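(* There exists a randomized algorithm that takes as input a full-rank matrix $A\in\mathbb{R}^{n\times d}$ with $n>d$ (so $\mathrm{rank}(A)=d$) and an error parameter $\epsilon\in(0,1/2]$, and returns real numbers $\tilde\ell_1,\ldots,\tilde\ell_n$ such that, with probability at least $0.8$ over the internal randomness of the algorithm, $$|\ell_i-\tilde\ell_i|\le\epsilon\,\ell_i\qquad\text{simultaneously for all } i\in\{1,\ldots,n\},$$ where $\ell_1,\dots,\ell_n$ are the statistical leverage scores of the rows of $A$. Moreover, assuming $d\le n\le e^d$, the running time of the algorithm is $$O\!\left(nd\ln(d\epsilon^{-1})+nd\,\epsilon^{-2}\ln n+d^3\epsilon^{-2}(\ln n)\,\ln(d\epsilon^{-1})\right),$$ with an absolute implied constant.
   Context: Statistical leverage scores: for $A\in\mathbb{R}^{n\times d}$ of rank $d$ with $n>d$, let $U\in\mathbb{R}^{n\times d}$ be the matrix whose columns are the $d$ left singular vectors of $A$ (from the thin SVD $A=U\Sigma V^T$), and let $U_{(i)}$ be its $i$-th row. The $i$-th statistical leverage score is $\ell_i=\|U_{(i)}\|_2^2$; equivalently $\ell_i=(P_A)_{ii}$, where $P_A=UU^T$ is the orthogonal projection onto the column space of $A$. Computational model: exact real arithmetic with unit-cost arithmetic operations, comparisons and random draws; as is standard, the SVD or QR decomposition of an $m\times p$ matrix with $m\ge p$ is taken to cost $O(mp^2)$. *)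

theory Defs
  imports
    "HOL-Probability.Probability_Mass_Function"
    "Jordan_Normal_Form.DL_Rank"
begin

section \<open>Thin SVD, thin QR, leverage scores\<close>

definition thin_svd :: "real mat \<Rightarrow> real mat \<Rightarrow> real mat \<Rightarrow> real mat \<Rightarrow> bool" where
  "thin_svd A U S V \<longleftrightarrow>
     (let m = dim_row A; p = dim_col A in
       U \<in> carrier_mat m p \<and> S \<in> carrier_mat p p \<and> V \<in> carrier_mat p p \<and>
       transpose_mat U * U = 1\<^sub>m p \<and> transpose_mat V * V = 1\<^sub>m p \<and>
       diagonal_mat S \<and>
       (\<forall>i<p. 0 \<le> S $$ (i, i)) \<and>
       (\<forall>i j. i \<le> j \<and> j < p \<longrightarrow> S $$ (j, j) \<le> S $$ (i, i)) \<and>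
       A = U * S * transpose_mat V)"

definition thin_qr :: "real mat \<Rightarrow> real mat \<Rightarrow> real mat \<Rightarrow> bool" where
  "thin_qr A Q R \<longleftrightarrow>
     (let m = dim_row A; p = dim_col A in
       Q \<in> carrier_mat m p \<and> R \<in> carrier_mat p p \<and>
       transpose_mat Q * Q = 1\<^sub>m p \<and> upper_triangular R \<and> A = Q * R)"

text \<open>The left factor of a thin SVD is not unique. If A has full column rank, its columns are
  in every case an orthonormal basis of the column space of A, so the row norms below do not
  depend on the choice.\<close>

definition left_singular :: "real mat \<Rightarrow> real mat" where
  "left_singular A = (SOME U. \<exists>S V. thin_svd A U S V)"

definition leverage_score :: "real mat \<Rightarrow> nat \<Rightarrow> real" where
  "leverage_score A i = (\<Sum>j<dim_col A. (left_singular A $$ (i, j))\<^sup>2)"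


section \<open>A randomized real RAM\<close>

text \<open>Programs are finite syntax trees. They contain natural number literals but no real
  constants, so a program cannot carry hidden information, and one program serves inputs of all
  sizes. Memory consists of named natural number arrays and named two-dimensional real arrays.
  Reals are exact, and can be combined by the field operations and compared. Naturals serve as
  indices and loop counters. They are only added, subtracted (truncated at 0) and compared, and
  can be converted to reals, but not conversely. This rules out the tricks that a unit-cost
  multiplication or division of large integers, or a unit-cost floor, would allow.\<close>

datatype iexp =
    INum nat
  | IGet string iexp
  | IAdd iexp iexp
  | ISub iexp iexp

datatype rexp =
    RNat iexp
  | RGet string iexp iexp
  | RAdd rexp rexp
  | RSub rexp rexp
  | RMul rexp rexp
  | RDiv rexp rexp

datatype test =
    ILess iexp iexp
  | RLess rexp rexp
  | Neg test
  | Conj test test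

datatype com =
    Skip
  | ISet string iexp iexp
  | RSet string iexp iexp rexp
  | Draw string iexp iexp
  | Seq com com
  | If test com com
  | While test com
  | Svd string iexp iexp string string string
  | Qr string iexp iexp string string

record store =
  ints :: "string \<Rightarrow> nat \<Rightarrow> nat"
  reals :: "string \<Rightarrow> nat \<Rightarrow> nat \<Rightarrow> real"

primrec ival :: "iexp \<Rightarrow> store \<Rightarrow> nat" where
  "ival (INum k) s = k"
| "ival (IGet x e) s = ints s x (ival e s)"
| "ival (IAdd e f) s = ival e s + ival f s"
| "ival (ISub e f) s = ival e s - ival f s"

primrec rval :: "rexp \<Rightarrow> store \<Rightarrow> real" where
  "rval (RNat e) s = real (ival e s)"
| "rval (RGet x e f) s = reals s x (ival e s) (ival f s)"
| "rval (RAdd a b) s = rval a s + rval b s"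
| "rval (RSub a b) s = rval a s - rval b s"
| "rval (RMul a b) s = rval a s * rval b s"
| "rval (RDiv a b) s = rval a s / rval b s"

primrec holds :: "test \<Rightarrow> store \<Rightarrow> bool" where
  "holds (ILess e f) s \<longleftrightarrow> ival e s < ival f s"
| "holds (RLess a b) s \<longleftrightarrow> rval a s < rval b s"
| "holds (Neg b) s \<longleftrightarrow> \<not> holds b s"
| "holds (Conj b c) s \<longleftrightarrow> holds b s \<and> holds c s"

text \<open>Evaluating an expression costs its number of nodes.\<close>

primrec icost :: "iexp \<Rightarrow> nat" where
  "icost (INum k) = 1"
| "icost (IGet x e) = icost e + 1"
| "icost (IAdd e f) = icost e + icost f + 1"
| "icost (ISub e f) = icost e + icost f + 1"

primrec rcost :: "rexp \<Rightarrow> nat" where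
  "rcost (RNat e) = icost e + 1"
| "rcost (RGet x e f) = icost e + icost f + 1"
| "rcost (RAdd a b) = rcost a + rcost b + 1"
| "rcost (RSub a b) = rcost a + rcost b + 1"
| "rcost (RMul a b) = rcost a + rcost b + 1"
| "rcost (RDiv a b) = rcost a + rcost b + 1"

primrec tcost :: "test \<Rightarrow> nat" where
  "tcost (ILess e f) = icost e + icost f + 1"
| "tcost (RLess a b) = rcost a + rcost b + 1"
| "tcost (Neg b) = tcost b + 1"
| "tcost (Conj b c) = tcost b + tcost c + 1"

definition set_int :: "string \<Rightarrow> nat \<Rightarrow> nat \<Rightarrow> store \<Rightarrow> store" where
  "set_int x i k s = s\<lparr>ints := (ints s)(x := (ints s x)(i := k))\<rparr>"

definition set_real :: "string \<Rightarrow> nat \<Rightarrow> nat \<Rightarrow> real \<Rightarrow> store \<Rightarrow> store" where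
  "set_real x i j r s =
     s\<lparr>reals := (reals s)(x := (reals s x)(i := (reals s x i)(j := r)))\<rparr>"

definition read_mat :: "string \<Rightarrow> nat \<Rightarrow> nat \<Rightarrow> store \<Rightarrow> real mat" where
  "read_mat x m p s = Matrix.mat m p (\<lambda>(i, j). reals s x i j)"

definition write_mat :: "string \<Rightarrow> real mat \<Rightarrow> store \<Rightarrow> store" where
  "write_mat x M s =
     s\<lparr>reals := (reals s)(x := (\<lambda>i j.
        if i < dim_row M \<and> j < dim_col M then M $$ (i, j) else reals s x i j))\<rparr>"

text \<open>The two factorization primitives are parameters of the machine: decompositions are not
  unique, and a program has to work whichever valid decomposition it is handed.\<close>

record factorizer =
  svd_of :: "real mat \<Rightarrow> real mat \<times> real mat \<times> real mat"
  qr_of :: "real mat \<Rightarrow> real mat \<times> real mat"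

definition valid_factorizer :: "factorizer \<Rightarrow> bool" where
  "valid_factorizer F \<longleftrightarrow>
     (\<forall>A. dim_col A \<le> dim_row A \<longrightarrow>
        (case svd_of F A of (U, S, V) \<Rightarrow> thin_svd A U S V) \<and>
        (case qr_of F A of (Q, R) \<Rightarrow> thin_qr A Q R))"

text \<open>A configuration consists of the stack of commands still to be executed, the store, and the
  time spent so far. The command \<open>Draw x e f\<close> stores a fresh uniform element of \<open>{0..k}\<close>, where
  \<open>k\<close> is the value of \<open>f\<close>. Factorizing an m by p matrix is charged \<open>m * p\<^sup>2\<close>; for \<open>m < p\<close> the
  primitives do nothing.\<close>

type_synonym config = "com list \<times> store \<times> nat"

fun step :: "factorizer \<Rightarrow> config \<Rightarrow> config pmf" where
  "step F ([], s, t) = return_pmf ([], s, t)"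
| "step F (Skip # K, s, t) = return_pmf (K, s, t + 1)"
| "step F (ISet x e f # K, s, t) =
     return_pmf (K, set_int x (ival e s) (ival f s) s, t + icost e + icost f + 1)"
| "step F (RSet x e f a # K, s, t) =
     return_pmf (K, set_real x (ival e s) (ival f s) (rval a s) s,
                 t + icost e + icost f + rcost a + 1)"
| "step F (Draw x e f # K, s, t) =
     map_pmf (\<lambda>k. (K, set_int x (ival e s) k s, t + icost e + icost f + 1))
             (pmf_of_set {0..ival f s})"
| "step F (Seq c d # K, s, t) = return_pmf (c # d # K, s, t + 1)"
| "step F (If b c d # K, s, t) =
     return_pmf ((if holds b s then c else d) # K, s, t + tcost b + 1)"
| "step F (While b c # K, s, t) =
     return_pmf (if holds b s then c # While b c # K else K, s, t + tcost b + 1)"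
| "step F (Svd x e f xu xs xv # K, s, t) =
     (let m = ival e s; p = ival f s; t' = t + icost e + icost f + m * p\<^sup>2 + 1 in
      return_pmf
        (if p \<le> m
         then (case svd_of F (read_mat x m p s) of (U, S, V) \<Rightarrow>
                 (K, write_mat xv V (write_mat xs S (write_mat xu U s)), t'))
         else (K, s, t')))"
| "step F (Qr x e f xq xr # K, s, t) =
     (let m = ival e s; p = ival f s; t' = t + icost e + icost f + m * p\<^sup>2 + 1 in
      return_pmf
        (if p \<le> m
         then (case qr_of F (read_mat x m p s) of (Q, R) \<Rightarrow>
                 (K, write_mat xr R (write_mat xq Q s), t'))
         else (K, s, t')))"

primrec run :: "factorizer \<Rightarrow> nat \<Rightarrow> config \<Rightarrow> config pmf" where
  "run F 0 cfg = return_pmf cfg"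
| "run F (Suc k) cfg = bind_pmf (step F cfg) (run F k)"

definition halted :: "config \<Rightarrow> bool" where
  "halted cfg \<longleftrightarrow> fst cfg = []"

definition time_spent :: "config \<Rightarrow> nat" where
  "time_spent cfg = snd (snd cfg)"


section \<open>Input and output of a leverage score algorithm\<close>

definition input_store :: "real mat \<Rightarrow> real \<Rightarrow> store" where
  "input_store A \<epsilon> =
     write_mat ''A'' A (set_real ''eps'' 0 0 \<epsilon>
       (set_int ''n'' 0 (dim_row A) (set_int ''d'' 0 (dim_col A)
         \<lparr>ints = (\<lambda>_ _. 0), reals = (\<lambda>_ _ _. 0)\<rparr>)))"

definition start :: "com \<Rightarrow> real mat \<Rightarrow> real \<Rightarrow> config" where
  "start P A \<epsilon> = ([P], input_store A \<epsilon>, 0)"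

definition returned_score :: "config \<Rightarrow> nat \<Rightarrow> real" where
  "returned_score cfg i = reals (fst (snd cfg)) ''l'' i 0"

end

theory Submission
  imports Defs "HOL-Probability.Product_PMF" "HOL-Analysis.L2_Norm"
begin

text \<open>
  The rows of \<open>A\<close> are given random signs and transformed by a Walsh-Hadamard matrix, which spreads
  the mass of the column space evenly over all \<open>N\<close> rows. Each of the \<open>r\<close> rows of the sketch is the sum
  of \<open>m = O(d ln n)\<close> transformed rows with random signs. So many summands make the fourth moment
  of a sketched unit vector \<open>O(1)\<close>, hence a scalar Chernoff bound for a fixed vector and a union
  bound over a grid of \<open>exp (O(d ln (d/\<epsilon>)))\<close> points give the lower bound \<open>\<parallel>S A z\<parallel>\<^sup>2 \<ge> (1 - \<epsilon>/4) \<parallel>A z\<parallel>\<^sup>2\<close> for all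
  \<open>z\<close>; no matrix concentration inequality is needed. The upper bound is only needed for the \<open>n\<close>
  projections of the standard basis vectors: by the Cauchy-Schwarz inequality the two bounds
  together confine every quadratic form of the inverse Gram matrix of \<open>S A\<close> at the rows of \<open>A\<close>,
  which are the leverage scores. These forms are squared norms, and are read off after a random
  sign projection to \<open>O(ln n / \<epsilon>\<^sup>2)\<close> dimensions.
\<close>

section \<open>Sums of independent symmetric random variables\<close>

text \<open>The two tails of a sketched quadratic form are unequally expensive, and this shapes the
  proof. The lower tail needs only a fourth moment, hence only that no single squared summand
  exceeds 1. With \<open>m\<close> equal to the bound 56 d L on the squared norm of a transformed
  row, this holds at every unit vector; the exponent is then of order r \<epsilon>^2 and survives a
  union over exp (O(d q)) grid points. The upper tail needs an exponential moment of a square, which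
  costs a factor \<kappa>, the largest squared inner product with a transformed row. This is O(L) at
  vectors that the random signs have flattened but is bounded only by \<open>m\<close> elsewhere,
  too weak for a union over the grid. Hence the upper bound is claimed at the n rows of
  \<open>U\<close> alone, and \<open>r\<close> is a sum of two requirements: d q for the grid, and
  L^2 for n vectors with \<kappa> = O(L). The sketch costs r m d, that is, d^3 L q / \<epsilon>^2
  plus d^2 L^3 / \<epsilon>^2; the second term is absorbed by comparing powers of L with n.
  Throughout, L and q are the ceilings of the binary logarithms of n and of d / \<epsilon>.\<close>

abbreviation prob :: "'a pmf \<Rightarrow> 'a set \<Rightarrow> real" where "prob p \<equiv> measure_pmf.prob p"

abbreviation expect :: "'a pmf \<Rightarrow> ('a \<Rightarrow> real) \<Rightarrow> real" where
  "expect p f \<equiv> measure_pmf.expectation p f"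

section \<open>Expectations under finitely supported and product distributions\<close>

lemma expect_mono:
  assumes "finite (set_pmf p)" "\<And>x. x \<in> set_pmf p \<Longrightarrow> f x \<le> g x"
  shows "expect p f \<le> expect p g"
  by (rule integral_mono_AE)
     (use assms in \<open>auto intro: integrable_measure_pmf_finite simp: AE_measure_pmf_iff\<close>)

lemma expect_cong:
  assumes "\<And>x. x \<in> set_pmf p \<Longrightarrow> f x = g x"
  shows "expect p f = expect p g"
  by (rule integral_cong_AE) (use assms in \<open>auto simp: AE_measure_pmf_iff\<close>)

lemma expect_add:
  assumes "finite (set_pmf p)"
  shows "expect p (\<lambda>x. f x + g x) = expect p f + expect p g"
  using assms by (intro Bochner_Integration.integral_add integrable_measure_pmf_finite)

lemma expect_sum:
  assumes "finite (set_pmf p)"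
  shows "expect p (\<lambda>x. \<Sum>i\<in>I. f i x) = (\<Sum>i\<in>I. expect p (f i))"
  using assms by (intro Bochner_Integration.integral_sum integrable_measure_pmf_finite)

lemma expect_bind:
  assumes "finite (set_pmf p)" "\<And>x. x \<in> set_pmf p \<Longrightarrow> finite (set_pmf (q x))"
  shows "expect (bind_pmf p q) f = expect p (\<lambda>x. expect (q x) f)"
proof -
  have "expect (bind_pmf p q) f = (\<Sum>a\<in>set_pmf p. pmf p a *\<^sub>R expect (q a) f)"
    using assms by (intro pmf_expectation_bind) auto
  also have "\<dots> = expect p (\<lambda>x. expect (q x) f)"
    by (subst integral_measure_pmf[OF assms(1)]) (auto simp: mult.commute)
  finally show ?thesis .
qed

lemma expect_pair:
  assumes "finite (set_pmf p)" "finite (set_pmf q)"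
  shows "expect (pair_pmf p q) f = expect p (\<lambda>x. expect q (\<lambda>y. f (x, y)))"
  unfolding pair_pmf_def using assms by (subst expect_bind; simp add: expect_bind)

lemma finite_set_Pi_pmf:
  assumes "finite A" "\<And>x. x \<in> A \<Longrightarrow> finite (set_pmf (p x))"
  shows "finite (set_pmf (Pi_pmf A dflt p))"
  using assms by (auto simp: set_Pi_pmf intro: finite_PiE_dflt)

lemma expect_Pi_insert:
  assumes "finite A" "x \<notin> A" "\<And>x. finite (set_pmf (p x))"
  shows "expect (Pi_pmf (insert x A) dflt p) g
       = expect (Pi_pmf A dflt p) (\<lambda>f. expect (p x) (\<lambda>y. g (f(x := y))))"
  using assms
  by (simp add: Pi_pmf_insert pair_commute_pmf[of "p x"] pmf.map_comp expect_pair finite_set_Pi_pmf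
      o_def case_prod_beta)

text \<open>The product distribution on a disjoint union is a pair of independent functions glued
  together, and \<open>g\<close> and \<open>h\<close> each see only one half of the glued
  function.\<close>

lemma expect_Pi_union:
  assumes "finite A" "finite B" "A \<inter> B = {}" "\<And>x. finite (set_pmf (p x))"
  assumes g: "\<And>f f'. (\<And>x. x \<in> A \<Longrightarrow> f x = f' x) \<Longrightarrow> g f = g f'"
  assumes h: "\<And>f f'. (\<And>x. x \<in> B \<Longrightarrow> f x = f' x) \<Longrightarrow> h f = h f'"
  shows "expect (Pi_pmf (A \<union> B) dflt p) (\<lambda>f. g f * h f)
       = expect (Pi_pmf A dflt p) g * expect (Pi_pmf B dflt p) h"
proof -
  let ?m = "\<lambda>(f, g') x. if x \<in> A then f x else g' x"
  have *: "g (?m (a, b)) = g a" "h (?m (a, b)) = h b" for a b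
    using assms(3) by (auto intro!: g h)
  have "expect (Pi_pmf (A \<union> B) dflt p) (\<lambda>f. g f * h f)
      = expect (pair_pmf (Pi_pmf A dflt p) (Pi_pmf B dflt p)) (\<lambda>x. g (?m x) * h (?m x))"
    using assms(1,2,3) by (simp add: Pi_pmf_union case_prod_unfold)
  also have "\<dots> = expect (pair_pmf (Pi_pmf A dflt p) (Pi_pmf B dflt p)) (\<lambda>x. g (fst x) * h (snd x))"
    using * by (intro expect_cong) auto
  also have "\<dots> = expect (Pi_pmf A dflt p) g * expect (Pi_pmf B dflt p) h"
    using assms(1,2,4) by (simp add: expect_pair finite_set_Pi_pmf)
  finally show ?thesis .
qed

lemma expect_Pi_blocks:
  fixes B :: "nat \<Rightarrow> 'i set" and g :: "nat \<Rightarrow> ('i \<Rightarrow> 'v) \<Rightarrow> real"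
  assumes "\<And>b. finite (B b)" "\<And>b c. b < c \<Longrightarrow> B b \<inter> B c = {}" "\<And>x. finite (set_pmf (p x))"
  assumes g: "\<And>b f f'. (\<And>x. x \<in> B b \<Longrightarrow> f x = f' x) \<Longrightarrow> g b f = g b f'"
  shows "expect (Pi_pmf (\<Union>b<r. B b) dflt p) (\<lambda>f. \<Prod>b<r. g b f)
       = (\<Prod>b<r. expect (Pi_pmf (B b) dflt p) (g b))"
proof (induction r)
  case (Suc r)
  have U: "(\<Union>b<Suc r. B b) = (\<Union>b<r. B b) \<union> B r"
    by (auto simp: less_Suc_eq)
  have "expect (Pi_pmf ((\<Union>b<r. B b) \<union> B r) dflt p) (\<lambda>f. (\<Prod>b<r. g b f) * g r f)
     = expect (Pi_pmf (\<Union>b<r. B b) dflt p) (\<lambda>f. \<Prod>b<r. g b f) * expect (Pi_pmf (B r) dflt p) (g r)"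
  proof (rule expect_Pi_union)
    show "(\<Union>b<r. B b) \<inter> B r = {}" using assms(2) by auto
    show "(\<Prod>b<r. g b f) = (\<Prod>b<r. g b f')" if "\<And>x. x \<in> (\<Union>b<r. B b) \<Longrightarrow> f x = f' x" for f f'
      using that by (intro prod.cong refl g) auto
    show "g r f = g r f'" if "\<And>x. x \<in> B r \<Longrightarrow> f x = f' x" for f f'
      using that by (rule g)
  qed (simp_all add: assms(1,3))
  then show ?case
    by (simp add: U Suc.IH)
qed simp

lemma markov_pmf:
  assumes "finite (set_pmf p)" "\<And>x. x \<in> set_pmf p \<Longrightarrow> 0 \<le> f x" "0 < c"
    and "\<And>x. x \<in> set_pmf p \<Longrightarrow> x \<in> Bad \<Longrightarrow> c \<le> f x"
  shows "prob p Bad \<le> expect p f / c"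
proof -
  have "prob p Bad = expect p (indicator Bad)" by simp
  also have "\<dots> \<le> expect p (\<lambda>x. f x / c)"
    using assms by (intro expect_mono) (auto simp: indicator_def field_simps)
  finally show ?thesis by simp
qed

text \<open>The power series are compared term by term, which needs only 2^n n! \<le> (2n)!. It
  bounds the average of exp over a random sign.\<close>

lemma cosh_le: "cosh (t::real) \<le> exp (t\<^sup>2 / 2)"
proof -
  have "fact n * 2 ^ n \<le> (fact (2 * n) :: real)" for n
  proof (induction n)
    case (Suc n)
    have "fact (Suc n) * 2 ^ Suc n = (2 * real n + 2) * (fact n * 2 ^ n :: real)" by (simp add: algebra_simps)
    also have "\<dots> \<le> (2 * real n + 2) * (2 * real n + 1) * fact (2 * n)"
    proof -
      have "(fact n * 2 ^ n :: real) \<le> (2 * real n + 1) * fact (2 * n)"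
        by (rule order_trans[OF Suc.IH]) simp
      then show ?thesis by (simp add: mult.assoc mult_left_mono)
    qed
    also have "\<dots> = fact (2 * Suc n)" by (simp add: algebra_simps)
    finally show ?case .
  qed simp
  then have *: "t ^ (2*n) / fact (2*n) \<le> (t\<^sup>2/2) ^ n / fact n" for n :: nat
  proof -
    have "t ^ (2*n) / fact (2*n) \<le> t ^ (2*n) / (fact n * 2 ^ n)"
      using \<open>fact n * 2 ^ n \<le> (fact (2 * n) :: real)\<close> by (intro divide_left_mono) (auto simp: power_mult)
    then show ?thesis by (simp add: power_mult[of t] power_divide mult.commute[of _ "fact n"])
  qed
  have "(\<lambda>n. if even n then t ^ n /\<^sub>R fact n else 0) sums cosh t" by (rule cosh_converges)
  then have "(\<lambda>n. t ^ (2*n) / fact (2*n)) sums cosh t"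
    by (subst (asm) sums_mono_reindex[of "\<lambda>n. 2*n", symmetric])
       (auto simp: strict_mono_def divide_inverse mult.commute elim!: evenE)
  moreover have "(\<lambda>n. (t\<^sup>2/2) ^ n / fact n) sums exp (t\<^sup>2/2)"
    using exp_converges[of "t\<^sup>2/2"] by (simp only: real_scaleR_def divide_inverse mult.commute)
  ultimately show ?thesis by (rule sums_le[OF *])
qed

text \<open>The third Taylor remainder has the sign of (-t)^3. The quadratic term is what turns a
  fourth moment of a sum into a bound on its lower tail.\<close>

lemma exp_neg_le:
  assumes "0 \<le> (t::real)"
  shows "exp (- t) \<le> 1 - t + t\<^sup>2 / 2"
proof -
  have "\<exists>u. \<bar>u\<bar> \<le> \<bar>- t\<bar> \<and> exp (- t) = (\<Sum>m<3. (- t) ^ m / fact m) + exp u / fact 3 * (- t) ^ 3"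
    by (rule Maclaurin_exp_le)
  then obtain u where "exp (- t) = (\<Sum>m<3. (- t) ^ m / fact m) + exp u / fact 3 * (- t) ^ 3" by blast
  moreover have "exp u / fact 3 * (- t) ^ 3 \<le> 0"
    using assms by (intro mult_nonneg_nonpos) auto
  ultimately show ?thesis by (simp add: eval_nat_numeral fact_numeral)
qed

text \<open>The drawn value \<open>v\<close> is a raw natural number, and \<open>\<xi>\<close>
  decodes it. The pointwise bound \<open>\<kappa>\<close> is kept apart from the variance
  \<open>s\<close>: for random signs the two agree, but for a sampled row \<open>\<kappa>\<close>
  may be much larger, and only the variance may enter the main term of a tail bound.\<close>

locale sym_vars =
  fixes p :: "'i \<Rightarrow> 'v pmf" and dflt :: 'v and \<xi> :: "'i \<Rightarrow> 'v \<Rightarrow> real" and \<kappa> s :: "'i \<Rightarrow> real"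
  assumes fin: "finite (set_pmf (p l))"
    and sym: "expect (p l) (\<lambda>v. h (\<xi> l v)) = expect (p l) (\<lambda>v. h (- \<xi> l v))"
    and bnd: "v \<in> set_pmf (p l) \<Longrightarrow> (\<xi> l v)\<^sup>2 \<le> \<kappa> l"
    and sec: "expect (p l) (\<lambda>v. (\<xi> l v)\<^sup>2) = s l"
begin

abbreviation "Y S f \<equiv> (\<Sum>l\<in>S. \<xi> l (f l))"

lemma kappa_nonneg: "0 \<le> \<kappa> l"
proof -
  obtain v where "v \<in> set_pmf (p l)" using set_pmf_not_empty by fast
  from bnd[OF this] show ?thesis by (meson order_trans zero_le_power2)
qed

lemma s_nonneg: "0 \<le> s l"
  unfolding sec[symmetric] by (intro integral_nonneg_AE) auto

lemma expect_sym:
  "expect (p l) (\<lambda>v. h (\<xi> l v)) = expect (p l) (\<lambda>v. (h (\<xi> l v) + h (- \<xi> l v)) / 2)"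
proof -
  have "expect (p l) (\<lambda>v. (h (\<xi> l v) + h (- \<xi> l v)) / 2)
     = (expect (p l) (\<lambda>v. h (\<xi> l v)) + expect (p l) (\<lambda>v. h (- \<xi> l v))) / 2"
    by (simp add: expect_add[OF fin])
  then show ?thesis using sym[of l h] by simp
qed

text \<open>One variable is integrated out. Averaging over its sign turns the cross term into a
  cosh, which raises the coefficient of the square of \<open>x\<close>. The remaining factor is
  expanded with exp t \<le> 1 + t + t^2, so that it costs the variance \<open>s\<close> and not
  \<open>\<kappa>\<close>.\<close>

lemma mgf_step:
  assumes "0 \<le> \<mu>" "\<mu> * \<kappa> l \<le> 1"
  shows "expect (p l) (\<lambda>v. exp (\<mu> * (x + \<xi> l v)\<^sup>2))
       \<le> exp ((\<mu> + 2 * \<mu>\<^sup>2 * \<kappa> l) * x\<^sup>2) * exp (\<mu> * s l * (1 + \<mu> * \<kappa> l))"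
proof -
  have 1: "(exp (\<mu> * (x + y)\<^sup>2) + exp (\<mu> * (x + - y)\<^sup>2)) / 2
      \<le> exp ((\<mu> + 2 * \<mu>\<^sup>2 * \<kappa> l) * x\<^sup>2) * (1 + \<mu> * y\<^sup>2 * (1 + \<mu> * \<kappa> l))" if y: "y\<^sup>2 \<le> \<kappa> l" for y
  proof -
    have "(exp (\<mu> * (x + y)\<^sup>2) + exp (\<mu> * (x + - y)\<^sup>2)) / 2
        = exp (\<mu> * x\<^sup>2 + \<mu> * y\<^sup>2) * cosh (2 * \<mu> * x * y)"
      unfolding cosh_def by (simp add: algebra_simps power2_eq_square flip: exp_add)
    also have "\<dots> \<le> exp (\<mu> * x\<^sup>2 + \<mu> * y\<^sup>2) * exp ((2 * \<mu> * x * y)\<^sup>2 / 2)"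
      by (intro mult_left_mono cosh_le) auto
    also have "\<dots> = exp (\<mu> * x\<^sup>2 + 2 * \<mu>\<^sup>2 * x\<^sup>2 * y\<^sup>2) * exp (\<mu> * y\<^sup>2)"
      by (simp add: power_mult_distrib algebra_simps flip: exp_add)
    also have "\<dots> \<le> exp ((\<mu> + 2 * \<mu>\<^sup>2 * \<kappa> l) * x\<^sup>2) * (1 + \<mu> * y\<^sup>2 * (1 + \<mu> * \<kappa> l))"
    proof (intro mult_mono)
      have "2 * \<mu>\<^sup>2 * x\<^sup>2 * y\<^sup>2 \<le> 2 * \<mu>\<^sup>2 * x\<^sup>2 * \<kappa> l" using y by (intro mult_left_mono) auto
      then show "exp (\<mu> * x\<^sup>2 + 2 * \<mu>\<^sup>2 * x\<^sup>2 * y\<^sup>2) \<le> exp ((\<mu> + 2 * \<mu>\<^sup>2 * \<kappa> l) * x\<^sup>2)"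
        by (simp add: algebra_simps)
      have my: "\<mu> * y\<^sup>2 \<le> \<mu> * \<kappa> l" using y assms(1) by (intro mult_left_mono)
      have "exp (\<mu> * y\<^sup>2) \<le> 1 + \<mu> * y\<^sup>2 + (\<mu> * y\<^sup>2)\<^sup>2"
        using assms my by (intro exp_bound) auto
      also have "\<dots> \<le> 1 + \<mu> * y\<^sup>2 * (1 + \<mu> * \<kappa> l)"
        using mult_left_mono[OF my, of "\<mu> * y\<^sup>2"] assms(1) by (simp add: power2_eq_square algebra_simps)
      finally show "exp (\<mu> * y\<^sup>2) \<le> 1 + \<mu> * y\<^sup>2 * (1 + \<mu> * \<kappa> l)" .
    qed auto
    finally show ?thesis .
  qed
  have "expect (p l) (\<lambda>v. exp (\<mu> * (x + \<xi> l v)\<^sup>2))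
      = expect (p l) (\<lambda>v. (exp (\<mu> * (x + \<xi> l v)\<^sup>2) + exp (\<mu> * (x + - \<xi> l v)\<^sup>2)) / 2)"
    by (rule expect_sym)
  also have "\<dots> \<le> expect (p l) (\<lambda>v. exp ((\<mu> + 2 * \<mu>\<^sup>2 * \<kappa> l) * x\<^sup>2) * (1 + \<mu> * (\<xi> l v)\<^sup>2 * (1 + \<mu> * \<kappa> l)))"
    by (intro expect_mono fin 1 bnd)
  also have "\<dots> = exp ((\<mu> + 2 * \<mu>\<^sup>2 * \<kappa> l) * x\<^sup>2) * (1 + \<mu> * s l * (1 + \<mu> * \<kappa> l))"
    by (simp add: expect_add fin flip: sec)
  also have "\<dots> \<le> exp ((\<mu> + 2 * \<mu>\<^sup>2 * \<kappa> l) * x\<^sup>2) * exp (\<mu> * s l * (1 + \<mu> * \<kappa> l))"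
    by (intro mult_left_mono exp_ge_add_one_self) auto
  finally show ?thesis .
qed

text \<open>Each variable that is integrated out raises the coefficient of the square. The third
  hypothesis says that all increments together stay below the ceiling \<nu>, and the induction
  restores it for the raised coefficient and the remaining variables.\<close>

lemma mgf_square:
  assumes "finite S" "0 \<le> \<mu>" "\<mu> + 2 * \<nu>\<^sup>2 * (\<Sum>l\<in>S. \<kappa> l) \<le> \<nu>" "\<And>l. l \<in> S \<Longrightarrow> \<nu> * \<kappa> l \<le> 1"
  shows "expect (Pi_pmf S dflt p) (\<lambda>f. exp (\<mu> * (x + Y S f)\<^sup>2))
       \<le> exp (\<nu> * x\<^sup>2 + \<nu> * (\<Sum>l\<in>S. s l * (1 + \<nu> * \<kappa> l)))"
  using assms
proof (induction S arbitrary: \<mu> rule: finite_induct)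
  case empty
  then show ?case by (auto intro!: mult_right_mono)
next
  case (insert l S)
  have K: "0 \<le> (\<Sum>l\<in>S. \<kappa> l)" by (intro sum_nonneg kappa_nonneg)
  have "\<mu> \<le> \<nu>"
  proof -
    have "0 \<le> 2 * \<nu>\<^sup>2 * (\<Sum>l\<in>insert l S. \<kappa> l)" by (intro mult_nonneg_nonneg sum_nonneg kappa_nonneg) auto
    then show ?thesis using insert.prems by linarith
  qed
  define \<mu>' where "\<mu>' = \<mu> + 2 * \<mu>\<^sup>2 * \<kappa> l"
  have "\<mu>' \<le> \<mu> + 2 * \<nu>\<^sup>2 * \<kappa> l"
    unfolding \<mu>'_def using \<open>\<mu> \<le> \<nu>\<close> \<open>0 \<le> \<mu>\<close> kappa_nonneg[of l]
    by (intro add_left_mono mult_right_mono mult_left_mono power_mono) auto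
  then have \<mu>': "\<mu>' + 2 * \<nu>\<^sup>2 * (\<Sum>l\<in>S. \<kappa> l) \<le> \<nu>" "0 \<le> \<mu>'"
    using insert by (auto simp: algebra_simps \<mu>'_def kappa_nonneg)
  have \<mu>\<kappa>: "\<mu> * \<kappa> l \<le> \<nu> * \<kappa> l" using \<open>\<mu> \<le> \<nu>\<close> kappa_nonneg by (intro mult_right_mono)
  then have \<mu>\<kappa>1: "\<mu> * \<kappa> l \<le> 1" using insert.prems(3)[of l] by simp
  have Y: "Y (insert l S) (f(l := v)) = Y S f + \<xi> l v" for f v
    using insert.hyps by (auto simp: add.commute intro!: sum.cong)
  have fS: "finite (set_pmf (Pi_pmf S dflt p))" using insert fin by (intro finite_set_Pi_pmf)
  have ms: "\<mu> * s l * (1 + \<mu> * \<kappa> l) \<le> \<nu> * (s l * (1 + \<nu> * \<kappa> l))"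
    unfolding mult.assoc using \<open>\<mu> \<le> \<nu>\<close> \<open>0 \<le> \<mu>\<close> kappa_nonneg[of l] s_nonneg[of l] \<mu>\<kappa>
    by (intro mult_mono add_mono) auto
  have "expect (Pi_pmf (insert l S) dflt p) (\<lambda>f. exp (\<mu> * (x + Y (insert l S) f)\<^sup>2))
     = expect (Pi_pmf S dflt p) (\<lambda>f. expect (p l) (\<lambda>v. exp (\<mu> * ((x + Y S f) + \<xi> l v)\<^sup>2)))"
    unfolding expect_Pi_insert[OF insert.hyps fin] Y add.assoc ..
  also have "\<dots> \<le> expect (Pi_pmf S dflt p) (\<lambda>f. exp (\<mu>' * (x + Y S f)\<^sup>2) * exp (\<mu> * s l * (1 + \<mu> * \<kappa> l)))"
    unfolding \<mu>'_def by (intro expect_mono fS mgf_step insert \<mu>\<kappa>1)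
  also have "\<dots> = expect (Pi_pmf S dflt p) (\<lambda>f. exp (\<mu>' * (x + Y S f)\<^sup>2)) * exp (\<mu> * s l * (1 + \<mu> * \<kappa> l))"
    by simp
  also have "\<dots> \<le> exp (\<nu> * x\<^sup>2 + \<nu> * (\<Sum>l\<in>S. s l * (1 + \<nu> * \<kappa> l))) * exp (\<nu> * (s l * (1 + \<nu> * \<kappa> l)))"
    using insert \<mu>' ms by (intro mult_mono) auto
  also have "\<dots> = exp (\<nu> * x\<^sup>2 + \<nu> * (\<Sum>l\<in>insert l S. s l * (1 + \<nu> * \<kappa> l)))"
    using insert.hyps by (simp add: algebra_simps flip: exp_add)
  finally show ?case .
qed

text \<open>By symmetry only the even terms of (x + y)^2 and (x + y)^4 survive. The fourth moment is
  at most the Gaussian value, three times the squared variance, plus a correction; the induction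
  step completes the square.\<close>

lemma moments:
  assumes "finite S"
  shows "expect (Pi_pmf S dflt p) (\<lambda>f. (Y S f)\<^sup>2) = (\<Sum>l\<in>S. s l)"
    and "expect (Pi_pmf S dflt p) (\<lambda>f. (Y S f) ^ 4) \<le> 3 * (\<Sum>l\<in>S. s l)\<^sup>2 + (\<Sum>l\<in>S. \<kappa> l * s l)"
  using assms
proof (induction S rule: finite_induct)
  case (insert l S)
  have Y: "Y (insert l S) (f(l := v)) = Y S f + \<xi> l v" for f v
    using insert.hyps by (auto simp: add.commute intro!: sum.cong)
  have fS: "finite (set_pmf (Pi_pmf S dflt p))" using insert fin by (intro finite_set_Pi_pmf)
  have 2: "expect (p l) (\<lambda>v. (x + \<xi> l v)\<^sup>2) = x\<^sup>2 + s l" for x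
  proof -
    have "expect (p l) (\<lambda>v. (x + \<xi> l v)\<^sup>2) = expect (p l) (\<lambda>v. ((x + \<xi> l v)\<^sup>2 + (x + - \<xi> l v)\<^sup>2) / 2)"
      by (rule expect_sym)
    also have "\<dots> = expect (p l) (\<lambda>v. x\<^sup>2 + (\<xi> l v)\<^sup>2)"
      by (intro expect_cong) (simp add: power2_eq_square algebra_simps)
    finally show ?thesis by (simp add: expect_add fin sec)
  qed
  have 4: "expect (p l) (\<lambda>v. (x + \<xi> l v) ^ 4) \<le> x ^ 4 + 6 * s l * x\<^sup>2 + \<kappa> l * s l" for x
  proof -
    have "expect (p l) (\<lambda>v. (x + \<xi> l v) ^ 4) = expect (p l) (\<lambda>v. ((x + \<xi> l v) ^ 4 + (x + - \<xi> l v) ^ 4) / 2)"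
      by (rule expect_sym)
    also have "\<dots> = expect (p l) (\<lambda>v. x ^ 4 + 6 * (\<xi> l v)\<^sup>2 * x\<^sup>2 + (\<xi> l v)\<^sup>2 * (\<xi> l v)\<^sup>2)"
      by (intro expect_cong) (simp add: eval_nat_numeral algebra_simps)
    also have "\<dots> \<le> expect (p l) (\<lambda>v. x ^ 4 + 6 * (\<xi> l v)\<^sup>2 * x\<^sup>2 + \<kappa> l * (\<xi> l v)\<^sup>2)"
      by (intro expect_mono fin add_left_mono mult_right_mono bnd) auto
    also have "\<dots> = x ^ 4 + 6 * s l * x\<^sup>2 + \<kappa> l * s l"
      by (simp add: expect_add fin flip: sec)
    finally show ?thesis .
  qed
  show "expect (Pi_pmf (insert l S) dflt p) (\<lambda>f. (Y (insert l S) f)\<^sup>2) = (\<Sum>l\<in>insert l S. s l)"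
    unfolding expect_Pi_insert[OF insert.hyps fin] Y 2 using insert by (simp add: expect_add fS)
  have "expect (Pi_pmf (insert l S) dflt p) (\<lambda>f. (Y (insert l S) f) ^ 4)
      = expect (Pi_pmf S dflt p) (\<lambda>f. expect (p l) (\<lambda>v. (Y S f + \<xi> l v) ^ 4))"
    unfolding expect_Pi_insert[OF insert.hyps fin] Y ..
  also have "\<dots> \<le> expect (Pi_pmf S dflt p) (\<lambda>f. (Y S f) ^ 4 + 6 * s l * (Y S f)\<^sup>2 + \<kappa> l * s l)"
    by (intro expect_mono fS 4)
  also have "\<dots> = expect (Pi_pmf S dflt p) (\<lambda>f. (Y S f) ^ 4) + 6 * s l * (\<Sum>l\<in>S. s l) + \<kappa> l * s l"
    using insert by (simp add: expect_add fS)
  also have "\<dots> \<le> 3 * (\<Sum>l\<in>S. s l)\<^sup>2 + (\<Sum>l\<in>S. \<kappa> l * s l) + 6 * s l * (\<Sum>l\<in>S. s l) + \<kappa> l * s l"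
    using insert by simp
  also have "\<dots> \<le> 3 * (\<Sum>l\<in>insert l S. s l)\<^sup>2 + (\<Sum>l\<in>insert l S. \<kappa> l * s l)"
    using insert.hyps by (simp add: power2_eq_square algebra_simps)
  finally show "expect (Pi_pmf (insert l S) dflt p) (\<lambda>f. (Y (insert l S) f) ^ 4)
      \<le> 3 * (\<Sum>l\<in>insert l S. s l)\<^sup>2 + (\<Sum>l\<in>insert l S. \<kappa> l * s l)" .
qed simp_all

text \<open>For a negative exponent the second-order expansion is valid at any size, so a fourth
  moment of at most 4 suffices. Each single \<open>\<kappa>\<close> has to be bounded but not their
  sum, which is the advantage of the lower tail.\<close>

lemma mgf_lower:
  assumes "finite S" "0 \<le> \<mu>" "(\<Sum>l\<in>S. s l) = 1" "\<And>l. l \<in> S \<Longrightarrow> \<kappa> l \<le> 1"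
  shows "expect (Pi_pmf S dflt p) (\<lambda>f. exp (- (\<mu> * (Y S f)\<^sup>2))) \<le> exp (- \<mu> + 2 * \<mu>\<^sup>2)"
proof -
  have fS: "finite (set_pmf (Pi_pmf S dflt p))" using assms fin by (intro finite_set_Pi_pmf)
  have "(\<Sum>l\<in>S. \<kappa> l * s l) \<le> (\<Sum>l\<in>S. 1 * s l)"
    using assms s_nonneg by (intro sum_mono mult_right_mono)
  then have 4: "expect (Pi_pmf S dflt p) (\<lambda>f. (Y S f) ^ 4) \<le> 4"
    using moments(2)[OF assms(1)] assms(3) by simp
  have "expect (Pi_pmf S dflt p) (\<lambda>f. exp (- (\<mu> * (Y S f)\<^sup>2)))
     \<le> expect (Pi_pmf S dflt p) (\<lambda>f. 1 + - \<mu> * (Y S f)\<^sup>2 + \<mu>\<^sup>2 / 2 * (Y S f) ^ 4)"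
  proof (intro expect_mono fS)
    fix f
    have "exp (- (\<mu> * (Y S f)\<^sup>2)) \<le> 1 - (\<mu> * (Y S f)\<^sup>2) + (\<mu> * (Y S f)\<^sup>2)\<^sup>2 / 2"
      using assms by (intro exp_neg_le) auto
    then show "exp (- (\<mu> * (Y S f)\<^sup>2)) \<le> 1 + - \<mu> * (Y S f)\<^sup>2 + \<mu>\<^sup>2 / 2 * (Y S f) ^ 4"
      by (simp add: power_mult_distrib flip: power_mult)
  qed
  also have "\<dots> = 1 + - \<mu> * (\<Sum>l\<in>S. s l) + \<mu>\<^sup>2 / 2 * expect (Pi_pmf S dflt p) (\<lambda>f. (Y S f) ^ 4)"
    by (simp only: expect_add fS) (simp add: moments(1)[OF assms(1)])
  also have "\<dots> \<le> 1 + (- \<mu> + 2 * \<mu>\<^sup>2)"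
    using mult_left_mono[OF 4, of "\<mu>\<^sup>2 / 2"] assms(3) by simp
  also have "\<dots> \<le> exp (- \<mu> + 2 * \<mu>\<^sup>2)" by (rule exp_ge_add_one_self)
  finally show ?thesis .
qed

section \<open>Chernoff bounds for sums of squares over disjoint blocks\<close>

context
  fixes B :: "nat \<Rightarrow> 'i set" and K :: real
  assumes B: "\<And>b. finite (B b)" "\<And>b c. b < c \<Longrightarrow> B b \<inter> B c = {}"
    and B1: "\<And>b. (\<Sum>l\<in>B b. s l) = 1"
begin

text \<open>\<theta> may have either sign, so that both tails are instances; a negative \<theta>
  gives the lower one.\<close>

lemma chernoff_blocks:
  assumes block: "\<And>b. expect (Pi_pmf (B b) dflt p) (\<lambda>f. exp (\<theta> * (Y (B b) f)\<^sup>2)) \<le> exp c"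
    and Bad: "\<And>f. f \<in> Bad \<Longrightarrow> a \<le> \<theta> * (\<Sum>b<r. (Y (B b) f)\<^sup>2)"
  shows "prob (Pi_pmf (\<Union>b<r. B b) dflt p) Bad \<le> exp (real r * c - a)"
proof -
  let ?P = "Pi_pmf (\<Union>b<r. B b) dflt p"
  have fin': "finite (set_pmf ?P)" using B fin by (intro finite_set_Pi_pmf) auto
  have "prob ?P Bad \<le> expect ?P (\<lambda>f. \<Prod>b<r. exp (\<theta> * (Y (B b) f)\<^sup>2)) / exp a"
    by (rule markov_pmf[OF fin']) (use Bad in \<open>auto intro: prod_nonneg simp: sum_distrib_left simp flip: exp_sum\<close>)
  also have "expect ?P (\<lambda>f. \<Prod>b<r. exp (\<theta> * (Y (B b) f)\<^sup>2))
       = (\<Prod>b<r. expect (Pi_pmf (B b) dflt p) (\<lambda>f. exp (\<theta> * (Y (B b) f)\<^sup>2)))"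
    using B fin by (intro expect_Pi_blocks) (auto cong: sum.cong)
  also have "\<dots> \<le> (\<Prod>b<r. exp c)"
    by (intro prod_mono block conjI integral_nonneg_AE) auto
  also have "\<dots> = exp (real r * c)" by (simp add: exp_of_nat_mult)
  finally show ?thesis by (simp add: divide_right_mono exp_diff)
qed

lemma upper_tail:
  assumes K: "\<And>b. (\<Sum>l\<in>B b. \<kappa> l) \<le> K" "0 < K" and \<delta>: "0 < \<delta>" "\<delta> \<le> 1"
  shows "prob (Pi_pmf (\<Union>b<r. B b) dflt p) {f. (1 + \<delta>) * real r < (\<Sum>b<r. (Y (B b) f)\<^sup>2)}
     \<le> exp (- (real r * \<delta>\<^sup>2 / (20 * K)))"
proof -
  \<comment> \<open>\<nu> is linear in \<delta>, so that \<nu> K = \<delta> / 10 is a small relative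
    error. \<mu> is then the largest coefficient that \<open>mgf_square\<close> permits under the
    ceiling \<nu> for blocks with total \<open>K\<close>.\<close>
  define \<nu> where "\<nu> = \<delta> / (10 * K)"
  define \<mu> where "\<mu> = \<nu> - 2 * \<nu>\<^sup>2 * K"
  have \<nu>: "0 < \<nu>" "\<nu> * K = \<delta> / 10" using assms by (auto simp: \<nu>_def)
  have "\<mu> = \<nu> * (1 - 2 * (\<nu> * K))" by (simp add: \<mu>_def power2_eq_square algebra_simps)
  then have \<mu>: "0 \<le> \<mu>" "\<mu> = \<nu> * (1 - \<delta> / 5)" using \<nu> \<delta> by auto
  have \<kappa>K: "\<kappa> l \<le> K" if "l \<in> B b" for l b
    using member_le_sum[of l "B b" \<kappa>] K(1)[of b] kappa_nonneg B that by fastforce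
  have block: "expect (Pi_pmf (B b) dflt p) (\<lambda>f. exp (\<mu> * (Y (B b) f)\<^sup>2)) \<le> exp (\<nu> * (1 + \<nu> * K))" for b
  proof -
    have "expect (Pi_pmf (B b) dflt p) (\<lambda>f. exp (\<mu> * (0 + Y (B b) f)\<^sup>2))
       \<le> exp (\<nu> * 0\<^sup>2 + \<nu> * (\<Sum>l\<in>B b. s l * (1 + \<nu> * \<kappa> l)))"
    proof (rule mgf_square[OF B(1) \<mu>(1)])
      have "2 * \<nu>\<^sup>2 * (\<Sum>l\<in>B b. \<kappa> l) \<le> 2 * \<nu>\<^sup>2 * K" using K by (intro mult_left_mono) auto
      then show "\<mu> + 2 * \<nu>\<^sup>2 * (\<Sum>l\<in>B b. \<kappa> l) \<le> \<nu>" by (simp add: \<mu>_def)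
      show "\<nu> * \<kappa> l \<le> 1" if "l \<in> B b" for l
        using mult_left_mono[OF \<kappa>K[OF that], of \<nu>] \<nu> \<delta> by simp
    qed
    also have "(\<Sum>l\<in>B b. s l * (1 + \<nu> * \<kappa> l)) \<le> (\<Sum>l\<in>B b. s l * (1 + \<nu> * K))"
      using \<nu> \<kappa>K s_nonneg by (intro sum_mono mult_left_mono add_left_mono) auto
    also have "\<dots> = 1 + \<nu> * K" by (simp add: B1 flip: sum_distrib_right)
    finally show ?thesis using \<nu>(1) by simp
  qed
  have "prob (Pi_pmf (\<Union>b<r. B b) dflt p) {f. (1 + \<delta>) * real r < (\<Sum>b<r. (Y (B b) f)\<^sup>2)}
     \<le> exp (real r * (\<nu> * (1 + \<nu> * K)) - \<mu> * ((1 + \<delta>) * real r))"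
    by (rule chernoff_blocks[OF block]) (use \<mu>(1) in \<open>auto intro: mult_left_mono\<close>)
  also have "\<dots> = exp (real r * (\<nu> * (1 + \<nu> * K) - \<mu> * (1 + \<delta>)))"
    by (simp add: algebra_simps)
  also have "\<dots> \<le> exp (real r * (- (\<delta>\<^sup>2 / (20 * K))))"
  proof -
    have dd: "\<delta> * \<delta> \<le> \<delta>" using \<delta> by (simp add: mult_left_le)
    have "\<nu> * (1 + \<nu> * K) - \<mu> * (1 + \<delta>) = \<nu> * (\<delta> / 10 - \<delta> + \<delta> / 5 + \<delta> * \<delta> / 5)"
      unfolding \<mu> \<nu> by (simp add: algebra_simps)
    also have "\<nu> * (\<delta> / 10 - \<delta> + \<delta> / 5 + \<delta> * \<delta> / 5) \<le> \<nu> * (- (\<delta> / 2))"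
      using \<nu>(1) \<delta>(1) dd by (intro mult_left_mono) linarith+
    also have "\<dots> = - (\<delta>\<^sup>2 / (20 * K))" by (simp add: \<nu>_def power2_eq_square)
    finally show ?thesis using mult_left_mono of_nat_0_le_iff exp_le_cancel_iff by blast
  qed
  finally show ?thesis by (simp add: divide_right_mono)
qed

lemma lower_tail:
  assumes K: "\<And>b l. l \<in> B b \<Longrightarrow> \<kappa> l \<le> 1" and \<delta>: "0 < \<delta>"
  shows "prob (Pi_pmf (\<Union>b<r. B b) dflt p) {f. (\<Sum>b<r. (Y (B b) f)\<^sup>2) < (1 - \<delta>) * real r}
     \<le> exp (- (real r * \<delta>\<^sup>2 / 8))"
proof -
  \<comment> \<open>This minimizes the exponent 2 \<mu>^2 - \<delta> \<mu> of a block.\<close>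
  define \<mu> where "\<mu> = \<delta> / 4"
  have \<mu>: "0 \<le> \<mu>" using \<delta> by (simp add: \<mu>_def)
  have "prob (Pi_pmf (\<Union>b<r. B b) dflt p) {f. (\<Sum>b<r. (Y (B b) f)\<^sup>2) < (1 - \<delta>) * real r}
     \<le> exp (real r * (- \<mu> + 2 * \<mu>\<^sup>2) - - (\<mu> * ((1 - \<delta>) * real r)))"
  proof (rule chernoff_blocks)
    show "expect (Pi_pmf (B b) dflt p) (\<lambda>f. exp (- \<mu> * (Y (B b) f)\<^sup>2)) \<le> exp (- \<mu> + 2 * \<mu>\<^sup>2)" for b
      using mgf_lower[OF B(1) \<mu> B1 K] by simp
  qed (use \<mu> in \<open>auto intro: mult_left_mono\<close>)
  also have "\<dots> = exp (real r * (- \<mu> + 2 * \<mu>\<^sup>2 + \<mu> * (1 - \<delta>)))"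
    by (simp add: algebra_simps)
  also have "- \<mu> + 2 * \<mu>\<^sup>2 + \<mu> * (1 - \<delta>) = - (\<delta>\<^sup>2 / 8)"
    by (simp add: \<mu>_def power2_eq_square diff_divide_distrib algebra_simps)
  finally show ?thesis by simp
qed

end

lemma single_tail:
  assumes S: "finite S" and "(\<Sum>l\<in>S. s l) \<le> 1" "(\<Sum>l\<in>S. \<kappa> l) \<le> 1"
  shows "prob (Pi_pmf S dflt p) {f. T < (Y S f)\<^sup>2} \<le> 2 * exp (- (T / 8))"
proof -
  let ?P = "Pi_pmf S dflt p"
  have fin': "finite (set_pmf ?P)" using S fin by (intro finite_set_Pi_pmf) auto
  have \<kappa>1: "\<kappa> l \<le> 1" if "l \<in> S" for l
    using member_le_sum[of l S \<kappa>] assms kappa_nonneg that by fastforce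
  have "prob ?P {f. T < (Y S f)\<^sup>2} \<le> expect ?P (\<lambda>f. exp (1/8 * (0 + Y S f)\<^sup>2)) / exp (T / 8)"
    by (rule markov_pmf[OF fin']) auto
  \<comment> \<open>With \<mu> = 1/8 and \<nu> = 1/4 the condition of \<open>mgf_square\<close>
    holds with equality when the \<open>\<kappa>\<close> sum to 1.\<close>
  also have "expect ?P (\<lambda>f. exp (1/8 * (0 + Y S f)\<^sup>2)) \<le> exp (1/4 * 0\<^sup>2 + 1/4 * (\<Sum>l\<in>S. s l * (1 + 1/4 * \<kappa> l)))"
  proof (rule mgf_square[OF S])
    show "1/8 + 2 * (1/4)\<^sup>2 * (\<Sum>l\<in>S. \<kappa> l) \<le> 1/4" using assms(3) by (simp add: power2_eq_square)
    show "1/4 * \<kappa> l \<le> 1" if "l \<in> S" for l using \<kappa>1[OF that] by simp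
  qed simp
  also have "\<dots> \<le> exp (1 / 2)"
  proof -
    have "(\<Sum>l\<in>S. s l * (1 + 1/4 * \<kappa> l)) \<le> (\<Sum>l\<in>S. s l * 2)"
    proof (intro sum_mono mult_left_mono s_nonneg)
      show "1 + 1/4 * \<kappa> l \<le> 2" if "l \<in> S" for l using \<kappa>1[OF that] by simp
    qed
    also have "\<dots> \<le> 2" using assms by (simp flip: sum_distrib_right)
    finally show ?thesis by simp
  qed
  also have "exp (1/2::real) \<le> 2" using exp_bound[of "1/2::real"] by (simp add: power2_eq_square)
  finally show ?thesis by (simp add: divide_right_mono exp_minus inverse_eq_divide)
qed

end

section \<open>Random signs and random samples\<close>

abbreviation unif :: "nat \<Rightarrow> nat pmf" where "unif M \<equiv> pmf_of_set {0..M}"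

abbreviation unifs :: "nat \<Rightarrow> nat \<Rightarrow> (nat \<Rightarrow> nat) pmf" where
  "unifs n M \<equiv> Pi_pmf {..<n} 0 (\<lambda>_. unif M)"

text \<open>A union bound across two successive draws: the second is controlled only where the first
  was good, and is bounded by 1 elsewhere.\<close>

lemma prob_bind_le:
  assumes "prob p A \<le> \<alpha>" "0 \<le> \<beta>" "finite (set_pmf p)" "\<And>x. x \<in> set_pmf p \<Longrightarrow> finite (set_pmf (q x))"
    and q: "\<And>x. x \<in> set_pmf p \<Longrightarrow> x \<notin> A \<Longrightarrow> prob (q x) B \<le> \<beta>"
  shows "prob (bind_pmf p q) B \<le> \<alpha> + \<beta>"
proof -
  have "prob (bind_pmf p q) B = expect (bind_pmf p q) (indicator B)" by simp
  also have "\<dots> = expect p (\<lambda>x. expect (q x) (indicator B))"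
    by (rule expect_bind) (use assms in auto)
  also have "\<dots> = expect p (\<lambda>x. prob (q x) B)" by simp
  also have "\<dots> \<le> expect p (\<lambda>x. indicator A x + \<beta>)"
  proof (rule expect_mono[OF assms(3)])
    fix x assume x: "x \<in> set_pmf p"
    show "prob (q x) B \<le> indicator A x + \<beta>"
    proof (cases "x \<in> A")
      case True
      have "prob (q x) B \<le> 1" by simp
      also have "1 \<le> indicator A x + \<beta>" using True assms(2) by simp
      finally show ?thesis .
    qed (use q[OF x] in auto)
  qed
  also have "\<dots> = prob p A + \<beta>"
    by (simp add: expect_add assms(3))
  finally show ?thesis using assms(1) by simp
qed

lemma prob_UN_le:
  assumes "finite I" "\<And>i. i \<in> I \<Longrightarrow> prob p (B i) \<le> c"
  shows "prob p (\<Union>i\<in>I. B i) \<le> real (card I) * c"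
proof -
  have "prob p (\<Union>i\<in>I. B i) \<le> (\<Sum>i\<in>I. prob p (B i))"
    using assms(1) by (intro measure_pmf.finite_measure_subadditive_finite) auto
  also have "\<dots> \<le> (\<Sum>i\<in>I. c)" by (intro sum_mono assms)
  finally show ?thesis by simp
qed

lemma prob_Un_le:
  "prob p A \<le> a \<Longrightarrow> prob p B \<le> b \<Longrightarrow> prob p (A \<union> B) \<le> a + b"
  using measure_Un_le[of A "measure_pmf p" B] by auto

lemma prob_mono: "A \<inter> set_pmf p \<subseteq> B \<Longrightarrow> prob p A \<le> prob p B"
  by (subst measure_Int_set_pmf[symmetric]) (auto intro: measure_pmf.finite_measure_mono)

lemma expect_unif: "expect (unif M) f = (\<Sum>v\<le>M. f v) / (real M + 1)"
  by (subst integral_pmf_of_set) (auto simp: atLeast0AtMost)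

text \<open>One array holds the draws for all rows of a sketch; block \<open>b\<close> is the
  stretch that belongs to row \<open>b\<close>.\<close>

definition block :: "nat \<Rightarrow> nat \<Rightarrow> nat set" where
  "block m b = {b * m..<b * m + m}"

lemma finite_block [simp]: "finite (block m b)"
  by (simp add: block_def)

lemma card_block [simp]: "card (block m b) = m"
  by (simp add: block_def)

lemma block_disjoint: "b < c \<Longrightarrow> block m b \<inter> block m c = {}"
proof -
  assume "b < c"
  then have "b * m + m \<le> c * m" by (metis Suc_leI mult_Suc mult_le_mono1 add.commute)
  then show ?thesis by (auto simp: block_def)
qed

lemma UN_block: "(\<Union>b<r. block m b) = {..<r * m}"
proof (induction r)
  case (Suc r)
  then show ?case by (auto simp: block_def lessThan_Suc)
qed simp

lemma sum_block: "(\<Sum>i\<in>block m b. f i) = (\<Sum>l<m. f (b * m + l))"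
  unfolding block_def by (rule sum.reindex_bij_witness[of _ "\<lambda>l. b * m + l" "\<lambda>i. i - b * m"]) auto

abbreviation sgn_of :: "nat \<Rightarrow> real" where "sgn_of v \<equiv> 1 - 2 * real v"

lemma sym_vars_signs:
  "sym_vars (\<lambda>_. unif 1) (\<lambda>i v. sgn_of v * a i) (\<lambda>i. (a i)\<^sup>2) (\<lambda>i. (a i)\<^sup>2)"
proof
  fix v l assume "v \<in> set_pmf (unif 1)"
  then have "v = 0 \<or> v = 1" by auto
  then show "(sgn_of v * a l)\<^sup>2 \<le> (a l)\<^sup>2" by auto
qed (auto simp: expect_unif numeral_2_eq_2)

lemma flat_tail:
  fixes a :: "nat \<Rightarrow> real"
  assumes "(\<Sum>i<N. (a i)\<^sup>2) \<le> 1"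
  shows "prob (unifs N 1) {f. T < (\<Sum>i<N. sgn_of (f i) * a i)\<^sup>2} \<le> 2 * exp (- (T / 8))"
  by (rule sym_vars.single_tail[OF sym_vars_signs]) (use assms in auto)

text \<open>Multiplication by entries of square 1 keeps the norm, so every transformed coordinate is
  again a randomly signed sum of a vector of norm at most 1, and \<open>flat_tail\<close> applies to
  each pair of \<open>w\<close> and \<open>k\<close>.\<close>

lemma flat_all:
  fixes W :: "(nat \<Rightarrow> real) set" and h :: "nat \<Rightarrow> nat \<Rightarrow> real"
  assumes fin: "finite W" and w: "\<And>w. w \<in> W \<Longrightarrow> (\<Sum>i<N. (w i)\<^sup>2) \<le> 1" and h: "\<And>k i. k < N \<Longrightarrow> i < N \<Longrightarrow> (h k i)\<^sup>2 = (1::real)"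
  shows "prob (unifs N 1)
    {f. \<exists>w\<in>W. \<exists>k<N. T < (\<Sum>i<N. h k i * (sgn_of (f i) * w i))\<^sup>2} \<le> real (card W * N) * (2 * exp (- (T / 8)))"
proof -
  have "prob (unifs N 1)
      (\<Union>(w, k)\<in>W \<times> {..<N}. {f. T < (\<Sum>i<N. sgn_of (f i) * (h k i * w i))\<^sup>2})
      \<le> real (card (W \<times> {..<N})) * (2 * exp (- (T / 8)))"
  proof (rule prob_UN_le)
    fix z assume "z \<in> W \<times> {..<N}"
    then obtain w' k where z: "z = (w', k)" "w' \<in> W" "k < N" by auto
    have "(\<Sum>i<N. (h k i * w' i)\<^sup>2) = (\<Sum>i<N. (w' i)\<^sup>2)"
      using z h by (intro sum.cong) (auto simp: power_mult_distrib)
    then show "prob (unifs N 1)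
        (case z of (w, k) \<Rightarrow> {f. T < (\<Sum>i<N. sgn_of (f i) * (h k i * w i))\<^sup>2}) \<le> 2 * exp (- (T / 8))"
      using flat_tail[of "\<lambda>i. h k i * w' i" N T] w z by auto
  qed (use fin in auto)
  moreover have "{f. \<exists>w\<in>W. \<exists>k<N. T < (\<Sum>i<N. h k i * (sgn_of (f i) * w i))\<^sup>2}
      = (\<Union>(w, k)\<in>W \<times> {..<N}. {f. T < (\<Sum>i<N. sgn_of (f i) * (h k i * w i))\<^sup>2})"
    by (auto simp: mult_ac)
  ultimately show ?thesis by (simp add: card_cartesian_product)
qed

abbreviation jl_sum :: "nat \<Rightarrow> nat \<Rightarrow> (nat \<Rightarrow> nat) \<Rightarrow> (nat \<Rightarrow> real) \<Rightarrow> real" where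
  "jl_sum k d g y \<equiv> (\<Sum>c<k. (\<Sum>j<d. sgn_of (g (c * d + j)) * y j)\<^sup>2)"

lemma jl_unit:
  assumes "0 < \<delta>" "\<delta> \<le> 1" and y: "(\<Sum>j<d. (y j)\<^sup>2) = 1"
  shows "prob (unifs (k * d) 1)
    {g. \<not> ((1 - \<delta>) * real k \<le> jl_sum k d g y
        \<and> jl_sum k d g y \<le> (1 + \<delta>) * real k)}
    \<le> 2 * exp (- (real k * \<delta>\<^sup>2 / 20))"
proof -
  interpret sym_vars "\<lambda>_. unif 1" 0 "\<lambda>l v. sgn_of v * y (l mod d)" "\<lambda>l. (y (l mod d))\<^sup>2" "\<lambda>l. (y (l mod d))\<^sup>2"
    by (rule sym_vars_signs)
  have s1: "(\<Sum>l\<in>block d b. (y (l mod d))\<^sup>2) = 1" for b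
    using y by (simp add: sum_block)
  have Yb: "(\<Sum>l\<in>block d b. sgn_of (g l) * y (l mod d)) = (\<Sum>j<d. sgn_of (g (b * d + j)) * y j)" for b g
    by (simp add: sum_block)
  let ?P = "unifs (k * d) 1"
  have \<kappa>1: "(y (l mod d))\<^sup>2 \<le> 1" if "l \<in> block d b" for l b
  proof -
    have "0 < d" using y by (cases d) auto
    then show ?thesis using member_le_sum[of "l mod d" "{..<d}" "\<lambda>j. (y j)\<^sup>2"] y by simp
  qed
  have U: "prob ?P {g. (1 + \<delta>) * real k < jl_sum k d g y}
     \<le> exp (- (real k * \<delta>\<^sup>2 / (20 * 1)))"
    using upper_tail[of "block d" 1 \<delta> k] block_disjoint s1 assms by (simp add: UN_block Yb)
  have Lo: "prob ?P {g. jl_sum k d g y < (1 - \<delta>) * real k}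
     \<le> exp (- (real k * \<delta>\<^sup>2 / 8))"
    using lower_tail[of "block d" \<delta> k] block_disjoint s1 assms \<kappa>1 by (simp add: UN_block Yb)
  \<comment> \<open>The upper tail is the weaker one and sets the common constant 20.\<close>
  have E: "exp (- (real k * \<delta>\<^sup>2 / 8)) \<le> exp (- (real k * \<delta>\<^sup>2 / 20))"
    by (simp add: field_simps)
  have "prob ?P ({g. (1 + \<delta>) * real k < jl_sum k d g y}
     \<union> {g. jl_sum k d g y < (1 - \<delta>) * real k})
     \<le> exp (- (real k * \<delta>\<^sup>2 / 20)) + exp (- (real k * \<delta>\<^sup>2 / 20))"
    using prob_Un_le[OF U order_trans[OF Lo E]] by simp
  moreover have "prob ?P {g. \<not> ((1 - \<delta>) * real k \<le> jl_sum k d g y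
        \<and> jl_sum k d g y \<le> (1 + \<delta>) * real k)}
    \<le> prob ?P ({g. (1 + \<delta>) * real k < jl_sum k d g y}
     \<union> {g. jl_sum k d g y < (1 - \<delta>) * real k})"
    by (rule prob_mono) auto
  ultimately show ?thesis by linarith
qed

lemma jl_vec:
  fixes y :: "nat \<Rightarrow> real"
  assumes "0 < \<delta>" "\<delta> \<le> 1"
  shows "prob (unifs (k * d) 1)
    {g. \<not> ((1 - \<delta>) * real k * (\<Sum>j<d. (y j)\<^sup>2) \<le> jl_sum k d g y
        \<and> jl_sum k d g y \<le> (1 + \<delta>) * real k * (\<Sum>j<d. (y j)\<^sup>2))}
    \<le> 2 * exp (- (real k * \<delta>\<^sup>2 / 20))"
proof -
  define S where "S = (\<Sum>j<d. (y j)\<^sup>2)"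
  have "0 \<le> S" unfolding S_def by (intro sum_nonneg) auto
  show ?thesis
  proof (cases "S = 0")
    case True
    then have "y j = 0" if "j < d" for j
      using that by (auto simp: S_def sum_nonneg_eq_0_iff)
    then show ?thesis by (auto simp: S_def)
  next
    case False
    then have S: "0 < S" using \<open>0 \<le> S\<close> by simp
    define z where "z j = y j / sqrt S" for j
    have z1: "(\<Sum>j<d. (z j)\<^sup>2) = 1"
      using S by (simp add: z_def power_divide S_def[symmetric] flip: sum_divide_distrib)
    have q: "jl_sum k d g y = S * jl_sum k d g z" for g
      using S by (simp add: z_def power_divide flip: sum_divide_distrib)
    have "a * S \<le> S * t \<longleftrightarrow> a \<le> t" "S * t \<le> a * S \<longleftrightarrow> t \<le> a" for a t
      using S by (auto simp: mult.commute[of a])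
    then show ?thesis
      using jl_unit[OF assms z1, of k] unfolding q S_def[symmetric] by simp
  qed
qed

section \<open>Sampling rows with random signs\<close>

lemma sum_lessThan_add:
  fixes f :: "nat \<Rightarrow> real"
  shows "(\<Sum>v<N + M. f v) = (\<Sum>v<N. f v) + (\<Sum>v<M. f (N + v))"
  by (induction M) auto

lemma sum_double:
  fixes f :: "nat \<Rightarrow> real"
  assumes "0 < N"
  shows "(\<Sum>v\<le>2 * N - 1. f v) = (\<Sum>v<N. f v + f (N + v))"
proof -
  have "{..2 * N - 1} = {..<N + N}" using assms by auto
  then show ?thesis by (simp add: sum_lessThan_add sum.distrib)
qed

text \<open>The list of \<open>N\<close> values is followed by their negatives. One uniform index
  below \<open>2 * N\<close> thus supplies a uniform row together with an independent random sign,
  and this is what makes a sample symmetric.\<close>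

locale sampling =
  fixes N m :: nat and \<phi> :: "nat \<Rightarrow> real" and \<kappa> :: real
  assumes N: "0 < N" and m: "0 < m"
    and odd: "v < N \<Longrightarrow> \<phi> (N + v) = - \<phi> v"
    and bound: "v < N \<Longrightarrow> (\<phi> v)\<^sup>2 \<le> \<kappa>"
    and mean: "(\<Sum>v<N. (\<phi> v)\<^sup>2) = real N"
begin

lemma bound2: "v < 2 * N \<Longrightarrow> (\<phi> v)\<^sup>2 \<le> \<kappa>"
  using bound[of v] bound[of "v - N"] odd[of "v - N"] by (cases "v < N") auto

text \<open>The factor 1 / sqrt m gives a block of \<open>m\<close> samples unit variance. Then
  \<kappa> / m bounds one squared summand and \<kappa> bounds their total over a block; the lower
  tail depends on the first quantity, the upper tail on the second.\<close>

sublocale sym_vars "\<lambda>_. unif (2 * N - 1)" 0 "\<lambda>_ v. \<phi> v / sqrt m" "\<lambda>_. \<kappa> / m" "\<lambda>_. 1 / m"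
proof
  fix h :: "real \<Rightarrow> real"
  show "expect (unif (2 * N - 1)) (\<lambda>v. h (\<phi> v / sqrt m)) = expect (unif (2 * N - 1)) (\<lambda>v. h (- (\<phi> v / sqrt m)))"
    using N odd by (simp add: expect_unif sum_double add.commute del: One_nat_def)
next
  fix v assume "v \<in> set_pmf (unif (2 * N - 1))"
  then have "v < 2 * N" using N by auto
  then show "(\<phi> v / sqrt m)\<^sup>2 \<le> \<kappa> / m" using bound2[of v] by (simp add: power_divide divide_right_mono)
next
  have "real (2 * N - 1) + 1 = 2 * real N" using N by linarith
  then show "expect (unif (2 * N - 1)) (\<lambda>v. (\<phi> v / sqrt m)\<^sup>2) = 1 / m"
    using N mean odd by (simp add: expect_unif sum_double power_divide del: One_nat_def flip: sum_divide_distrib sum_distrib_left)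
qed simp

lemma Y_block: "(\<Sum>l\<in>block m b. \<phi> (g l) / sqrt m)\<^sup>2 = (\<Sum>l<m. \<phi> (g (b * m + l)))\<^sup>2 / m"
  by (simp add: sum_block power_divide flip: sum_divide_distrib)

lemma sum_Y_block: "(\<Sum>b<r. (\<Sum>l\<in>block m b. \<phi> (g l) / sqrt m)\<^sup>2) = (\<Sum>b<r. (\<Sum>l<m. \<phi> (g (b * m + l)))\<^sup>2) / m"
  by (simp only: Y_block sum_divide_distrib)

lemma sum_s_block: "(\<Sum>l\<in>block m b. 1 / real m) = 1"
  using m by simp

lemma sampling_upper:
  assumes "0 < \<delta>" "\<delta> \<le> 1" "0 < \<kappa>"
  shows "prob (unifs (r * m) (2 * N - 1))
     {g. (1 + \<delta>) * (real r * real m) < (\<Sum>b<r. (\<Sum>l<m. \<phi> (g (b * m + l)))\<^sup>2)} \<le> exp (- (real r * \<delta>\<^sup>2 / (20 * \<kappa>)))"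
proof -
  have "(\<Sum>l\<in>block m b. \<kappa> / real m) \<le> \<kappa>" for b using m by simp
  from upper_tail[of "block m" \<kappa> \<delta> r, OF finite_block block_disjoint sum_s_block this] assms
  have "prob (unifs (r * m) (2 * N - 1))
     {g. (1 + \<delta>) * real r < (\<Sum>b<r. (\<Sum>l<m. \<phi> (g (b * m + l)))\<^sup>2) / m} \<le> exp (- (real r * \<delta>\<^sup>2 / (20 * \<kappa>)))"
    by (simp add: UN_block sum_Y_block)
  then show ?thesis using m by (simp add: pos_less_divide_eq mult.assoc)
qed

lemma sampling_lower:
  assumes "0 < \<delta>" "\<kappa> \<le> m"
  shows "prob (unifs (r * m) (2 * N - 1))
     {g. (\<Sum>b<r. (\<Sum>l<m. \<phi> (g (b * m + l)))\<^sup>2) < (1 - \<delta>) * (real r * real m)} \<le> exp (- (real r * \<delta>\<^sup>2 / 8))"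
proof -
  have "\<kappa> / real m \<le> 1" for b using m assms by simp
  from lower_tail[of "block m" \<delta> r, OF finite_block block_disjoint sum_s_block this] assms
  have "prob (unifs (r * m) (2 * N - 1))
     {g. (\<Sum>b<r. (\<Sum>l<m. \<phi> (g (b * m + l)))\<^sup>2) / m < (1 - \<delta>) * real r} \<le> exp (- (real r * \<delta>\<^sup>2 / 8))"
    by (simp add: UN_block sum_Y_block)
  then show ?thesis using m by (simp add: pos_divide_less_eq mult.assoc)
qed

lemma sampling_mean:
  "expect (unifs (r * m) (2 * N - 1)) (\<lambda>g. \<Sum>b<r. (\<Sum>l<m. \<phi> (g (b * m + l)))\<^sup>2) = real r * real m"
proof -
  let ?P = "unifs (r * m) (2 * N - 1)"
  have fin': "finite (set_pmf ?P)" by (intro finite_set_Pi_pmf) auto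
  have 1: "expect ?P (\<lambda>g. (\<Sum>l\<in>block m b. \<phi> (g l) / sqrt m)\<^sup>2) = 1" if "b < r" for b
  proof -
    have sub: "block m b \<subseteq> {..<r * m}" using that UN_block[of m r] by blast
    then have U: "block m b \<union> ({..<r * m} - block m b) = {..<r * m}" by blast
    \<comment> \<open>The constant factor 1 on the remaining coordinates turns the product rule into
      a marginalization to one block.\<close>
    have "expect (Pi_pmf (block m b \<union> ({..<r * m} - block m b)) 0 (\<lambda>_. unif (2 * N - 1)))
        (\<lambda>g. (\<Sum>l\<in>block m b. \<phi> (g l) / sqrt m)\<^sup>2 * 1)
      = expect (Pi_pmf (block m b) 0 (\<lambda>_. unif (2 * N - 1))) (\<lambda>g. (\<Sum>l\<in>block m b. \<phi> (g l) / sqrt m)\<^sup>2)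
        * expect (Pi_pmf ({..<r * m} - block m b) 0 (\<lambda>_. unif (2 * N - 1))) (\<lambda>_. 1)"
      by (rule expect_Pi_union) (auto cong: sum.cong)
    also have "\<dots> = 1" using m by (simp add: moments(1)[OF finite_block] del: One_nat_def)
    finally show ?thesis by (simp only: U mult_1_right)
  qed
  have "expect ?P (\<lambda>g. \<Sum>b<r. (\<Sum>l<m. \<phi> (g (b * m + l)))\<^sup>2)
      = expect ?P (\<lambda>g. real m * (\<Sum>b<r. (\<Sum>l\<in>block m b. \<phi> (g l) / sqrt m)\<^sup>2))"
    using m by (simp add: sum_Y_block)
  also have "\<dots> = real m * (\<Sum>b<r. expect ?P (\<lambda>g. (\<Sum>l\<in>block m b. \<phi> (g l) / sqrt m)\<^sup>2))"
    by (simp add: expect_sum[OF fin'] del: One_nat_def)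
  also have "\<dots> = real m * (\<Sum>b<r. 1)" by (intro arg_cong2[where f = "(*)"] refl sum.cong 1) auto
  finally show ?thesis by simp
qed

end

section \<open>Numerical constants and the passage from a grid to all vectors\<close>

lemma two_power_le_exp: "2 ^ k \<le> exp (real k)"
proof -
  have "(2::real) \<le> exp 1" using exp_ge_add_one_self[of 1] by simp
  then have "(2::real) ^ k \<le> exp 1 ^ k" by (intro power_mono) auto
  then show ?thesis by (simp add: exp_of_nat_mult[of k 1, simplified])
qed

lemma exp_neg_numerals: "exp (- 4 :: real) \<le> 0.026" "exp (- 5 :: real) \<le> 0.011"
proof -
  \<comment> \<open>The two bounds come from (2/5)^4 = 0.0256 and (2/5)^5 = 0.01024.\<close>
  have "(5/2::real) \<le> exp 1" using exp_lower_Taylor_quadratic[of "1::real"] by simp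
  then have "(5/2::real) ^ k \<le> exp (real k)" for k
    using power_mono[of "5/2" "exp 1 :: real" k] by (simp add: exp_of_nat_mult[of k 1, simplified])
  from this[of 4] this[of 5]
  show "exp (- 4 :: real) \<le> 0.026" "exp (- 5 :: real) \<le> 0.011"
    by (simp_all add: exp_minus field_simps power_numeral_even power_numeral_odd)
qed

text \<open>A lower bound on a grid of polynomial resolution suffices, because the Frobenius norm is a
  cheap a priori bound for the operator norm.\<close>

lemma lower_bound_from_grid:
  fixes \<Phi> :: "nat \<Rightarrow> nat \<Rightarrow> real" and G :: nat
  assumes d: "0 < d" and \<epsilon>: "0 < \<epsilon>" "\<epsilon> \<le> 1" and \<rho>: "0 \<le> \<rho>" and G: "200 * real d / \<epsilon> \<le> real G"
    and fro: "(\<Sum>b<r. \<Sum>j<d. (\<Phi> b j)\<^sup>2) \<le> 50 * real d * \<rho>"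
    and grid: "\<And>g :: nat \<Rightarrow> int. (\<And>j. j < d \<Longrightarrow> \<bar>g j\<bar> \<le> int G) \<Longrightarrow>
       (1 - \<epsilon> / 8) * \<rho> * (\<Sum>j<d. (real_of_int (g j))\<^sup>2) \<le> (\<Sum>b<r. (\<Sum>j<d. \<Phi> b j * real_of_int (g j))\<^sup>2)"
  shows "(1 - \<epsilon> / 4) * \<rho> * (\<Sum>j<d. (z j)\<^sup>2) \<le> (\<Sum>b<r. (\<Sum>j<d. \<Phi> b j * z j)\<^sup>2)"
proof -
  have Gpos: "0 < real G" using G d \<epsilon> by (meson divide_pos_pos le_less_trans mult_pos_pos not_le of_nat_0_less_iff zero_less_numeral)
  have unit: "(1 - \<epsilon> / 4) * \<rho> \<le> (\<Sum>b<r. (\<Sum>j<d. \<Phi> b j * z j)\<^sup>2)" if z: "(\<Sum>j<d. (z j)\<^sup>2) = 1" for z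
  proof -
    \<comment> \<open>The unit vector is rounded down to the grid of spacing 1 / G, with rounding
      error \<open>e\<close>.\<close>
    define g where "g j = \<lfloor>real G * z j\<rfloor>" for j
    define w where "w j = real_of_int (g j) / real G" for j
    define e where "e j = z j - w j" for j
    have z1: "\<bar>z j\<bar> \<le> 1" if "j < d" for j
      using member_le_sum[of j "{..<d}" "\<lambda>j. (z j)\<^sup>2"] that z by (simp add: abs_square_le_1)
    have g: "\<bar>g j\<bar> \<le> int G" if "j < d" for j
    proof -
      have "\<bar>real G * z j\<bar> \<le> real G" using z1[OF that] by (simp add: abs_mult mult_left_le)
      then show ?thesis unfolding g_def abs_le_iff by (simp add: le_floor_iff floor_le_iff) linarith
    qed
    have e1: "\<bar>e j\<bar> \<le> 1 / real G" for j
    proof -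
      have "e j = (real G * z j - real_of_int (g j)) / real G" using Gpos by (simp add: e_def w_def field_simps)
      moreover have "0 \<le> real G * z j - real_of_int (g j)" "real G * z j - real_of_int (g j) \<le> 1"
        unfolding g_def by linarith+
      ultimately show ?thesis using Gpos by (simp add: divide_right_mono)
    qed
    define dG where "dG = real d / real G"
    have dG: "0 \<le> dG" "dG \<le> \<epsilon> / 200" using G Gpos \<epsilon> by (auto simp: dG_def field_simps)
    have e2: "(\<Sum>j<d. (e j)\<^sup>2) \<le> dG / real G"
    proof -
      have "(\<Sum>j<d. (e j)\<^sup>2) \<le> (\<Sum>j<d. (1 / real G)\<^sup>2)"
        using e1 by (intro sum_mono) (meson abs_le_square_iff abs_ge_self order_trans)
      then show ?thesis by (simp add: dG_def power2_eq_square)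
    qed
    have e2': "(\<Sum>j<d. (e j)\<^sup>2) \<le> dG\<^sup>2"
    proof -
      have "1 / real G \<le> dG" using d Gpos by (simp add: dG_def divide_right_mono)
      from mult_left_mono[OF this dG(1)] show ?thesis using e2 by (simp add: power2_eq_square)
    qed
    let ?n = "\<lambda>x. L2_set x {..<d}" and ?q = "\<lambda>x. L2_set (\<lambda>b. \<Sum>j<d. \<Phi> b j * x j) {..<r}"
    have ne: "?n e \<le> dG" unfolding L2_set_def using real_sqrt_le_mono[OF e2'] dG by simp
    have nz: "?n z = 1" unfolding L2_set_def using z by simp
    have nw: "1 - dG \<le> ?n w"
    proof -
      have "?n z \<le> ?n w + ?n e" using L2_set_triangle_ineq[of w e "{..<d}"] by (simp add: e_def)
      then show ?thesis using ne nz by linarith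
    qed
    have qw: "sqrt \<rho> * (1 - \<epsilon> / 15) * (1 - dG) \<le> ?q w"
    proof -
      have "(1 - \<epsilon> / 8) * \<rho> * (\<Sum>j<d. (real_of_int (g j))\<^sup>2) / (real G)\<^sup>2 \<le> (\<Sum>b<r. (\<Sum>j<d. \<Phi> b j * real_of_int (g j))\<^sup>2) / (real G)\<^sup>2"
        by (intro divide_right_mono grid g) auto
      then have "(1 - \<epsilon> / 8) * \<rho> * (\<Sum>j<d. (w j)\<^sup>2) \<le> (\<Sum>b<r. (\<Sum>j<d. \<Phi> b j * w j)\<^sup>2)"
        by (simp add: w_def power_divide flip: sum_divide_distrib)
      then have "sqrt ((1 - \<epsilon> / 8) * \<rho> * (\<Sum>j<d. (w j)\<^sup>2)) \<le> ?q w"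
        unfolding L2_set_def by (rule real_sqrt_le_mono)
      then have "sqrt (1 - \<epsilon> / 8) * sqrt \<rho> * ?n w \<le> ?q w"
        by (simp add: L2_set_def real_sqrt_mult)
      \<comment> \<open>Squaring the left-hand side loses 2 \<epsilon> / 15 in first order, which
        exceeds \<epsilon> / 8 by enough to absorb the quadratic term, as \<epsilon> \<le>
        1.\<close>
      moreover have "1 - \<epsilon> / 15 \<le> sqrt (1 - \<epsilon> / 8)"
      proof (rule real_le_rsqrt)
        have "\<epsilon> * \<epsilon> \<le> \<epsilon>" using \<epsilon> by (simp add: mult_left_le)
        then show "(1 - \<epsilon> / 15)\<^sup>2 \<le> 1 - \<epsilon> / 8"
          using \<epsilon> by (simp add: power2_eq_square algebra_simps)
      qed
      then have "(1 - \<epsilon> / 15) * sqrt \<rho> * (1 - dG) \<le> sqrt (1 - \<epsilon> / 8) * sqrt \<rho> * ?n w"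
        using nw dG \<epsilon> \<rho> by (intro mult_mono) auto
      ultimately show ?thesis by (simp add: mult_ac)
    qed
    \<comment> \<open>The Frobenius norm stands in for the operator norm. The factor d that this
      costs is compensated by the resolution of the grid: d times the bound dG / G on the squared
      error is dG^2. The constant 50 is rounded up to the square 64.\<close>
    have qe: "?q e \<le> 8 * dG * sqrt \<rho>"
    proof -
      have "(\<Sum>b<r. (\<Sum>j<d. \<Phi> b j * e j)\<^sup>2) \<le> (\<Sum>b<r. (\<Sum>j<d. (\<Phi> b j)\<^sup>2) * (\<Sum>j<d. (e j)\<^sup>2))"
        by (intro sum_mono Cauchy_Schwarz_ineq_sum)
      also have "\<dots> = (\<Sum>b<r. \<Sum>j<d. (\<Phi> b j)\<^sup>2) * (\<Sum>j<d. (e j)\<^sup>2)" by (rule sum_distrib_right[symmetric])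
      also have "\<dots> \<le> (50 * real d * \<rho>) * (dG / real G)"
        using fro e2 \<rho> by (intro mult_mono) (auto intro: sum_nonneg)
      also have "\<dots> = 50 * dG\<^sup>2 * \<rho>" by (simp add: dG_def power2_eq_square)
      also have "\<dots> \<le> 64 * dG\<^sup>2 * \<rho>" using \<rho> by (intro mult_right_mono) auto
      also have "\<dots> = (8 * dG * sqrt \<rho>)\<^sup>2" using \<rho> by (simp add: power_mult_distrib)
      finally show ?thesis unfolding L2_set_def using dG \<rho> by (intro real_le_lsqrt) (auto intro: sum_nonneg)
    qed
    have "?q w \<le> ?q z + ?q (\<lambda>j. - e j)"
    proof -
      have "(\<Sum>j<d. \<Phi> b j * w j) = (\<Sum>j<d. \<Phi> b j * z j) + (\<Sum>j<d. \<Phi> b j * (- e j))" for b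
        unfolding sum.distrib[symmetric] by (intro sum.cong) (auto simp: e_def algebra_simps)
      then show ?thesis using L2_set_triangle_ineq[of _ _ "{..<r}"] by simp
    qed
    moreover have "?q (\<lambda>j. - e j) = ?q e" by (simp add: L2_set_def sum_negf)
    ultimately have "sqrt \<rho> * ((1 - \<epsilon> / 15) * (1 - dG) - 8 * dG) \<le> ?q z"
      using qw qe by (simp add: algebra_simps)
    \<comment> \<open>One \<open>dG\<close> is lost in the norm of \<open>w\<close> and eight in the
      image of \<open>e\<close>; with \<open>dG\<close> at most \<epsilon> / 200 this is 9
      \<epsilon> / 200.\<close>
    moreover have "1 - \<epsilon> / 15 - \<epsilon> * 9 / 200 \<le> (1 - \<epsilon> / 15) * (1 - dG) - 8 * dG"
    proof -
      have "0 \<le> \<epsilon> / 15 * dG" using \<epsilon> dG by simp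
      moreover have "(1 - \<epsilon> / 15) * (1 - dG) = 1 - \<epsilon> / 15 - dG + \<epsilon> / 15 * dG"
        by (simp add: algebra_simps diff_divide_distrib)
      ultimately show ?thesis using dG by linarith
    qed
    ultimately have "sqrt \<rho> * (1 - \<epsilon> / 15 - \<epsilon> * 9 / 200) \<le> ?q z"
      by (meson mult_left_mono order_trans real_sqrt_ge_zero \<rho>)
    then have "(sqrt \<rho> * (1 - \<epsilon> / 15 - \<epsilon> * 9 / 200))\<^sup>2 \<le> (?q z)\<^sup>2"
      using \<rho> \<epsilon> by (intro power_mono) auto
    moreover have "(?q z)\<^sup>2 = (\<Sum>b<r. (\<Sum>j<d. \<Phi> b j * z j)\<^sup>2)"
      unfolding L2_set_def by (simp add: sum_nonneg)
    \<comment> \<open>To first order the squared loss is 2 (1/15 + 9/200) \<epsilon>, which is below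
      \<epsilon> / 4.\<close>
    moreover have "(1 - \<epsilon> / 4) * \<rho> \<le> (sqrt \<rho> * (1 - \<epsilon> / 15 - \<epsilon> * 9 / 200))\<^sup>2"
    proof -
      define x where "x = \<epsilon> / 15 + \<epsilon> * 9 / 200"
      have "1 - \<epsilon> / 4 \<le> 1 - 2 * x" using \<epsilon> by (simp add: x_def)
      also have "\<dots> \<le> (1 - x)\<^sup>2" by (simp add: power2_eq_square algebra_simps)
      finally have "(1 - \<epsilon> / 4) * \<rho> \<le> (1 - x)\<^sup>2 * \<rho>" using \<rho> by (intro mult_right_mono)
      then show ?thesis using \<rho> by (simp add: x_def power_mult_distrib mult.commute diff_diff_eq)
    qed
    ultimately show ?thesis by simp
  qed
  define S where "S = (\<Sum>j<d. (z j)\<^sup>2)"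
  show ?thesis
  proof (cases "S = 0")
    case True
    then show ?thesis by (simp add: S_def[symmetric] sum_nonneg)
  next
    case False
    moreover have "0 \<le> S" unfolding S_def by (intro sum_nonneg) auto
    ultimately have S: "0 < S" by simp
    have "(\<Sum>j<d. (z j / sqrt S)\<^sup>2) = 1"
      using S by (simp add: power_divide S_def[symmetric] flip: sum_divide_distrib)
    from unit[OF this] have "(1 - \<epsilon> / 4) * \<rho> \<le> (\<Sum>b<r. (\<Sum>j<d. \<Phi> b j * z j)\<^sup>2) / S"
      using S by (simp add: power_divide flip: sum_divide_distrib)
    then show ?thesis using S by (simp add: S_def[symmetric] pos_le_divide_eq)
  qed
qed

text \<open>\<open>R\<close> stands for the transformed orthonormal factor of A, followed by its
  negated rows, and \<open>u i\<close> for row \<open>i\<close> of that factor before the transform.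
  The flatness level 56 L is what a union bound over the random signs yields, and \<open>m\<close>
  is d times this level. In \<open>r\<close>, the summand d q pays for the grid and L^2 for the
  union over the vectors \<open>u i\<close>.\<close>

locale embedding =
  fixes N m d n L q r :: nat and \<epsilon> :: real and R u :: "nat \<Rightarrow> nat \<Rightarrow> real"
  assumes N: "0 < N" and d: "0 < d" and L: "0 < L" and q: "0 < q"
    and n: "n \<le> 2 ^ L" and dq: "real d / \<epsilon> \<le> 2 ^ q" and \<epsilon>: "0 < \<epsilon>" "\<epsilon> \<le> 1 / 2"
    and m: "m = 56 * d * L"
    and r: "90000 * (real d * real q + (real L)\<^sup>2) / \<epsilon>\<^sup>2 \<le> real r"
    and odd: "v < N \<Longrightarrow> R (N + v) j = - R v j"
    and iso: "(\<Sum>v<N. (\<Sum>j<d. R v j * z j)\<^sup>2) = real N * (\<Sum>j<d. (z j)\<^sup>2)"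
    and flat: "v < N \<Longrightarrow> j < d \<Longrightarrow> (R v j)\<^sup>2 \<le> 56 * real L"
    and flat_u: "v < N \<Longrightarrow> i < n \<Longrightarrow> (\<Sum>j<d. R v j * u i j)\<^sup>2 \<le> 56 * real L * (\<Sum>j<d. (u i j)\<^sup>2)"
begin

text \<open>Left unnormalized, so squared norms are scaled by r m; the scale is corrected only in
  the output of the program.\<close>

definition \<Phi> :: "(nat \<Rightarrow> nat) \<Rightarrow> nat \<Rightarrow> nat \<Rightarrow> real" where
  "\<Phi> g b j = (\<Sum>l<m. R (g (b * m + l)) j)"

abbreviation qf :: "(nat \<Rightarrow> nat) \<Rightarrow> (nat \<Rightarrow> real) \<Rightarrow> real" where "qf g z \<equiv> (\<Sum>b<r. (\<Sum>j<d. \<Phi> g b j * z j)\<^sup>2)"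
abbreviation nsq :: "(nat \<Rightarrow> real) \<Rightarrow> real" where "nsq z \<equiv> (\<Sum>j<d. (z j)\<^sup>2)"
abbreviation "P \<equiv> unifs (r * m) (2 * N - 1)"

lemma m_pos: "0 < m" using d L by (simp add: m)

lemma finite_P: "finite (set_pmf P)" by (intro finite_set_Pi_pmf) auto

lemma sampling_unit:
  assumes "nsq z = 1" "\<And>v. v < N \<Longrightarrow> (\<Sum>j<d. R v j * z j)\<^sup>2 \<le> \<kappa>"
  shows "sampling N m (\<lambda>v. \<Sum>j<d. R v j * z j) \<kappa>"
  using assms iso[of z] by unfold_locales (auto simp: N m_pos odd sum_negf)

lemma sampled_sum: "(\<Sum>l<m. \<Sum>j<d. R (g (b * m + l)) j * z j) = (\<Sum>j<d. \<Phi> g b j * z j)"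
  unfolding \<Phi>_def sum_distrib_right by (rule sum.swap)

text \<open>Cauchy-Schwarz with d flat entries. For a unit vector this is the hypothesis \<kappa>
  \<le> m of \<open>sampling_lower\<close>, obtained from the flatness of the entries of
  \<open>R\<close> and valid for every direction \<open>z\<close>.\<close>

lemma row_bound:
  assumes "v < N"
  shows "(\<Sum>j<d. R v j * z j)\<^sup>2 \<le> real m * nsq z"
proof -
  have "(\<Sum>j<d. R v j * z j)\<^sup>2 \<le> (\<Sum>j<d. (R v j)\<^sup>2) * nsq z" by (rule Cauchy_Schwarz_ineq_sum)
  also have "\<dots> \<le> (\<Sum>j<d. 56 * real L) * nsq z"
    using flat[OF assms] by (intro mult_right_mono sum_mono) (auto intro: sum_nonneg)
  finally show ?thesis by (simp add: m)
qed

lemma scaled: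
  assumes S: "0 < nsq z"
  shows "nsq (\<lambda>j. z j / sqrt (nsq z)) = 1" "qf g (\<lambda>j. z j / sqrt (nsq z)) = qf g z / nsq z"
    "(\<Sum>j<d. R v j * (z j / sqrt (nsq z)))\<^sup>2 = (\<Sum>j<d. R v j * z j)\<^sup>2 / nsq z"
  using S by (simp_all add: power_divide flip: sum_divide_distrib)

lemma nsq_cases: "nsq z = 0 \<or> 0 < nsq z"
  using sum_nonneg[of "{..<d}" "\<lambda>j. (z j)\<^sup>2"] by fastforce

lemma qf_zero: "nsq z = 0 \<Longrightarrow> qf g z = 0"
  by (simp add: sum_nonneg_eq_0_iff)

lemma lower_prob:
  assumes "0 < \<delta>"
  shows "prob P {g. qf g z < (1 - \<delta>) * (real r * real m) * nsq z} \<le> exp (- (real r * \<delta>\<^sup>2 / 8))"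
  using nsq_cases[of z]
proof
  assume "nsq z = 0"
  then show ?thesis by (simp add: qf_zero)
next
  assume S: "0 < nsq z"
  define w where "w j = z j / sqrt (nsq z)" for j
  have w: "nsq w = 1" "qf g w = qf g z / nsq z" for g using scaled[OF S] by (simp_all add: w_def)
  interpret sampling N m "\<lambda>v. \<Sum>j<d. R v j * w j" "real m"
    using row_bound[of _ w] w by (intro sampling_unit) auto
  show ?thesis using sampling_lower[of \<delta> r] assms S by (simp add: sampled_sum w pos_divide_less_eq del: One_nat_def)
qed

text \<open>At the vectors \<open>u i\<close> flatness is known in the direction itself, so \<kappa>
  is 56 L here instead of \<open>m\<close>.\<close>

lemma upper_prob:
  assumes "0 < \<delta>" "\<delta> \<le> 1" "i < n"
  shows "prob P {g. (1 + \<delta>) * (real r * real m) * nsq (u i) < qf g (u i)} \<le> exp (- (real r * \<delta>\<^sup>2 / (20 * (56 * real L))))"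
  using nsq_cases[of "u i"]
proof
  assume "nsq (u i) = 0"
  then show ?thesis by (simp add: qf_zero)
next
  assume S: "0 < nsq (u i)"
  define w where "w j = u i j / sqrt (nsq (u i))" for j
  have w: "nsq w = 1" "qf g w = qf g (u i) / nsq (u i)" "(\<Sum>j<d. R v j * w j)\<^sup>2 = (\<Sum>j<d. R v j * u i j)\<^sup>2 / nsq (u i)" for g v
    using scaled[OF S] by (simp_all add: w_def)
  interpret sampling N m "\<lambda>v. \<Sum>j<d. R v j * w j" "56 * real L"
    using flat_u[OF _ assms(3)] w S by (intro sampling_unit) (auto simp: pos_divide_le_eq)
  show ?thesis using sampling_upper[of \<delta> r] assms S L by (simp add: sampled_sum w pos_less_divide_eq del: One_nat_def)
qed

text \<open>Each coordinate vector has an image of mean squared norm r m, so the squared Frobenius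
  norm has mean d r m. Markov's inequality is sharp enough because this bound only ever multiplies a
  rounding error.\<close>

lemma frobenius_prob:
  "prob P {g. 50 * real d * (real r * real m) < (\<Sum>b<r. \<Sum>j<d. (\<Phi> g b j)\<^sup>2)} \<le> 1 / 50"
proof -
  have rpos: "0 < real r"
  proof -
    have "0 < 90000 * (real d * real q + (real L)\<^sup>2) / \<epsilon>\<^sup>2" using d q \<epsilon> by (intro divide_pos_pos) (auto intro: add_pos_nonneg)
    then show ?thesis using r by linarith
  qed
  define e where "e i j = (if j = i then 1 else 0 :: real)" for i j :: nat
  have e: "nsq (e i) = 1" "(\<Sum>j<d. x j * e i j) = x i" if "i < d" for i and x :: "nat \<Rightarrow> real"
    using that by (auto simp: e_def if_distrib[of "\<lambda>t. t\<^sup>2"] if_distrib[of "\<lambda>t. _ * t"] cong: if_cong)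
  have "expect P (\<lambda>g. \<Sum>b<r. (\<Phi> g b i)\<^sup>2) = real r * real m" if i: "i < d" for i
  proof -
    interpret sampling N m "\<lambda>v. \<Sum>j<d. R v j * e i j" "real m"
      using row_bound[of _ "e i"] e[OF i] by (intro sampling_unit) auto
    show ?thesis using sampling_mean[of r] by (simp add: e[OF i] \<Phi>_def del: One_nat_def)
  qed
  then have "expect P (\<lambda>g. \<Sum>j<d. \<Sum>b<r. (\<Phi> g b j)\<^sup>2) = real d * (real r * real m)"
    by (subst expect_sum[OF finite_P]) simp
  then have E: "expect P (\<lambda>g. \<Sum>b<r. \<Sum>j<d. (\<Phi> g b j)\<^sup>2) = real d * (real r * real m)"
    by (subst sum.swap)
  have "prob P {g. 50 * real d * (real r * real m) < (\<Sum>b<r. \<Sum>j<d. (\<Phi> g b j)\<^sup>2)}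
     \<le> expect P (\<lambda>g. \<Sum>b<r. \<Sum>j<d. (\<Phi> g b j)\<^sup>2) / (50 * real d * (real r * real m))"
    by (rule markov_pmf[OF finite_P]) (use d rpos m_pos in \<open>auto intro!: sum_nonneg\<close>)
  also have "\<dots> = 1 / 50" using d rpos m_pos by (simp add: E del: One_nat_def)
  finally show ?thesis .
qed

lemma two_le_d\<epsilon>: "2 \<le> real d / \<epsilon>"
proof -
  have "2 * \<epsilon> \<le> 1" using \<epsilon> by simp
  then show ?thesis using d \<epsilon> by (simp add: pos_le_divide_eq)
qed

lemma grid_prob:
  assumes G: "G = nat \<lceil>200 * real d / \<epsilon>\<rceil>"
  shows "prob P {g. \<exists>z :: nat \<Rightarrow> int. (\<forall>j<d. \<bar>z j\<bar> \<le> int G) \<and>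
      qf g (\<lambda>j. real_of_int (z j)) < (1 - \<epsilon> / 8) * (real r * real m) * nsq (\<lambda>j. real_of_int (z j))} \<le> 0.001"
proof -
  let ?bad = "\<lambda>z :: nat \<Rightarrow> int. {g. qf g (\<lambda>j. real_of_int (z j)) < (1 - \<epsilon> / 8) * (real r * real m) * nsq (\<lambda>j. real_of_int (z j))}"
  \<comment> \<open>Grid vectors matter only below \<open>d\<close>; restricting them there makes
    the index set of the union bound finite.\<close>
  let ?Z = "PiE {..<d} (\<lambda>_. {- int G..int G})"
  have "prob P {g. \<exists>z :: nat \<Rightarrow> int. (\<forall>j<d. \<bar>z j\<bar> \<le> int G) \<and>
      qf g (\<lambda>j. real_of_int (z j)) < (1 - \<epsilon> / 8) * (real r * real m) * nsq (\<lambda>j. real_of_int (z j))}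
     \<le> prob P (\<Union>z\<in>?Z. ?bad z)"
  proof (rule prob_mono, rule subsetI, elim IntE CollectE exE conjE)
    fix g z assume z: "\<forall>j<d. \<bar>z j\<bar> \<le> int G"
      and b: "qf g (\<lambda>j. real_of_int (z j)) < (1 - \<epsilon> / 8) * (real r * real m) * nsq (\<lambda>j. real_of_int (z j))"
    have "restrict z {..<d} \<in> ?Z" using z by (auto simp: abs_le_iff)
    moreover have "(\<Sum>j<d. \<Phi> g b j * real_of_int (restrict z {..<d} j)) = (\<Sum>j<d. \<Phi> g b j * real_of_int (z j))"
      "nsq (\<lambda>j. real_of_int (restrict z {..<d} j)) = nsq (\<lambda>j. real_of_int (z j))" for b
      by (intro sum.cong; simp)+
    then have "g \<in> ?bad (restrict z {..<d})" using b by (simp only: mem_Collect_eq)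
    ultimately show "g \<in> (\<Union>z\<in>?Z. ?bad z)" by blast
  qed
  also have "\<dots> \<le> real (card ?Z) * exp (- (real r * (\<epsilon> / 8)\<^sup>2 / 8))"
    using \<epsilon> by (intro prob_UN_le lower_prob finite_PiE) auto
  \<comment> \<open>A side of the grid has 2 G + 1 \<le> 512 * 2^q \<le> 2^(10 q) points. The
    failure exponent of one point is r \<epsilon>^2 / 512, and 90000 / 512 > 170.\<close>
  also have "\<dots> \<le> exp (10 * real q * real d) * exp (- (170 * real q * real d))"
  proof (intro mult_mono)
    have "2 * real G + 1 \<le> 512 * 2 ^ q"
    proof -
      have "real G \<le> 200 * real d / \<epsilon> + 1" unfolding G using d \<epsilon> by (simp add: of_nat_nat)
      then show ?thesis using two_le_d\<epsilon> dq by simp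
    qed
    also have "\<dots> = 2 ^ (9 + q)" by (simp add: power_add)
    also have "\<dots> \<le> (2::real) ^ (10 * q)" using q by (intro power_increasing) auto
    also have "\<dots> \<le> exp (real (10 * q))" by (rule two_power_le_exp)
    finally have "(2 * real G + 1) ^ d \<le> exp (real (10 * q)) ^ d" by (intro power_mono) auto
    then show "real (card ?Z) \<le> exp (10 * real q * real d)"
      by (simp add: card_PiE add.commute mult.commute mult.left_commute flip: exp_of_nat_mult)
    have "90000 * (real d * real q) \<le> 90000 * (real d * real q + (real L)\<^sup>2)" by simp
    also have "\<dots> \<le> real r * \<epsilon>\<^sup>2" using r \<epsilon> by (simp add: pos_divide_le_eq)
    finally have "90000 * (real d * real q) \<le> real r * \<epsilon>\<^sup>2" .
    moreover have "0 \<le> real d * real q" by simp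
    ultimately have "170 * (real d * real q) \<le> real r * \<epsilon>\<^sup>2 / 512" by linarith
    also have "\<dots> = real r * (\<epsilon> / 8)\<^sup>2 / 8" by (simp add: power_divide)
    also have "170 * (real d * real q) = 170 * real q * real d" by simp
    finally have "170 * real q * real d \<le> real r * (\<epsilon> / 8)\<^sup>2 / 8" .
    then show "exp (- (real r * (\<epsilon> / 8)\<^sup>2 / 8)) \<le> exp (- (170 * real q * real d))" by simp
  qed auto
  also have "\<dots> = exp (- (160 * (real q * real d)))" by (simp flip: exp_add)
  also have "\<dots> \<le> exp (- 10)"
  proof -
    have "1 \<le> real q * real d" using q d by (metis One_nat_def Suc_leI mult_pos_pos of_nat_1 of_nat_le_iff of_nat_mult)
    then show ?thesis by (simp only: exp_le_cancel_iff)
  qed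
  also have "\<dots> = exp (-5) * exp (-5 :: real)" by (simp flip: exp_add)
  also have "\<dots> \<le> 0.011 * 0.011" by (intro mult_mono exp_neg_numerals) auto
  finally show ?thesis by simp
qed

lemma union_upper_prob:
  "prob P {g. \<exists>i<n. (1 + \<epsilon> / 4) * (real r * real m) * nsq (u i) < qf g (u i)} \<le> 0.026"
proof -
  have "prob P (\<Union>i\<in>{..<n}. {g. (1 + \<epsilon> / 4) * (real r * real m) * nsq (u i) < qf g (u i)})
     \<le> real (card {..<n}) * exp (- (real r * (\<epsilon> / 4)\<^sup>2 / (20 * (56 * real L))))"
    using \<epsilon> by (intro prob_UN_le upper_prob) auto
  also have "\<dots> \<le> exp (real L) * exp (- (5 * real L))"
  proof (intro mult_mono)
    have "real n \<le> 2 ^ L" using n by (metis of_nat_le_iff of_nat_numeral of_nat_power)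
    then show "real (card {..<n}) \<le> exp (real L)" using order_trans[OF _ two_power_le_exp[of L]] by simp
    have "90000 * (real L)\<^sup>2 \<le> 90000 * (real d * real q + (real L)\<^sup>2)" by simp
    also have "\<dots> \<le> real r * \<epsilon>\<^sup>2" using r \<epsilon> by (simp add: pos_divide_le_eq)
    finally have "90000 * (real L)\<^sup>2 \<le> real r * \<epsilon>\<^sup>2" .
    moreover have "0 \<le> (real L)\<^sup>2" by simp
    \<comment> \<open>89600 = 5 * 16 * 20 * 56 is the requirement behind the constant 90000 in
      \<open>r\<close>: exponent 5 L for each of at most e^L vectors, 16 from the square of
      \<epsilon> / 4, and 20 * 56 from the upper tail.\<close>
    ultimately have "89600 * (real L)\<^sup>2 \<le> real r * \<epsilon>\<^sup>2" by linarith
    then have "5 * real L * (17920 * real L) \<le> real r * \<epsilon>\<^sup>2" by (simp add: power2_eq_square)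
    then have "5 * real L \<le> real r * (\<epsilon> / 4)\<^sup>2 / (20 * (56 * real L))"
      using L by (simp add: pos_le_divide_eq power_divide)
    then show "exp (- (real r * (\<epsilon> / 4)\<^sup>2 / (20 * (56 * real L)))) \<le> exp (- (5 * real L))" by simp
  qed auto
  also have "\<dots> = exp (- (4 * real L))" by (simp flip: exp_add)
  also have "\<dots> \<le> exp (- 4)" using L by simp
  also have "\<dots> \<le> 0.026" by (rule exp_neg_numerals)
  finally show ?thesis by (simp add: UNION_eq Bex_def)
qed

lemma embedding_prob:
  "prob P {g. \<not> ((\<forall>z. (1 - \<epsilon> / 4) * (real r * real m) * nsq z \<le> qf g z) \<and>
      (\<forall>i<n. qf g (u i) \<le> (1 + \<epsilon> / 4) * (real r * real m) * nsq (u i)))} \<le> 0.06"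
proof -
  define G where "G = nat \<lceil>200 * real d / \<epsilon>\<rceil>"
  let ?A = "{g. 50 * real d * (real r * real m) < (\<Sum>b<r. \<Sum>j<d. (\<Phi> g b j)\<^sup>2)}"
  let ?B = "{g. \<exists>z :: nat \<Rightarrow> int. (\<forall>j<d. \<bar>z j\<bar> \<le> int G) \<and>
      qf g (\<lambda>j. real_of_int (z j)) < (1 - \<epsilon> / 8) * (real r * real m) * nsq (\<lambda>j. real_of_int (z j))}"
  let ?C = "{g. \<exists>i<n. (1 + \<epsilon> / 4) * (real r * real m) * nsq (u i) < qf g (u i)}"
  have "prob P {g. \<not> ((\<forall>z. (1 - \<epsilon> / 4) * (real r * real m) * nsq z \<le> qf g z) \<and>
      (\<forall>i<n. qf g (u i) \<le> (1 + \<epsilon> / 4) * (real r * real m) * nsq (u i)))} \<le> prob P ((?A \<union> ?B) \<union> ?C)"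
  proof (rule prob_mono, rule subsetI, rule ccontr)
    fix g assume g: "g \<in> {g. \<not> ((\<forall>z. (1 - \<epsilon> / 4) * (real r * real m) * nsq z \<le> qf g z) \<and>
      (\<forall>i<n. qf g (u i) \<le> (1 + \<epsilon> / 4) * (real r * real m) * nsq (u i)))} \<inter> set_pmf P"
      and not: "g \<notin> (?A \<union> ?B) \<union> ?C"
    have "(1 - \<epsilon> / 4) * (real r * real m) * nsq z \<le> qf g z" for z
    proof (rule lower_bound_from_grid[OF d, where G = G])
      show "200 * real d / \<epsilon> \<le> real G" unfolding G_def by (rule real_nat_ceiling_ge)
      show "(1 - \<epsilon> / 8) * (real r * real m) * nsq (\<lambda>j. real_of_int (z j)) \<le> qf g (\<lambda>j. real_of_int (z j))"
        if "\<And>j. j < d \<Longrightarrow> \<bar>z j\<bar> \<le> int G" for z :: "nat \<Rightarrow> int"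
        using not that by (force simp: not_less)
    qed (use not \<epsilon> in auto)
    moreover have "qf g (u i) \<le> (1 + \<epsilon> / 4) * (real r * real m) * nsq (u i)" if "i < n" for i
      using not that not_less by blast
    ultimately show False using g by blast
  qed
  also have "\<dots> \<le> (1 / 50 + 0.001) + 0.026"
    by (intro prob_Un_le frobenius_prob union_upper_prob grid_prob G_def)
  finally show ?thesis by simp
qed

end

section \<open>The Walsh-Hadamard transform\<close>

text \<open>The butterfly of constant geometry: neighbours are paired, sums go to the first half and
  differences to the second. Every level is the same map, so the program repeats one loop body and
  needs no strides that depend on the level.\<close>

definition butterfly :: "nat \<Rightarrow> (nat \<Rightarrow> real) \<Rightarrow> nat \<Rightarrow> real" where
  "butterfly M x k = (if k < M then x (2 * k) + x (2 * k + 1) else x (2 * (k - M)) - x (2 * (k - M) + 1))"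

lemma sum_even_odd:
  fixes f :: "nat \<Rightarrow> real"
  shows "(\<Sum>k<2 * M. f k) = (\<Sum>k<M. f (2 * k) + f (2 * k + 1))"
  by (induction M) (auto simp: numeral_2_eq_2)

text \<open>The parallelogram law on each pair.\<close>

lemma butterfly_norm: "(\<Sum>k<2 * M. (butterfly M x k)\<^sup>2) = 2 * (\<Sum>k<2 * M. (x k)\<^sup>2)"
proof -
  have "(\<Sum>k<M + M. (butterfly M x k)\<^sup>2)
      = (\<Sum>k<M. (x (2 * k) + x (2 * k + 1))\<^sup>2 + (x (2 * k) - x (2 * k + 1))\<^sup>2)"
    unfolding sum_lessThan_add sum.distrib by (simp add: butterfly_def)
  also have "\<dots> = (\<Sum>k<M. 2 * ((x (2 * k))\<^sup>2 + (x (2 * k + 1))\<^sup>2))"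
    by (intro sum.cong) (auto simp: power2_eq_square algebra_simps)
  also have "\<dots> = 2 * (\<Sum>k<2 * M. (x k)\<^sup>2)"
    by (simp add: sum_even_odd sum_distrib_left)
  finally show ?thesis by (simp only: mult_2[of M])
qed

lemma butterflies_norm: "(\<Sum>k<2 * M. ((butterfly M ^^ t) x k)\<^sup>2) = 2 ^ t * (\<Sum>k<2 * M. (x k)\<^sup>2)"
  by (induction t) (simp_all add: butterfly_norm)

text \<open>After \<open>t\<close> levels, entry \<open>k\<close> is a signed sum over the \<open>2 ^ t\<close> consecutive inputs from
  position \<open>2 ^ t * k mod 2 ^ L\<close> on; for \<open>t = L\<close> these are all inputs.\<close>

lemma butterflies_signed_sum:
  assumes "t \<le> Suc L'"
  shows "\<exists>s :: nat \<Rightarrow> nat \<Rightarrow> real. (\<forall>k b. (s k b)\<^sup>2 = 1) \<and>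
    (\<forall>x. \<forall>k<2 ^ Suc L'. (butterfly (2 ^ L') ^^ t) x k = (\<Sum>b<2 ^ t. s k b * x ((2 ^ t * k) mod 2 ^ Suc L' + b)))"
  using assms
proof (induction t)
  case 0
  show ?case by (rule exI[of _ "\<lambda>_ _. 1"]) simp
next
  case (Suc t)
  let ?N = "2 ^ Suc L' :: nat" and ?M = "2 ^ L' :: nat"
  obtain s :: "nat \<Rightarrow> nat \<Rightarrow> real" where s: "\<And>k b. (s k b)\<^sup>2 = 1"
    "\<And>x k. k < ?N \<Longrightarrow> (butterfly ?M ^^ t) x k = (\<Sum>b<2 ^ t. s k b * x ((2 ^ t * k) mod ?N + b))"
    using Suc by (metis Suc_leD)
  \<comment> \<open>Entry \<open>k\<close> of the next level combines the entries \<open>e k\<close>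
    and \<open>e k + 1\<close> of the current one, with sign \<open>\<sigma> k\<close> on the
    second. As \<open>e k\<close> is 2 k modulo the length, the inputs that these two entries cover
    are adjacent runs.\<close>
  define e where "e k = (if k < ?M then 2 * k else 2 * (k - ?M))" for k
  define \<sigma> where "\<sigma> k = (if k < ?M then 1 else - 1 :: real)" for k
  define s' where "s' k b = (if b < 2 ^ t then s (e k) b else \<sigma> k * s (e k + 1) (b - 2 ^ t))" for k b
  have "(butterfly ?M ^^ Suc t) x k = (\<Sum>b<2 ^ Suc t. s' k b * x ((2 ^ Suc t * k) mod ?N + b))"
    if k: "k < ?N" for x k
  proof -
    have e: "e k + 1 < ?N" "2 * k mod ?N = e k"
      using k by (auto simp: e_def mod_if)
    define p where "p = (2 ^ Suc t * k) mod ?N"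
    have p1: "(2 ^ t * e k) mod ?N = p"
      unfolding p_def e(2)[symmetric] mod_mult_right_eq by (simp add: mult.assoc mult.left_commute)
    \<comment> \<open>Both \<open>p\<close> and the length are multiples of 2^(t+1), so the doubled
      run starting at \<open>p\<close> does not wrap around.\<close>
    obtain w where w: "?N = 2 ^ Suc t * w" using Suc.prems by (metis dvd_def le_imp_power_dvd)
    have "2 ^ Suc t dvd p" unfolding p_def by (rule dvd_mod) (use w in auto)
    then obtain v where v: "p = 2 ^ Suc t * v" by blast
    have "p < ?N" unfolding p_def by simp
    then have "v < w" unfolding v w by simp
    then have "2 ^ Suc t * (v + 1) \<le> 2 ^ Suc t * w" by (intro mult_left_mono) auto
    then have "2 ^ Suc t * v + 2 ^ Suc t \<le> 2 ^ Suc t * w" by (simp only: add_mult_distrib2 mult_1_right)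
    moreover have "(2::nat) ^ t < 2 ^ Suc t" by simp
    ultimately have lt: "p + 2 ^ t < ?N" unfolding v w by linarith
    have p2: "(2 ^ t * (e k + 1)) mod ?N = p + 2 ^ t"
    proof -
      have "(2 ^ t * (e k + 1)) mod ?N = ((2 ^ t * e k) mod ?N + 2 ^ t) mod ?N"
        by (simp only: mod_add_left_eq) (simp add: algebra_simps)
      then show ?thesis using lt p1 by simp
    qed
    have "(butterfly ?M ^^ Suc t) x k = (butterfly ?M ^^ t) x (e k) + \<sigma> k * (butterfly ?M ^^ t) x (e k + 1)"
      by (simp add: butterfly_def e_def \<sigma>_def)
    also have "\<dots> = (\<Sum>b<2 ^ t. s (e k) b * x (p + b)) + \<sigma> k * (\<Sum>b<2 ^ t. s (e k + 1) b * x (p + 2 ^ t + b))"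
      using e s(2)[of "e k" x] s(2)[of "e k + 1" x] unfolding p1 p2 by simp
    also have "\<dots> = (\<Sum>b<2 ^ t + 2 ^ t. s' k b * x (p + b))"
      unfolding sum_lessThan_add sum_distrib_left by (simp add: s'_def mult_ac add_ac)
    finally show ?thesis unfolding p_def by (simp only: power_Suc mult_2)
  qed
  moreover have "(s' k b)\<^sup>2 = 1" for k b by (auto simp: s'_def \<sigma>_def power_mult_distrib s)
  ultimately show ?case by (intro exI[of _ s']) auto
qed

text \<open>Entries of square 1 and the norm identity are all that the probabilistic analysis needs.
  The identity comes from the parallelogram law, so the matrix never has to be written down.\<close>

lemma butterflies_hadamard:
  assumes "0 < L"
  obtains h :: "nat \<Rightarrow> nat \<Rightarrow> real" where "\<And>k i. (h k i)\<^sup>2 = 1"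
    "\<And>x k. k < 2 ^ L \<Longrightarrow> (butterfly (2 ^ (L - 1)) ^^ L) x k = (\<Sum>i<2 ^ L. h k i * x i)"
    "\<And>x. (\<Sum>k<2 ^ L. (\<Sum>i<2 ^ L. h k i * x i)\<^sup>2) = 2 ^ L * (\<Sum>i<2 ^ L. (x i)\<^sup>2)"
proof -
  obtain L' where L: "L = Suc L'" using assms by (cases L) auto
  obtain s :: "nat \<Rightarrow> nat \<Rightarrow> real" where s: "\<And>k b. (s k b)\<^sup>2 = 1"
    "\<And>x k. k < 2 ^ L \<Longrightarrow> (butterfly (2 ^ L') ^^ L) x k = (\<Sum>b<2 ^ L. s k b * x ((2 ^ L * k) mod 2 ^ L + b))"
    using butterflies_signed_sum[of L L'] unfolding L by auto
  show thesis
  proof (rule that[of s])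
    show eq: "(butterfly (2 ^ (L - 1)) ^^ L) x k = (\<Sum>i<2 ^ L. s k i * x i)" if "k < 2 ^ L" for x k
      using s(2)[OF that] by (simp add: L)
    show "(\<Sum>k<2 ^ L. (\<Sum>i<2 ^ L. s k i * x i)\<^sup>2) = 2 ^ L * (\<Sum>i<2 ^ L. (x i)\<^sup>2)" for x
      using butterflies_norm[where M = "2 ^ (L - 1)" and t = L and x = x] eq by (simp add: L)
  qed (rule s)
qed

section \<open>Leverage scores from a sketch\<close>

abbreviation sqnorm :: "real Matrix.vec \<Rightarrow> real" where "sqnorm v \<equiv> v \<bullet> v"

lemma sqnorm_nonneg: "0 \<le> sqnorm v"
  by (simp add: scalar_prod_def sum_nonneg)

lemma sqnorm_eq_0:
  assumes "v \<in> carrier_vec n" "sqnorm v = 0"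
  shows "v = 0\<^sub>v n"
proof (rule eq_vecI)
  fix i assume "i < dim_vec (0\<^sub>v n :: real Matrix.vec)"
  then show "v $ i = 0\<^sub>v n $ i"
    using assms by (auto simp: scalar_prod_def sum_nonneg_eq_0_iff)
qed (use assms in auto)

lemma Cauchy_Schwarz_vec:
  assumes "v \<in> carrier_vec n" "w \<in> carrier_vec n"
  shows "(v \<bullet> w)\<^sup>2 \<le> sqnorm v * sqnorm w"
  using Cauchy_Schwarz_ineq_sum[of "($) v" "($) w" "{0..<n}"] assms
  by (simp add: scalar_prod_def power2_eq_square)

lemma scalar_prod_mult_mat_vec:
  assumes "M \<in> carrier_mat n k" "v \<in> carrier_vec n" "w \<in> carrier_vec k"
  shows "v \<bullet> (M *\<^sub>v w) = (transpose_mat M *\<^sub>v v) \<bullet> (w :: real Matrix.vec)"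
  using transpose_vec_mult_scalar[OF assms(1,3,2)] assms
  by (simp add: comm_scalar_prod[of _ k])

lemma sqnorm_isometry:
  assumes "U \<in> carrier_mat n k" "transpose_mat U * U = 1\<^sub>m k" "w \<in> carrier_vec k"
  shows "sqnorm (U *\<^sub>v w) = sqnorm (w :: real Matrix.vec)"
proof -
  have "sqnorm (U *\<^sub>v w) = (transpose_mat U *\<^sub>v (U *\<^sub>v w)) \<bullet> w"
    using assms by (intro scalar_prod_mult_mat_vec) auto
  also have "transpose_mat U *\<^sub>v (U *\<^sub>v w) = (transpose_mat U * U) *\<^sub>v w"
    using assms by (intro assoc_mult_mat_vec[symmetric]) auto
  finally show ?thesis using assms by simp
qed

lemma mult_mat_zero_vec:
  "M \<in> carrier_mat n k \<Longrightarrow> M *\<^sub>v 0\<^sub>v k = (0\<^sub>v n :: real Matrix.vec)"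
  by (intro eq_vecI) auto

definition diag_inverse :: "real mat \<Rightarrow> real mat" where
  "diag_inverse S = Matrix.mat (dim_row S) (dim_row S) (\<lambda>(i, j). if i = j then 1 / S $$ (i, i) else 0)"

lemma diagonal_mult:
  assumes "S \<in> carrier_mat d d" "diagonal_mat S" "D \<in> carrier_mat d d" "i < d" "j < d"
  shows "(S * D) $$ (i, j) = S $$ (i, i) * (D $$ (i, j) :: real)"
proof -
  have "(S * D) $$ (i, j) = (\<Sum>k\<in>{0..<d}. S $$ (i, k) * D $$ (k, j))"
    using assms by (simp add: scalar_prod_def)
  also have "\<dots> = (\<Sum>k\<in>{0..<d}. if k = i then S $$ (i, i) * D $$ (i, j) else 0)"
    using assms by (intro sum.cong) (auto simp: diagonal_mat_def)
  finally show ?thesis using assms by simp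
qed

locale full_rank_svd =
  fixes A U S V :: "real mat" and n d :: nat
  assumes A: "A \<in> carrier_mat n d" and svd: "thin_svd A U S V"
    and inj: "\<And>z. z \<in> carrier_vec d \<Longrightarrow> A *\<^sub>v z = 0\<^sub>v n \<Longrightarrow> z = 0\<^sub>v d"
begin

lemma carriers: "U \<in> carrier_mat n d" "S \<in> carrier_mat d d" "V \<in> carrier_mat d d"
  and orth: "transpose_mat U * U = 1\<^sub>m d" "transpose_mat V * V = 1\<^sub>m d"
  and diag: "diagonal_mat S" and A_eq: "A = U * S * transpose_mat V"
  using svd A by (auto simp: thin_svd_def Let_def)

definition "K = S * transpose_mat V"

text \<open>The inverse of \<open>K\<close>. Since A = U K with orthonormal columns in
  \<open>U\<close>, changing coordinates by \<open>T\<close> whitens A. The program uses the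
  analogous product from the SVD of the sketch.\<close>

definition "T = V * diag_inverse S"

lemma KT_carrier: "K \<in> carrier_mat d d" "T \<in> carrier_mat d d" "diag_inverse S \<in> carrier_mat d d"
  using carriers by (auto simp: K_def T_def diag_inverse_def)

lemma A_UK: "A = U * K"
  unfolding A_eq K_def using carriers by (intro assoc_mult_mat) auto

text \<open>A zero singular value would put a column of \<open>V\<close> into the kernel of
  A.\<close>

lemma S_nonzero:
  assumes i: "i < d"
  shows "S $$ (i, i) \<noteq> 0"
proof
  assume z: "S $$ (i, i) = 0"
  let ?v = "V *\<^sub>v unit_vec d i"
  have v: "?v \<in> carrier_vec d" using carriers by auto
  have "transpose_mat V *\<^sub>v ?v = (transpose_mat V * V) *\<^sub>v unit_vec d i"
    using carriers by (intro assoc_mult_mat_vec[symmetric]) auto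
  then have Vv: "transpose_mat V *\<^sub>v ?v = unit_vec d i" by (simp add: orth)
  have "S *\<^sub>v unit_vec d i = 0\<^sub>v d"
  proof (rule eq_vecI)
    fix k assume "k < dim_vec (0\<^sub>v d :: real Matrix.vec)"
    then show "(S *\<^sub>v unit_vec d i) $ k = 0\<^sub>v d $ k"
      using carriers i z diag by (cases "k = i") (auto simp: scalar_prod_right_unit diagonal_mat_def)
  qed (use carriers in auto)
  moreover have "A *\<^sub>v ?v = U *\<^sub>v (S *\<^sub>v (transpose_mat V *\<^sub>v ?v))"
    unfolding A_eq using carriers v by (simp add: assoc_mult_mat_vec[of _ n d _ d])
  ultimately have "A *\<^sub>v ?v = 0\<^sub>v n" using mult_mat_zero_vec[OF carriers(1)] by (simp add: Vv)
  then have "?v = 0\<^sub>v d" using inj v by blast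
  then have "unit_vec d i = (0\<^sub>v d :: real Matrix.vec)"
    using Vv mult_mat_zero_vec[of "transpose_mat V" d d] carriers by simp
  then have "unit_vec d i $ i = (0\<^sub>v d :: real Matrix.vec) $ i" by simp
  then show False using i by simp
qed

lemma S_inverse: "S * diag_inverse S = 1\<^sub>m d"
proof (rule eq_matI)
  fix i j assume "i < dim_row (1\<^sub>m d :: real mat)" "j < dim_col (1\<^sub>m d :: real mat)"
  then have ij: "i < d" "j < d" by auto
  then show "(S * diag_inverse S) $$ (i, j) = 1\<^sub>m d $$ (i, j)"
    unfolding diagonal_mult[OF carriers(2) diag KT_carrier(3) ij]
    using carriers S_nonzero[of i] by (auto simp: diag_inverse_def)
qed (use carriers KT_carrier in auto)

lemma KT: "K * T = 1\<^sub>m d"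
proof -
  have "K * T = S * (transpose_mat V * (V * diag_inverse S))"
    unfolding K_def T_def using carriers KT_carrier by (intro assoc_mult_mat) auto
  also have "transpose_mat V * (V * diag_inverse S) = (transpose_mat V * V) * diag_inverse S"
    using carriers KT_carrier by (intro assoc_mult_mat[symmetric]) auto
  finally show ?thesis using KT_carrier by (simp add: orth S_inverse)
qed

lemma TK: "T * K = 1\<^sub>m d"
  by (rule mat_mult_left_right_inverse[OF KT_carrier(1,2) KT])

lemma T_index:
  assumes "j < d" "l < d"
  shows "T $$ (j, l) = V $$ (j, l) / S $$ (l, l)"
proof -
  have "T $$ (j, l) = (\<Sum>k\<in>{0..<d}. V $$ (j, k) * diag_inverse S $$ (k, l))"
    using assms carriers KT_carrier(3) by (simp add: T_def scalar_prod_def)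
  also have "\<dots> = (\<Sum>k\<in>{0..<d}. if k = l then V $$ (j, l) / S $$ (l, l) else 0)"
    using assms carriers by (intro sum.cong) (auto simp: diag_inverse_def)
  finally show ?thesis using assms by simp
qed

end

text \<open>If \<open>\<Phi>\<close> almost preserves the norm from below everywhere and from above at the rows of \<open>U\<close>,
  then the Gram matrix of \<open>\<Phi> * K\<close> gives almost the right leverage scores. The two bounds are two
  applications of the Cauchy-Schwarz inequality.\<close>

lemma sketched_leverage:
  assumes "full_rank_svd A U S V n d" and svdB: "thin_svd B U' S' V'"
    and \<Phi>: "\<Phi> \<in> carrier_mat r d" and B: "B = \<Phi> * (S * transpose_mat V)"
    and \<rho>: "0 < \<rho>" and \<delta>: "0 \<le> \<delta>" "\<delta> < 1" and i: "i < n"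
    and lower: "\<And>z. z \<in> carrier_vec d \<Longrightarrow> (1 - \<delta>) * \<rho> * sqnorm z \<le> sqnorm (\<Phi> *\<^sub>v z)"
    and upper: "sqnorm (\<Phi> *\<^sub>v row U i) \<le> (1 + \<delta>) * \<rho> * sqnorm (row U i)"
  defines "\<tau> \<equiv> (\<Sum>k<d. (\<Sum>j<d. A $$ (i, j) * (V' $$ (j, k) / S' $$ (k, k)))\<^sup>2)"
  shows "(1 - \<delta>) * \<rho> * \<tau> \<le> sqnorm (row U i)" "sqnorm (row U i) \<le> (1 + \<delta>) * \<rho> * \<tau>"
proof -
  interpret a: full_rank_svd A U S V n d by (rule assms(1))
  note [simp] = a.carriers a.KT_carrier
  have BK: "B = \<Phi> * a.K" using B by (simp add: a.K_def)
  have Bc: "B \<in> carrier_mat r d" using \<Phi> by (simp add: BK)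
  \<comment> \<open>The lower bound makes \<open>\<Phi>\<close> injective, so the sketch has full
    rank and its SVD can be inverted like that of A.\<close>
  interpret b: full_rank_svd B U' S' V' r d
  proof
    fix z :: "real Matrix.vec" assume z: "z \<in> carrier_vec d" "B *\<^sub>v z = 0\<^sub>v r"
    have Kz: "a.K *\<^sub>v z \<in> carrier_vec d" using mult_mat_vec_carrier[OF a.KT_carrier(1) z(1)] .
    have "B *\<^sub>v z = \<Phi> *\<^sub>v (a.K *\<^sub>v z)" unfolding BK using \<Phi> z by (intro assoc_mult_mat_vec) auto
    then have "\<Phi> *\<^sub>v (a.K *\<^sub>v z) = 0\<^sub>v r" using z by simp
    then have "(1 - \<delta>) * \<rho> * sqnorm (a.K *\<^sub>v z) \<le> 0" using lower[OF Kz] by (simp only:) simp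
    then have "sqnorm (a.K *\<^sub>v z) \<le> 0" using \<delta> \<rho> by (simp add: mult_le_0_iff)
    then have "a.K *\<^sub>v z = 0\<^sub>v d" using sqnorm_nonneg[of "a.K *\<^sub>v z"] by (intro sqnorm_eq_0[OF Kz]) simp
    moreover have "z = (a.T * a.K) *\<^sub>v z" using z by (simp add: a.TK)
    then have "z = a.T *\<^sub>v (a.K *\<^sub>v z)"
      using assoc_mult_mat_vec[OF a.KT_carrier(2,1) z(1)] by simp
    ultimately have "z = a.T *\<^sub>v 0\<^sub>v d" by simp
    then show "z = 0\<^sub>v d" using mult_mat_zero_vec[OF a.KT_carrier(2)] by simp
  qed (use Bc svdB in auto)
  note [simp] = b.carriers b.KT_carrier carrier_matD[OF a.carriers(1)] carrier_matD[OF a.KT_carrier(1)] carrier_matD[OF b.KT_carrier(2)]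
  define u where "u = row U i"
  \<comment> \<open>The squared norm of \<open>y\<close> is the form of the inverse Gram matrix of
    \<open>B\<close> at row \<open>i\<close> of A, because that inverse is \<open>b.T\<close> times
    its transpose.\<close>
  define y where "y = transpose_mat b.T *\<^sub>v row A i"
  have u [simp]: "u \<in> carrier_vec d" using a.carriers(1) i by (simp add: u_def)
  have rA [simp]: "row A i \<in> carrier_vec d" by (intro carrier_vecI) (use a.A in simp)
  have y [simp]: "y \<in> carrier_vec d" unfolding y_def by (intro carrier_vecI) simp
  have rowA: "row A i = transpose_mat a.K *\<^sub>v u"
  proof (rule eq_vecI)
    fix j assume "j < dim_vec (transpose_mat a.K *\<^sub>v u)"
    then have j: "j < d" using a.KT_carrier(1) by simp
    have "row A i $ j = row U i \<bullet> col a.K j" using j i a.carriers(1) a.KT_carrier(1) by (simp add: a.A_UK)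
    also have "\<dots> = col a.K j \<bullet> u" unfolding u_def
      using a.carriers(1) a.KT_carrier(1) i j by (intro comm_scalar_prod[of _ d]) auto
    finally show "row A i $ j = (transpose_mat a.K *\<^sub>v u) $ j" using j a.KT_carrier(1) by simp
  qed (use a.A a.KT_carrier(1) in auto)
  have yk: "y $ k = (\<Sum>j<d. A $$ (i, j) * (V' $$ (j, k) / S' $$ (k, k)))" if k: "k < d" for k
  proof -
    have "y $ k = col b.T k \<bullet> row A i" using k b.KT_carrier(2) by (simp add: y_def)
    also have "\<dots> = (\<Sum>j\<in>{0..<d}. b.T $$ (j, k) * A $$ (i, j))"
      using a.A b.KT_carrier(2) k i by (simp add: scalar_prod_def)
    finally show ?thesis
      using k by (simp add: b.T_index mult.commute atLeast0LessThan)
  qed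
  have \<tau>: "sqnorm y = \<tau>"
    using y by (auto simp: scalar_prod_def \<tau>_def yk power2_eq_square atLeast0LessThan intro!: sum.cong)
  have ay: "y \<bullet> z = u \<bullet> (a.K *\<^sub>v (b.T *\<^sub>v z))" if z: "z \<in> carrier_vec d" for z
  proof -
    have Tz: "b.T *\<^sub>v z \<in> carrier_vec d" using mult_mat_vec_carrier[OF b.KT_carrier(2) z] .
    have "y \<bullet> z = row A i \<bullet> (b.T *\<^sub>v z)"
      unfolding y_def by (rule scalar_prod_mult_mat_vec[OF b.KT_carrier(2) rA z, symmetric])
    also have "\<dots> = u \<bullet> (a.K *\<^sub>v (b.T *\<^sub>v z))"
      unfolding rowA by (rule scalar_prod_mult_mat_vec[OF a.KT_carrier(1) u Tz, symmetric])
    finally show ?thesis .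
  qed
  have \<Phi>K: "\<Phi> *\<^sub>v (a.K *\<^sub>v (b.T *\<^sub>v z)) = U' *\<^sub>v z" if z: "z \<in> carrier_vec d" for z
  proof -
    have Tz: "b.T *\<^sub>v z \<in> carrier_vec d" using mult_mat_vec_carrier[OF b.KT_carrier(2) z] .
    have KTz: "b.K *\<^sub>v (b.T *\<^sub>v z) = z"
      using assoc_mult_mat_vec[OF b.KT_carrier(1,2) z] z by (simp add: b.KT)
    have "\<Phi> *\<^sub>v (a.K *\<^sub>v (b.T *\<^sub>v z)) = B *\<^sub>v (b.T *\<^sub>v z)"
      unfolding BK using assoc_mult_mat_vec[OF \<Phi> a.KT_carrier(1) Tz] by simp
    also have "\<dots> = U' *\<^sub>v (b.K *\<^sub>v (b.T *\<^sub>v z))"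
      by (subst b.A_UK) (rule assoc_mult_mat_vec[OF b.carriers(1) b.KT_carrier(1) Tz])
    finally show ?thesis using KTz by simp
  qed
  have iso: "sqnorm (U' *\<^sub>v z) = sqnorm z" if "z \<in> carrier_vec d" for z
    using sqnorm_isometry[OF b.carriers(1) b.orth(1) that] .
  show "(1 - \<delta>) * \<rho> * \<tau> \<le> sqnorm (row U i)"
  proof (cases "\<tau> = 0")
    case True
    then show ?thesis by (simp add: sqnorm_nonneg)
  next
    case False
    then have \<tau>pos: "0 < \<tau>" using \<tau> sqnorm_nonneg[of y] by simp
    \<comment> \<open>With this \<open>w\<close> the inner product of \<open>u\<close> and
      \<open>w\<close> is \<tau>, and \<open>\<Phi>\<close> maps \<open>w\<close> to U' y, of
      squared norm \<tau>. The lower bound at \<open>w\<close> and Cauchy-Schwarz for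
      \<open>u\<close> and \<open>w\<close> then finish.\<close>
    define w where "w = a.K *\<^sub>v (b.T *\<^sub>v y)"
    have w: "w \<in> carrier_vec d"
      unfolding w_def using mult_mat_vec_carrier[OF a.KT_carrier(1) mult_mat_vec_carrier[OF b.KT_carrier(2) y]] .
    have 1: "(1 - \<delta>) * \<rho> * sqnorm w \<le> \<tau>"
      using lower[OF w] \<Phi>K[OF y] iso[OF y] \<tau> by (simp add: w_def)
    have "\<tau>\<^sup>2 \<le> sqnorm u * sqnorm w"
      using Cauchy_Schwarz_vec[OF u w] ay[OF y] \<tau> by (simp add: w_def)
    then have "(1 - \<delta>) * \<rho> * \<tau>\<^sup>2 \<le> (1 - \<delta>) * \<rho> * (sqnorm u * sqnorm w)"
      using \<delta> \<rho> by (intro mult_left_mono) auto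
    also have "\<dots> = sqnorm u * ((1 - \<delta>) * \<rho> * sqnorm w)" by (simp only: mult_ac)
    also have "\<dots> \<le> sqnorm u * \<tau>" by (intro mult_left_mono 1 sqnorm_nonneg)
    finally have "(1 - \<delta>) * \<rho> * \<tau> * \<tau> \<le> sqnorm u * \<tau>" by (simp add: power2_eq_square mult.assoc)
    then show ?thesis using \<tau>pos by (simp add: u_def)
  qed
  show "sqnorm (row U i) \<le> (1 + \<delta>) * \<rho> * \<tau>"
  proof (cases "sqnorm u = 0")
    case True
    then show ?thesis using \<tau> sqnorm_nonneg[of y] \<delta> \<rho> by (simp add: u_def)
  next
    case False
    then have upos: "0 < sqnorm u" using sqnorm_nonneg[of u] by simp
    define c where "c = a.T *\<^sub>v u"
    have c: "c \<in> carrier_vec d" unfolding c_def using mult_mat_vec_carrier[OF a.KT_carrier(2) u] .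
    \<comment> \<open>Conversely, \<open>z\<close> is chosen to be taken back to \<open>u\<close>.
      Its norm is that of the image of \<open>u\<close> under \<open>\<Phi>\<close>, and its inner
      product with \<open>y\<close> is the squared norm of \<open>u\<close>; so the upper bound is
      called at \<open>u\<close> only.\<close>
    define z where "z = b.K *\<^sub>v c"
    have z: "z \<in> carrier_vec d" unfolding z_def using mult_mat_vec_carrier[OF b.KT_carrier(1) c] .
    have "b.T *\<^sub>v z = c" unfolding z_def
      using assoc_mult_mat_vec[OF b.KT_carrier(2,1) c] c by (simp add: b.TK)
    moreover have "a.K *\<^sub>v c = u" unfolding c_def
      using assoc_mult_mat_vec[OF a.KT_carrier(1,2) u] u by (simp add: a.KT)
    ultimately have KTz: "a.K *\<^sub>v (b.T *\<^sub>v z) = u" by simp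
    have "sqnorm z = sqnorm (\<Phi> *\<^sub>v u)" using \<Phi>K[OF z] iso[OF z] by (simp add: KTz)
    then have "sqnorm z \<le> (1 + \<delta>) * \<rho> * sqnorm u" using upper by (simp add: u_def)
    moreover have "(sqnorm u)\<^sup>2 \<le> \<tau> * sqnorm z"
      using Cauchy_Schwarz_vec[OF y z] ay[OF z] \<tau> by (simp add: KTz)
    moreover have "\<tau> * sqnorm z \<le> \<tau> * ((1 + \<delta>) * \<rho> * sqnorm u)"
      using calculation(1) \<tau> sqnorm_nonneg[of y] by (intro mult_left_mono) auto
    ultimately have "sqnorm u * sqnorm u \<le> (1 + \<delta>) * \<rho> * \<tau> * sqnorm u"
      by (simp add: power2_eq_square mult_ac)
    then show ?thesis using upos by (simp add: u_def)
  qed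
qed

lemma full_rank_injective:
  fixes A :: "real mat"
  assumes A: "A \<in> carrier_mat n d" and rank: "vec_space.rank n A = d"
    and z: "z \<in> carrier_vec d" "A *\<^sub>v z = 0\<^sub>v n"
  shows "z = 0\<^sub>v d"
proof (rule ccontr)
  interpret vec_space "TYPE(real)" n .
  assume nz: "z \<noteq> 0\<^sub>v d"
  \<comment> \<open>Linear independence concerns the set of columns, so repetitions have to be
    excluded first: with one, a maximal independent set of columns would have fewer than d
    elements.\<close>
  have dist: "distinct (cols A)"
  proof (rule ccontr)
    assume "\<not> distinct (cols A)"
    then have "card (set (cols A)) < length (cols A)"
      using card_distinct card_length le_neq_implies_less by blast
    then have c: "card (set (cols A)) < d" using A by simp
    obtain S where S: "maximal S (\<lambda>T. T \<subseteq> set (cols A) \<and> lin_indpt T)"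
      using maximal_exists[of "\<lambda>T. T \<subseteq> set (cols A) \<and> lin_indpt T" "card (set (cols A))" "{}"]
      by (meson List.finite_set card_mono empty_iff empty_subsetI finite_lin_indpt2 rev_finite_subset)
    then have "card S \<le> card (set (cols A))" by (simp add: card_mono maximal_def)
    then show False using rank_card_indpt[OF A S] rank c by simp
  qed
  show False
    using full_rank_lin_indpt[OF A rank dist] lin_depI[OF A z(1) nz z(2) dist] by blast
qed

text \<open>A valid factorizer exhibits a thin SVD, so the choice in \<open>left_singular\<close> is
  made from an inhabited set.\<close>

lemma leverage_score_svd:
  assumes F: "valid_factorizer F" and A: "A \<in> carrier_mat n d" and "d \<le> n"
  obtains U S V where "thin_svd A U S V" "\<And>i. i < n \<Longrightarrow> leverage_score A i = sqnorm (row U i)"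
proof -
  obtain U0 S0 V0 where 0: "svd_of F A = (U0, S0, V0)" by (cases "svd_of F A")
  have dim: "dim_col A \<le> dim_row A" using A \<open>d \<le> n\<close> by simp
  note conjunct1[OF mp[OF spec[OF F[unfolded valid_factorizer_def]] dim]]
  then have "thin_svd A U0 S0 V0" by (simp add: 0)
  then have "\<exists>S V. thin_svd A (left_singular A) S V"
    unfolding left_singular_def by (metis (mono_tags, lifting) someI_ex)
  then obtain S V where svd: "thin_svd A (left_singular A) S V" by blast
  have c: "left_singular A \<in> carrier_mat n d" using svd A by (simp add: thin_svd_def Let_def)
  show thesis
  proof (rule that[OF svd])
    fix i assume "i < n"
    then show "leverage_score A i = sqnorm (row (left_singular A) i)"
      using A c by (simp add: leverage_score_def scalar_prod_def power2_eq_square atLeast0LessThan)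
  qed
qed

section \<open>Reasoning about programs\<close>

definition halts :: "factorizer \<Rightarrow> config \<Rightarrow> config pmf \<Rightarrow> bool" where
  "halts F cfg E \<longleftrightarrow> (\<exists>N. run F N cfg = E \<and> (\<forall>c\<in>set_pmf E. halted c))"

lemma run_halted: "halted cfg \<Longrightarrow> run F k cfg = return_pmf cfg"
  by (induction k) (cases cfg; auto simp: halted_def bind_return_pmf)+

lemma run_add: "run F (j + k) cfg = bind_pmf (run F j cfg) (run F k)"
proof (induction j arbitrary: cfg)
  case (Suc j)
  have "run F (j + k) = (\<lambda>c. bind_pmf (run F j c) (run F k))" using Suc by blast
  then show ?case by (simp add: bind_assoc_pmf)
qed (simp add: bind_return_pmf)

lemma run_mono:
  assumes "run F N cfg = E" "\<forall>c\<in>set_pmf E. halted c" "N \<le> M"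
  shows "run F M cfg = E"
proof -
  have "run F M cfg = bind_pmf E (run F (M - N))"
    using run_add[of F N "M - N" cfg] assms by simp
  also have "\<dots> = bind_pmf E return_pmf"
    using assms(2) by (intro bind_pmf_cong refl run_halted) auto
  finally show ?thesis by (simp add: bind_return_pmf')
qed

lemma halts_return: "halts F ([], s, t) (return_pmf ([], s, t))"
  unfolding halts_def by (rule exI[of _ 0]) (simp add: halted_def)

text \<open>Branches may halt after different numbers of steps. Finitely many outcomes have a common
  bound, and halted configurations no longer change, so every branch can be run up to that
  bound.\<close>

lemma halts_step:
  assumes st: "step F cfg = map_pmf f Q" and fin: "finite (set_pmf Q)"
    and G: "\<And>q. q \<in> set_pmf Q \<Longrightarrow> halts F (f q) (G q)"
  shows "halts F cfg (bind_pmf Q G)"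
proof -
  from G obtain N where N: "\<And>q. q \<in> set_pmf Q \<Longrightarrow> run F (N q) (f q) = G q \<and> (\<forall>c\<in>set_pmf (G q). halted c)"
    unfolding halts_def by metis
  define M where "M = Max (N ` set_pmf Q)"
  have "run F (Suc M) cfg = bind_pmf Q (\<lambda>q. run F M (f q))"
    by (simp add: st bind_map_pmf)
  also have "\<dots> = bind_pmf Q G"
  proof (rule bind_pmf_cong[OF refl])
    fix q assume q: "q \<in> set_pmf Q"
    then have "N q \<le> M" using fin unfolding M_def by (intro Max_ge) auto
    then show "run F M (f q) = G q" using N[OF q] run_mono by blast
  qed
  finally show ?thesis unfolding halts_def using N by (intro exI[of _ "Suc M"]) auto
qed

lemma halts_step_det:
  assumes "step F cfg = return_pmf cfg'" "halts F cfg' E"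
  shows "halts F cfg E"
  using halts_step[of F cfg "\<lambda>_. cfg'" "return_pmf ()" "\<lambda>_. E"] assms by (simp add: bind_return_pmf)

text \<open>Stated in continuation-passing style, because different random outcomes may need different
  numbers of machine steps.\<close>

definition computes :: "factorizer \<Rightarrow> com \<Rightarrow> store \<Rightarrow> (store \<times> nat) pmf \<Rightarrow> bool" where
  "computes F c s D \<longleftrightarrow> finite (set_pmf D) \<and>
     (\<forall>K t E. (\<forall>x\<in>set_pmf D. halts F (K, fst x, t + snd x) (E x)) \<longrightarrow>
        halts F (c # K, s, t) (bind_pmf D E))"

lemma computesD:
  assumes "computes F c s D" "\<And>x. x \<in> set_pmf D \<Longrightarrow> halts F (K, fst x, t + snd x) (E x)"
  shows "halts F (c # K, s, t) (bind_pmf D E)"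
  using assms unfolding computes_def by simp

text \<open>The distribution of the final store is exact. The time may depend on the random outcome,
  so only an upper bound valid on every branch is kept.\<close>

definition exec :: "factorizer \<Rightarrow> com \<Rightarrow> store \<Rightarrow> nat \<Rightarrow> store pmf \<Rightarrow> bool" where
  "exec F c s T D \<longleftrightarrow>
     (\<exists>D'. computes F c s D' \<and> map_pmf fst D' = D \<and> (\<forall>x\<in>set_pmf D'. snd x \<le> T))"

lemma exec_mono: "exec F c s T D \<Longrightarrow> T \<le> T' \<Longrightarrow> exec F c s T' D"
  unfolding exec_def using le_trans by blast

lemma exec_run:
  assumes "exec F c s T D"
  shows "\<exists>N. (\<forall>cfg\<in>set_pmf (run F N ([c], s, 0)). halted cfg \<and> time_spent cfg \<le> T) \<and>
             map_pmf (\<lambda>cfg. fst (snd cfg)) (run F N ([c], s, 0)) = D"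
proof -
  obtain D' where D': "computes F c s D'" "map_pmf fst D' = D" "\<And>x. x \<in> set_pmf D' \<Longrightarrow> snd x \<le> T"
    using assms unfolding exec_def by blast
  have "halts F ([c], s, 0) (bind_pmf D' (\<lambda>x. return_pmf ([], fst x, 0 + snd x)))"
    by (rule computesD[OF D'(1) halts_return])
  then obtain N where N: "run F N ([c], s, 0) = bind_pmf D' (\<lambda>x. return_pmf ([], fst x, 0 + snd x))"
    unfolding halts_def by blast
  have "map_pmf (\<lambda>cfg. fst (snd cfg)) (run F N ([c], s, 0)) = D"
    unfolding N D'(2)[symmetric] by (simp add: map_bind_pmf map_pmf_def bind_assoc_pmf bind_return_pmf)
  moreover have "halted cfg \<and> time_spent cfg \<le> T" if "cfg \<in> set_pmf (run F N ([c], s, 0))" for cfg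
    using that D'(3) unfolding N by (auto simp: halted_def time_spent_def)
  ultimately show ?thesis by blast
qed

lemma exec_det_stepI:
  assumes "\<And>K t. step F (c # K, s, t) = return_pmf (K, s', t + u)" "u \<le> T"
  shows "exec F c s T (return_pmf s')"
proof -
  have "computes F c s (return_pmf (s', u))"
    unfolding computes_def by (auto simp: bind_return_pmf intro: halts_step_det[OF assms(1)])
  then show ?thesis unfolding exec_def using assms(2)
    by (intro exI[of _ "return_pmf (s', u)"]) auto
qed

section \<open>Effect and cost of single commands\<close>

lemma exec_ISet:
  "exec F (ISet x e f) s (icost e + icost f + 1) (return_pmf (set_int x (ival e s) (ival f s) s))"
  by (rule exec_det_stepI[where u = "icost e + icost f + 1"]) (auto simp: add.assoc)

lemma exec_RSet:
  "exec F (RSet x e f a) s (icost e + icost f + rcost a + 1)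
     (return_pmf (set_real x (ival e s) (ival f s) (rval a s) s))"
  by (rule exec_det_stepI[where u = "icost e + icost f + rcost a + 1"]) (auto simp: add.assoc)

lemma exec_Svd:
  assumes "ival f s \<le> ival e s"
    "svd_of F (read_mat x (ival e s) (ival f s) s) = (U, S, V)"
  shows "exec F (Svd x e f xu xs xv) s (icost e + icost f + ival e s * (ival f s)\<^sup>2 + 1)
     (return_pmf (write_mat xv V (write_mat xs S (write_mat xu U s))))"
  by (rule exec_det_stepI[where u = "icost e + icost f + ival e s * (ival f s)\<^sup>2 + 1"])
     (use assms in \<open>auto simp: add.assoc Let_def\<close>)

lemma exec_Draw:
  "exec F (Draw x e f) s (icost e + icost f + 1)
     (map_pmf (\<lambda>k. set_int x (ival e s) k s) (pmf_of_set {0..ival f s}))"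
proof -
  let ?u = "icost e + icost f + 1"
  let ?D = "map_pmf (\<lambda>k. (set_int x (ival e s) k s, ?u)) (pmf_of_set {0..ival f s})"
  have "computes F (Draw x e f) s ?D"
    unfolding computes_def
  proof (intro conjI allI impI)
    show "finite (set_pmf ?D)" by simp
    fix K t E assume E: "\<forall>y\<in>set_pmf ?D. halts F (K, fst y, t + snd y) (E y)"
    show "halts F (Draw x e f # K, s, t) (bind_pmf ?D E)"
      unfolding bind_map_pmf
      by (rule halts_step[where f = "\<lambda>k. (K, set_int x (ival e s) k s, t + ?u)"])
         (use E in \<open>auto simp: add.assoc\<close>)
  qed
  then show ?thesis unfolding exec_def by (intro exI[of _ ?D]) (auto simp: pmf.map_comp o_def)
qed

text \<open>The common core of \<open>Seq\<close> and of a \<open>While\<close> whose test holds: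
  each replaces itself by two commands at cost \<open>w\<close>.\<close>

lemma computes_prefix:
  assumes "\<And>K t. step F (c # K, s, t) = return_pmf (c1 # c2 # K, s, t + w)"
    and 1: "computes F c1 s D1" and 2: "\<And>x. x \<in> set_pmf D1 \<Longrightarrow> computes F c2 (fst x) (D2 x)"
  shows "computes F c s (bind_pmf D1 (\<lambda>x. map_pmf (\<lambda>y. (fst y, w + snd x + snd y)) (D2 x)))"
  unfolding computes_def
proof (intro conjI allI impI)
  show "finite (set_pmf (bind_pmf D1 (\<lambda>x. map_pmf (\<lambda>y. (fst y, w + snd x + snd y)) (D2 x))))"
    using 1 2 by (auto simp: computes_def)
  fix K t E
  assume E: "\<forall>z\<in>set_pmf (bind_pmf D1 (\<lambda>x. map_pmf (\<lambda>y. (fst y, w + snd x + snd y)) (D2 x))).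
      halts F (K, fst z, t + snd z) (E z)"
  have "halts F (c2 # K, fst x, (t + w) + snd x)
      (bind_pmf (D2 x) (\<lambda>y. E (fst y, w + snd x + snd y)))" if "x \<in> set_pmf D1" for x
    using 2[OF that] E that unfolding computes_def by (fastforce simp: add.assoc)
  then have "halts F (c1 # c2 # K, s, t + w)
      (bind_pmf D1 (\<lambda>x. bind_pmf (D2 x) (\<lambda>y. E (fst y, w + snd x + snd y))))"
    by (rule computesD[OF 1])
  then show "halts F (c # K, s, t)
      (bind_pmf (bind_pmf D1 (\<lambda>x. map_pmf (\<lambda>y. (fst y, w + snd x + snd y)) (D2 x))) E)"
    by (simp add: bind_assoc_pmf bind_map_pmf halts_step_det[OF assms(1)])
qed

lemma exec_prefix:
  assumes st: "\<And>K t. step F (c # K, s, t) = return_pmf (c1 # c2 # K, s, t + w)"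
    and 1: "exec F c1 s T1 D1" and 2: "\<And>x. x \<in> set_pmf D1 \<Longrightarrow> exec F c2 x T2 (D2 x)"
  shows "exec F c s (w + T1 + T2) (bind_pmf D1 D2)"
proof -
  from 1 obtain D1' where D1': "computes F c1 s D1'" "map_pmf fst D1' = D1" "\<And>x. x \<in> set_pmf D1' \<Longrightarrow> snd x \<le> T1"
    unfolding exec_def by blast
  from 2 obtain D2' where D2': "\<And>x. x \<in> set_pmf D1 \<Longrightarrow> computes F c2 x (D2' x) \<and> map_pmf fst (D2' x) = D2 x
      \<and> (\<forall>y\<in>set_pmf (D2' x). snd y \<le> T2)"
    unfolding exec_def by metis
  let ?D = "bind_pmf D1' (\<lambda>x. map_pmf (\<lambda>y. (fst y, w + snd x + snd y)) (D2' (fst x)))"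
  have in1: "fst x \<in> set_pmf D1" if "x \<in> set_pmf D1'" for x
    using that D1'(2) by (auto simp flip: D1'(2))
  have "computes F c s ?D"
    using D2' in1 by (intro computes_prefix[OF st D1'(1)]) auto
  moreover have "map_pmf fst ?D = bind_pmf D1 D2"
  proof -
    have "map_pmf fst ?D = bind_pmf D1' (\<lambda>x. D2 (fst x))"
      using D2' in1 by (auto simp: map_bind_pmf pmf.map_comp o_def intro!: bind_pmf_cong)
    then show ?thesis by (simp add: bind_map_pmf flip: D1'(2))
  qed
  moreover have "snd z \<le> w + T1 + T2" if "z \<in> set_pmf ?D" for z
    using that D1'(3) D2' in1 by (fastforce intro: add_mono)
  ultimately show ?thesis unfolding exec_def by blast
qed

lemma exec_Seq:
  assumes "exec F c s T1 D1" "\<And>x. x \<in> set_pmf D1 \<Longrightarrow> exec F d x T2 (D2 x)"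
  shows "exec F (Seq c d) s (1 + T1 + T2) (bind_pmf D1 D2)"
  by (rule exec_prefix[OF _ assms]) auto

lemma exec_While_True:
  assumes "holds b s" "exec F c s T1 D1" "\<And>x. x \<in> set_pmf D1 \<Longrightarrow> exec F (While b c) x T2 (D2 x)"
  shows "exec F (While b c) s (tcost b + 1 + T1 + T2) (bind_pmf D1 D2)"
  by (rule exec_prefix[OF _ assms(2,3)]) (use assms(1) in auto)

lemma exec_While_False:
  assumes "\<not> holds b s"
  shows "exec F (While b c) s (tcost b + 1) (return_pmf s)"
  by (rule exec_det_stepI[where u = "tcost b + 1"]) (use assms in auto)

text \<open>A total-correctness triple with a time bound for code whose effect is deterministic: the
  result is a point mass.\<close>

definition tri :: "factorizer \<Rightarrow> (store \<Rightarrow> bool) \<Rightarrow> com \<Rightarrow> nat \<Rightarrow> (store \<Rightarrow> bool) \<Rightarrow> bool" where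
  "tri F P c T Q \<longleftrightarrow> (\<forall>s. P s \<longrightarrow> (\<exists>s'. exec F c s T (return_pmf s') \<and> Q s'))"

lemma tri_conseq:
  "tri F P' c T' Q' \<Longrightarrow> (\<And>s. P s \<Longrightarrow> P' s) \<Longrightarrow> (\<And>s. Q' s \<Longrightarrow> Q s) \<Longrightarrow> T' \<le> T \<Longrightarrow> tri F P c T Q"
  unfolding tri_def by (meson exec_mono)

lemma tri_ISet:
  assumes "\<And>s. P s \<Longrightarrow> Q (set_int x (ival e s) (ival f s) s)" "icost e + icost f + 1 \<le> T"
  shows "tri F P (ISet x e f) T Q"
  unfolding tri_def using assms exec_mono[OF exec_ISet] by blast

lemma tri_RSet:
  assumes "\<And>s. P s \<Longrightarrow> Q (set_real x (ival e s) (ival f s) (rval a s) s)"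
    "icost e + icost f + rcost a + 1 \<le> T"
  shows "tri F P (RSet x e f a) T Q"
  unfolding tri_def using assms exec_mono[OF exec_RSet] by blast

lemma tri_Seq:
  assumes "tri F P c Ta Q" "tri F Q d Tb R" "1 + Ta + Tb \<le> T"
  shows "tri F P (Seq c d) T R"
  unfolding tri_def
proof (intro allI impI)
  fix s assume "P s"
  then obtain s1 where 1: "exec F c s Ta (return_pmf s1)" "Q s1" using assms(1) unfolding tri_def by blast
  then obtain s2 where 2: "exec F d s1 Tb (return_pmf s2)" "R s2" using assms(2) unfolding tri_def by blast
  have "exec F (Seq c d) s (1 + Ta + Tb) (bind_pmf (return_pmf s1) (\<lambda>_. return_pmf s2))"
    using 1 2 by (intro exec_Seq) auto
  then show "\<exists>s'. exec F (Seq c d) s T (return_pmf s') \<and> R s'"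
    using 2 assms(3) by (auto simp: bind_return_pmf intro: exec_mono)
qed

lemma tri_While:
  assumes body: "\<And>j. j < k \<Longrightarrow> tri F (J j) c T (J (Suc j))"
    and test: "\<And>j s. j \<le> k \<Longrightarrow> J j s \<Longrightarrow> holds b s \<longleftrightarrow> j < k"
    and T': "k * (T + tcost b + 1) + tcost b + 1 \<le> T'"
  shows "tri F (J 0) (While b c) T' (J k)"
proof -
  have "tri F (J j) (While b c) ((k - j) * (T + tcost b + 1) + tcost b + 1) (J k)" if "j \<le> k" for j
    using that
  proof (induction j rule: inc_induct)
    case base
    have "exec F (While b c) s (tcost b + 1) (return_pmf s)" if "J k s" for s
      using test[of k s] that by (intro exec_While_False) auto
    then show ?case unfolding tri_def by auto
  next
    case (step j)
    show ?case unfolding tri_def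
    proof (intro allI impI)
      fix s assume s: "J j s"
      then obtain s1 where 1: "exec F c s T (return_pmf s1)" "J (Suc j) s1"
        using body[OF step(2)] unfolding tri_def by blast
      let ?T = "(k - Suc j) * (T + tcost b + 1) + tcost b + 1"
      obtain s2 where 2: "exec F (While b c) s1 ?T (return_pmf s2)" "J k s2"
        using step.IH 1(2) unfolding tri_def by blast
      have "exec F (While b c) s (tcost b + 1 + T + ?T) (bind_pmf (return_pmf s1) (\<lambda>_. return_pmf s2))"
        using 1 2 s test[of j s] step(2) by (intro exec_While_True) auto
      moreover have "tcost b + 1 + T + ?T = (k - j) * (T + tcost b + 1) + tcost b + 1"
        using step(2) by (simp add: Suc_diff_Suc[symmetric] algebra_simps)
      ultimately have "exec F (While b c) s ((k - j) * (T + tcost b + 1) + tcost b + 1) (return_pmf s2)"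
        by (simp only: bind_return_pmf)
      then show "\<exists>s'. exec F (While b c) s ((k - j) * (T + tcost b + 1) + tcost b + 1) (return_pmf s') \<and> J k s'"
        using 2(2) by blast
    qed
  qed
  from this[of 0] show ?thesis by (rule tri_conseq) (use T' in auto)
qed

abbreviation Var :: "string \<Rightarrow> iexp" where "Var x \<equiv> IGet x (INum 0)"

abbreviation incr :: "string \<Rightarrow> com" where
  "incr x \<equiv> ISet x (INum 0) (IAdd (Var x) (INum 1))"

definition For :: "string \<Rightarrow> string \<Rightarrow> com \<Rightarrow> com" where
  "For x y c = Seq (ISet x (INum 0) (INum 0)) (While (ILess (Var x) (Var y)) (Seq c (incr x)))"

lemma ints_set_int: "ints (set_int x i k s) y j = (if y = x \<and> j = i then k else ints s y j)"
  by (simp add: set_int_def)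

lemma ints_set_int_other: "y \<noteq> x \<Longrightarrow> ints (set_int x i k s) y = ints s y"
  by (simp add: set_int_def)

lemma reals_set_int [simp]: "reals (set_int x i k s) = reals s"
  by (simp add: set_int_def)

lemma ints_set_real [simp]: "ints (set_real x i j r s) = ints s"
  by (simp add: set_real_def)

lemma reals_set_real:
  "reals (set_real x i j r s) = (reals s)(x := (reals s x)(i := (reals s x i)(j := r)))"
  by (simp add: set_real_def)

text \<open>An iteration adds 1 for the \<open>Seq\<close>, 6 for the increment and 6 for the test;
  the final 10 covers the initialization and the last test.\<close>

lemma tri_For:
  assumes pre: "\<And>s. P s \<Longrightarrow> I 0 (set_int x 0 0 s)"
    and body: "\<And>i. i < k \<Longrightarrow> tri F (\<lambda>s. I i s \<and> ints s x 0 = i) c T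
                 (\<lambda>s. I (Suc i) (set_int x 0 (Suc i) s) \<and> ints s x 0 = i)"
    and bnd: "\<And>i s. I i s \<Longrightarrow> ints s y 0 = k"
    and T': "k * (T + 13) + 10 \<le> T'"
  shows "tri F P (For x y c) T' (I k)"
proof -
  define J where "J i s \<longleftrightarrow> I i s \<and> ints s x 0 = i" for i s
  have 1: "tri F P (ISet x (INum 0) (INum 0)) 3 (J 0)"
    using pre by (intro tri_ISet) (auto simp: J_def ints_set_int)
  have 2: "tri F (J 0) (While (ILess (Var x) (Var y)) (Seq c (incr x))) (k * (T + 13) + 6) (J k)"
  proof (rule tri_While[where T = "T + 7"])
    show "tri F (J i) (Seq c (incr x)) (T + 7) (J (Suc i))" if "i < k" for i
    proof (rule tri_Seq[where Tb = 6])
      show "tri F (J i) c T (\<lambda>s. I (Suc i) (set_int x 0 (Suc i) s) \<and> ints s x 0 = i)"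
        using body[OF that] by (simp add: J_def[abs_def])
      show "tri F (\<lambda>s. I (Suc i) (set_int x 0 (Suc i) s) \<and> ints s x 0 = i) (incr x) 6 (J (Suc i))"
        by (rule tri_ISet) (auto simp: J_def ints_set_int)
    qed simp
  next
    show "holds (ILess (Var x) (Var y)) s \<longleftrightarrow> i < k" if "i \<le> k" "J i s" for i s
      using that(2) bnd[of i s] by (auto simp: J_def)
  next
    show "k * (T + 7 + tcost (ILess (Var x) (Var y)) + 1) + tcost (ILess (Var x) (Var y)) + 1 \<le> k * (T + 13) + 6"
      by simp
  qed
  have "tri F P (For x y c) (k * (T + 13) + 10) (J k)"
    unfolding For_def by (rule tri_Seq[OF 1 2]) simp
  then show ?thesis by (rule tri_conseq) (use T' in \<open>auto simp: J_def\<close>)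
qed

text \<open>The array has to be zero beforehand because \<open>unifs\<close> has default value 0
  outside its index set; only so does the final array equal the drawn function everywhere.
  \<open>h\<close> sends the drawn function to the final store.\<close>

lemma exec_draw_loop:
  fixes M :: nat
  assumes ne: "x \<noteq> y" "a \<noteq> x" "a \<noteq> y" and k: "ints s y 0 = k"
    and zero: "ints s a = (\<lambda>_. 0)"
    and M: "\<And>s'. (\<forall>z. z \<noteq> x \<longrightarrow> z \<noteq> a \<longrightarrow> ints s' z = ints s z) \<Longrightarrow> ival e s' = M"
  shows "\<exists>h. exec F (For x y (Draw a (Var x) e)) s (k * (icost e + 16) + 10)
           (map_pmf h (unifs k M)) \<and>
         (\<forall>f. reals (h f) = reals s \<and> (f \<in> set_pmf (unifs k M) \<longrightarrow> ints (h f) a = f) \<and>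
            (\<forall>z. z \<noteq> x \<longrightarrow> z \<noteq> a \<longrightarrow> ints (h f) z = ints s z))"
proof -
  define st where "st f j = s\<lparr>ints := (ints s)(a := (\<lambda>i. if i < j then f i else 0), x := (ints s x)(0 := j))\<rparr>"
    for f :: "nat \<Rightarrow> nat" and j
  let ?w = "While (ILess (Var x) (Var y)) (Seq (Draw a (Var x) e) (incr x))"
  let ?T = "icost e + 16"
  \<comment> \<open>The first \<open>j\<close> entries are already fixed by \<open>f\<close>; the
    remaining ones still have the product distribution on \<open>{j..<k}\<close>.\<close>
  have loop: "exec F ?w (st f j) ((k - j) * ?T + 6)
      (map_pmf (\<lambda>g. st (\<lambda>i. if i < j then f i else g i) k) (Pi_pmf {j..<k} 0 (\<lambda>_. unif M)))"
    if "j \<le> k" for j f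
    using that
  proof (induction j arbitrary: f rule: inc_induct)
    case base
    have "exec F ?w (st f k) 6 (return_pmf (st f k))"
      by (rule exec_mono[OF exec_While_False]) (use ne k in \<open>auto simp: st_def\<close>)
    moreover have "st (\<lambda>i. if i < k then f i else 0) k = st f k"
      unfolding st_def by (intro arg_cong[where f = "\<lambda>u. s\<lparr>ints := u\<rparr>"]) (auto simp: fun_eq_iff)
    ultimately show ?case by simp
  next
    case (step j)
    have ival: "ival e (st f j) = M" using ne by (intro M) (auto simp: st_def)
    have d: "exec F (Draw a (Var x) e) (st f j) (icost e + 3)
        (map_pmf (\<lambda>v. set_int a j v (st f j)) (unif M))"
      using exec_Draw[of F a "Var x" e "st f j"] ival ne by (simp add: st_def eval_nat_numeral)
    have st_Suc: "set_int x 0 (Suc j) (set_int a j v (st f j)) = st (f(j := v)) (Suc j)" for v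
      unfolding st_def set_int_def using ne by (auto simp: fun_eq_iff)
    have i: "exec F (incr x) (set_int a j v (st f j)) 6 (return_pmf (st (f(j := v)) (Suc j)))" for v
    proof -
      have "ival (IAdd (Var x) (INum 1)) (set_int a j v (st f j)) = Suc j"
        using ne by (simp add: st_def set_int_def)
      then show ?thesis
        using exec_ISet[of F x "INum 0" "IAdd (Var x) (INum 1)" "set_int a j v (st f j)"]
        by (simp add: st_Suc eval_nat_numeral)
    qed
    have di: "exec F (Seq (Draw a (Var x) e) (incr x)) (st f j) (icost e + 10)
        (map_pmf (\<lambda>v. st (f(j := v)) (Suc j)) (unif M))"
    proof -
      have "exec F (Seq (Draw a (Var x) e) (incr x)) (st f j) (1 + (icost e + 3) + 6)
        (bind_pmf (map_pmf (\<lambda>v. set_int a j v (st f j)) (unif M))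
           (\<lambda>s'. return_pmf (set_int x 0 (Suc j) s')))"
      proof (rule exec_Seq[OF d])
        fix s' assume "s' \<in> set_pmf (map_pmf (\<lambda>v. set_int a j v (st f j)) (unif M))"
        then obtain v where "s' = set_int a j v (st f j)" by auto
        then show "exec F (incr x) s' 6 (return_pmf (set_int x 0 (Suc j) s'))" using i st_Suc by simp
      qed
      then show ?thesis by (simp add: map_pmf_def bind_assoc_pmf bind_return_pmf st_Suc add.commute)
    qed
    \<comment> \<open>The continuation in \<open>exec_While_True\<close> is indexed by the store, so
      the drawn value is read back from it as \<open>ints s' a j\<close>.\<close>
    let ?D = "\<lambda>v. map_pmf (\<lambda>g. st (\<lambda>i. if i < Suc j then (f(j := v)) i else g i) k) (Pi_pmf {Suc j..<k} 0 (\<lambda>_. unif M))"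
    have "exec F ?w (st f j) (6 + (icost e + 10) + ((k - Suc j) * ?T + 6))
       (bind_pmf (map_pmf (\<lambda>v. st (f(j := v)) (Suc j)) (unif M)) (\<lambda>s'. ?D (ints s' a j)))"
    proof -
      have "exec F ?w (st f j) (tcost (ILess (Var x) (Var y)) + 1 + (icost e + 10) + ((k - Suc j) * ?T + 6))
       (bind_pmf (map_pmf (\<lambda>v. st (f(j := v)) (Suc j)) (unif M)) (\<lambda>s'. ?D (ints s' a j)))"
      proof (rule exec_While_True[OF _ di])
        show "holds (ILess (Var x) (Var y)) (st f j)" using step k ne by (simp add: st_def)
        fix s' assume "s' \<in> set_pmf (map_pmf (\<lambda>v. st (f(j := v)) (Suc j)) (unif M))"
        then obtain v where v: "s' = st (f(j := v)) (Suc j)" by auto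
        have "ints s' a j = v" using ne by (simp add: v st_def)
        then show "exec F ?w s' ((k - Suc j) * ?T + 6) (?D (ints s' a j))"
          by (simp only: v step.IH)
      qed
      then show ?thesis by simp
    qed
    moreover have "bind_pmf (map_pmf (\<lambda>v. st (f(j := v)) (Suc j)) (unif M)) (\<lambda>s'. ?D (ints s' a j))
       = map_pmf (\<lambda>g. st (\<lambda>i. if i < j then f i else g i) k) (Pi_pmf {j..<k} 0 (\<lambda>_. unif M))"
    proof -
      have *: "ints (st (f(j := v)) (Suc j)) a j = v" for v using ne by (simp add: st_def)
      have "{j..<k} = insert j {Suc j..<k}" using step by auto
      then have "Pi_pmf {j..<k} 0 (\<lambda>_. unif M) =
          map_pmf (\<lambda>(v, g). g(j := v)) (pair_pmf (unif M) (Pi_pmf {Suc j..<k} 0 (\<lambda>_. unif M)))"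
        by (simp add: Pi_pmf_insert)
      moreover have "(\<lambda>i. if i < Suc j then (f(j := v)) i else g i) = (\<lambda>i. if i < j then f i else (g(j := v)) i)" for v g
        by (auto simp: fun_eq_iff)
      ultimately show ?thesis
        by (simp only: * bind_map_pmf pmf.map_comp pair_pmf_def map_bind_pmf map_return_pmf o_def case_prod_conv)
           (simp only: map_pmf_def)
    qed
    moreover have "6 + (icost e + 10) + ((k - Suc j) * ?T + 6) = (k - j) * ?T + 6"
      using step by (simp add: Suc_diff_Suc[symmetric] algebra_simps)
    ultimately show ?case by (simp only:)
  qed
  have init: "exec F (ISet x (INum 0) (INum 0)) s 3 (return_pmf (st (\<lambda>_. 0) 0))"
  proof -
    have "set_int x 0 0 s = st (\<lambda>_. 0) 0"
      unfolding st_def set_int_def using zero by (auto simp: fun_eq_iff)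
    then show ?thesis using exec_ISet[of F x "INum 0" "INum 0" s] by (simp add: numeral_3_eq_3)
  qed
  define h where "h g = st g k" for g
  have "exec F (For x y (Draw a (Var x) e)) s (1 + 3 + (k * ?T + 6))
     (bind_pmf (return_pmf (st (\<lambda>_. 0) 0)) (\<lambda>_. map_pmf h (unifs k M)))"
    unfolding For_def
    by (rule exec_Seq[OF init]) (use loop[of 0 "\<lambda>_. 0"] in \<open>simp add: h_def[abs_def] atLeast0LessThan\<close>)
  moreover have "ints (h f) a = f" if "f \<in> set_pmf (unifs k M)" for f
    using that ne set_Pi_pmf_subset[of "{..<k}" 0 "\<lambda>_. unif M"]
    by (auto simp: h_def st_def fun_eq_iff)
  ultimately show ?thesis using ne
    by (intro exI[of _ h]) (auto simp: bind_return_pmf h_def st_def add.commute)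
qed

text \<open>At least one iteration absorbs the constant overhead, so the bounds of nested loops
  remain products.\<close>

lemma tri_For_pos:
  assumes "\<And>s. P s \<Longrightarrow> I 0 (set_int x 0 0 s)"
    and "\<And>i. i < k \<Longrightarrow> tri F (\<lambda>s. I i s \<and> ints s x 0 = i) c T
           (\<lambda>s. I (Suc i) (set_int x 0 (Suc i) s) \<and> ints s x 0 = i)"
    and "\<And>i s. I i s \<Longrightarrow> ints s y 0 = k" and k: "1 \<le> k"
  shows "tri F P (For x y c) (k * (T + 23)) (I k)"
proof (rule tri_For[OF assms(1-3)])
  have "k * (T + 23) = k * (T + 13) + k * 10" by (simp add: algebra_simps)
  then show "k * (T + 13) + 10 \<le> k * (T + 23)" using k by linarith
qed

lemma tri_For2:
  assumes pre: "\<And>s. P s \<Longrightarrow> J 0 0 s" and ne: "x \<noteq> y"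
    and body: "\<And>i j. i < a \<Longrightarrow> j < b \<Longrightarrow> tri F (\<lambda>s. J i j s \<and> ints s x 0 = i \<and> ints s y 0 = j) c T
          (\<lambda>s. J i (Suc j) s \<and> ints s x 0 = i \<and> ints s y 0 = j)"
    and nxt: "\<And>i s. i < a \<Longrightarrow> J i b s \<Longrightarrow> J (Suc i) 0 s"
    and stable: "\<And>i j s v. J i j s \<Longrightarrow> J i j (set_int x 0 v s)" "\<And>i j s v. J i j s \<Longrightarrow> J i j (set_int y 0 v s)"
    and bnd: "\<And>i j s. J i j s \<Longrightarrow> ints s xa 0 = a" "\<And>i j s. J i j s \<Longrightarrow> ints s yb 0 = b"
    and pos: "1 \<le> a" "1 \<le> b" "a * b * (T + 46) \<le> T'"
  shows "tri F P (For x xa (For y yb c)) T' (J a 0)"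
proof -
  have inner: "tri F (\<lambda>s. J i 0 s \<and> ints s x 0 = i) (For y yb c) (b * (T + 23))
      (\<lambda>s. J i b s \<and> ints s x 0 = i)" if i: "i < a" for i
  proof (rule tri_For_pos[where I = "\<lambda>j s. J i j s \<and> ints s x 0 = i"])
    show "J i 0 (set_int y 0 0 s) \<and> ints (set_int y 0 0 s) x 0 = i" if "J i 0 s \<and> ints s x 0 = i" for s
      using that stable ne by (simp add: ints_set_int)
    show "tri F (\<lambda>s. (J i j s \<and> ints s x 0 = i) \<and> ints s y 0 = j) c T
       (\<lambda>s. (J i (Suc j) (set_int y 0 (Suc j) s) \<and> ints (set_int y 0 (Suc j) s) x 0 = i) \<and> ints s y 0 = j)" if "j < b" for j
      by (rule tri_conseq[OF body[OF i that]]) (use stable ne in \<open>auto simp: ints_set_int\<close>)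
  qed (use bnd pos in auto)
  have "tri F P (For x xa (For y yb c)) (a * (b * (T + 23) + 23)) (J a 0)"
  proof (rule tri_For_pos[where I = "\<lambda>i. J i 0"])
    show "J 0 0 (set_int x 0 0 s)" if "P s" for s using pre[OF that] stable by blast
    show "tri F (\<lambda>s. J i 0 s \<and> ints s x 0 = i) (For y yb c) (b * (T + 23))
       (\<lambda>s. J (Suc i) 0 (set_int x 0 (Suc i) s) \<and> ints s x 0 = i)" if "i < a" for i
      by (rule tri_conseq[OF inner[OF that]]) (use nxt[OF that] stable in auto)
  qed (use bnd pos in auto)
  then show ?thesis
  proof (rule tri_conseq)
    have "b * (T + 23) + 23 \<le> b * (T + 46)" using pos by (simp add: add_mult_distrib2)
    then have "a * (b * (T + 23) + 23) \<le> a * (b * (T + 46))" by (intro mult_left_mono) auto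
    then show "a * (b * (T + 23) + 23) \<le> T'" by (rule le_trans[OF _ pos(3)[unfolded mult.assoc]])
  qed auto
qed

section \<open>Filling, counting and accumulating loops\<close>

definition fill :: "string \<Rightarrow> string \<Rightarrow> string \<Rightarrow> iexp \<Rightarrow> rexp \<Rightarrow> com" where
  "fill a b X er e = For ''i'' a (For ''j'' b (RSet X er (Var ''j'') e))"

lemma tri_fill:
  assumes stable: "\<And>s v. Inv s \<Longrightarrow> Inv (set_int ''i'' 0 v s)" "\<And>s v. Inv s \<Longrightarrow> Inv (set_int ''j'' 0 v s)"
    and upd: "\<And>s i j v. Inv s \<Longrightarrow> i < a \<Longrightarrow> j < b \<Longrightarrow> Inv (set_real X (base + i) j v s)"
    and bnd: "\<And>s. Inv s \<Longrightarrow> ints s xa 0 = a" "\<And>s. Inv s \<Longrightarrow> ints s yb 0 = b"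
    and ev: "\<And>s i j. Inv s \<Longrightarrow> i < a \<Longrightarrow> j < b \<Longrightarrow> ints s ''i'' 0 = i \<Longrightarrow> ints s ''j'' 0 = j \<Longrightarrow> ival er s = base + i"
      "\<And>s i j. Inv s \<Longrightarrow> i < a \<Longrightarrow> j < b \<Longrightarrow> ints s ''i'' 0 = i \<Longrightarrow> ints s ''j'' 0 = j \<Longrightarrow> rval e s = val i j"
    and pos: "1 \<le> a" "1 \<le> b" "a * b * (icost er + rcost e + 49) \<le> T'"
    and post: "\<And>s. Inv s \<Longrightarrow> (\<And>i j. i < a \<Longrightarrow> j < b \<Longrightarrow> reals s X (base + i) j = val i j) \<Longrightarrow> Q s"
  shows "tri F Inv (fill xa yb X er e) T' Q"
proof -
  define J where "J i j s \<longleftrightarrow> Inv s \<and> (\<forall>i' j'. i' < a \<and> j' < b \<and> (i' < i \<or> i' = i \<and> j' < j) \<longrightarrow> reals s X (base + i') j' = val i' j')" for i j s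
  have "tri F Inv (For ''i'' xa (For ''j'' yb (RSet X er (Var ''j'') e))) T' (J a 0)"
  proof (rule tri_For2)
    fix i j assume ij: "i < a" "j < b"
    show "tri F (\<lambda>s. J i j s \<and> ints s ''i'' 0 = i \<and> ints s ''j'' 0 = j) (RSet X er (Var ''j'') e) (icost er + rcost e + 3)
        (\<lambda>s. J i (Suc j) s \<and> ints s ''i'' 0 = i \<and> ints s ''j'' 0 = j)"
    proof (rule tri_RSet)
      fix s assume s: "J i j s \<and> ints s ''i'' 0 = i \<and> ints s ''j'' 0 = j"
      then have I: "Inv s" by (simp add: J_def)
      have e: "ival er s = base + i" "rval e s = val i j" using ev I ij s by auto
      show "J i (Suc j) (set_real X (ival er s) (ival (Var ''j'') s) (rval e s) s)
         \<and> ints (set_real X (ival er s) (ival (Var ''j'') s) (rval e s) s) ''i'' 0 = i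
         \<and> ints (set_real X (ival er s) (ival (Var ''j'') s) (rval e s) s) ''j'' 0 = j"
        using s upd[OF I ij] by (auto simp: J_def e reals_set_real less_Suc_eq)
    qed simp
  next
    show "J (Suc i) 0 s" if "J i b s" for i s using that by (auto simp: J_def less_Suc_eq)
    show "a * b * (icost er + rcost e + 3 + 46) \<le> T'" using pos(3) by (simp add: add.assoc)
  qed (use pos stable bnd in \<open>auto simp: J_def\<close>)
  then show ?thesis unfolding fill_def
    by (rule tri_conseq) (auto simp: J_def intro: post)
qed

text \<open>The machine can neither round a real to a natural nor multiply naturals. Products and
  quotients are therefore evaluated in the reals and approached from below by a counter, in time
  proportional to the value.\<close>

definition count_up :: "string \<Rightarrow> rexp \<Rightarrow> com" where
  "count_up x e = Seq (ISet x (INum 0) (INum 0)) (While (RLess (RNat (Var x)) e) (incr x))"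

lemma tri_count_up:
  assumes stable: "\<And>s w. Inv s \<Longrightarrow> Inv (set_int x 0 w s)" and ev: "\<And>s. Inv s \<Longrightarrow> rval e s = v"
    and T: "(nat \<lceil>v\<rceil> + 1) * (rcost e + 20) \<le> T"
    and post: "\<And>s. Inv s \<Longrightarrow> ints s x 0 = nat \<lceil>v\<rceil> \<Longrightarrow> Q s"
  shows "tri F Inv (count_up x e) T Q"
proof -
  define J where "J j s \<longleftrightarrow> Inv s \<and> ints s x 0 = j" for j s
  let ?k = "nat \<lceil>v\<rceil>"
  have "tri F Inv (count_up x e) ((?k + 1) * (rcost e + 20)) (J ?k)" unfolding count_up_def
  proof (rule tri_Seq)
    show "tri F Inv (ISet x (INum 0) (INum 0)) 3 (J 0)"
      by (rule tri_ISet) (auto simp: J_def stable ints_set_int)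
    show "tri F (J 0) (While (RLess (RNat (Var x)) e) (incr x)) (?k * (rcost e + 11) + rcost e + 5) (J ?k)"
    proof (rule tri_While[where T = 6])
      show "tri F (J j) (incr x) 6 (J (Suc j))" for j
        by (rule tri_ISet) (auto simp: J_def stable ints_set_int)
      show "holds (RLess (RNat (Var x)) e) s \<longleftrightarrow> j < ?k" if "J j s" for j s
        using that ev[of s] by (auto simp: J_def less_ceiling_iff zless_nat_eq_int_zless)
    qed (simp add: algebra_simps)
  qed (simp add: algebra_simps)
  then show ?thesis by (rule tri_conseq) (use T post in \<open>auto simp: J_def\<close>)
qed

lemma tri_count_up_nat:
  assumes stable: "\<And>s w. Inv s \<Longrightarrow> Inv (set_int x 0 w s)" and ev: "\<And>s. Inv s \<Longrightarrow> rval e s = real v"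
    and T: "(v + 1) * (rcost e + 20) \<le> T" and post: "\<And>s. Inv s \<Longrightarrow> ints s x 0 = v \<Longrightarrow> Q s"
  shows "tri F Inv (count_up x e) T Q"
proof (rule tri_count_up[where Inv = Inv and v = "real v"])
  show "(nat \<lceil>real v\<rceil> + 1) * (rcost e + 20) \<le> T" using T by simp
  show "Q s" if "Inv s" "ints s x 0 = nat \<lceil>real v\<rceil>" for s using post that by simp
qed (fact stable ev)+

text \<open>The running counter \<open>c\<close> replaces the index arithmetic \<open>i * b + l\<close>, which the machine
  cannot do at unit cost.\<close>

definition accumulate :: "string \<Rightarrow> string \<Rightarrow> string \<Rightarrow> rexp \<Rightarrow> com" where
  "accumulate a b X e = Seq (ISet ''c'' (INum 0) (INum 0))
     (For ''i'' a (For ''l'' b (Seq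
        (For ''j'' ''d'' (RSet X (Var ''i'') (Var ''j'') (RAdd (RGet X (Var ''i'') (Var ''j'')) e)))
        (incr ''c''))))"

lemma tri_accumulate:
  assumes stable: "\<And>s x v. x \<in> {''i'', ''j'', ''l'', ''c''} \<Longrightarrow> Inv s \<Longrightarrow> Inv (set_int x 0 v s)"
    and upd: "\<And>s i j v. Inv s \<Longrightarrow> Inv (set_real X i j v s)"
    and bnd: "\<And>s. Inv s \<Longrightarrow> ints s xa 0 = a" "\<And>s. Inv s \<Longrightarrow> ints s xb 0 = b" "\<And>s. Inv s \<Longrightarrow> ints s ''d'' 0 = d"
    and ev: "\<And>s i l j. Inv s \<Longrightarrow> i < a \<Longrightarrow> l < b \<Longrightarrow> j < d \<Longrightarrow> ints s ''i'' 0 = i \<Longrightarrow> ints s ''l'' 0 = l \<Longrightarrow>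
        ints s ''j'' 0 = j \<Longrightarrow> ints s ''c'' 0 = i * b + l \<Longrightarrow> rval e s = val i l j"
    and pos: "1 \<le> a" "1 \<le> b" "1 \<le> d" "a * b * d * (rcost e + 100) \<le> T'"
    and pre: "\<And>s. P s \<Longrightarrow> Inv s \<and> reals s X = (\<lambda>_ _. 0)"
    and post: "\<And>s. Inv s \<Longrightarrow> (\<And>i j. i < a \<Longrightarrow> j < d \<Longrightarrow> reals s X i j = (\<Sum>l<b. val i l j)) \<Longrightarrow> Q s"
  shows "tri F P (accumulate xa xb X e) T' Q"
proof -
  define J where "J i l s \<longleftrightarrow> Inv s \<and> ints s ''c'' 0 = i * b + l \<and>
     (\<forall>i'<a. \<forall>j<d. reals s X i' j = (if i' < i then \<Sum>l<b. val i' l j else if i' = i then \<Sum>l'<l. val i' l' j else 0))" for i l s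
  let ?inner = "For ''j'' ''d'' (RSet X (Var ''i'') (Var ''j'') (RAdd (RGet X (Var ''i'') (Var ''j'')) e))"
  have inner: "tri F (\<lambda>s. J i l s \<and> ints s ''i'' 0 = i \<and> ints s ''l'' 0 = l) ?inner (d * (rcost e + 34))
     (\<lambda>s. J i (Suc l) (set_int ''c'' 0 (i * b + Suc l) s) \<and> ints s ''i'' 0 = i \<and> ints s ''l'' 0 = l \<and> ints s ''c'' 0 = i * b + l)"
    if il: "i < a" "l < b" for i l
  proof -
    define I where "I j s \<longleftrightarrow> Inv s \<and> ints s ''c'' 0 = i * b + l \<and> ints s ''i'' 0 = i \<and> ints s ''l'' 0 = l \<and>
     (\<forall>i'<a. \<forall>j'<d. reals s X i' j' = (if i' < i then \<Sum>l<b. val i' l j'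
        else if i' = i then (if j' < j then \<Sum>l'<Suc l. val i' l' j' else \<Sum>l'<l. val i' l' j') else 0))" for j s
    have "tri F (\<lambda>s. J i l s \<and> ints s ''i'' 0 = i \<and> ints s ''l'' 0 = l) ?inner (d * ((rcost e + 11) + 23)) (I d)"
    proof (rule tri_For_pos)
      show "I 0 (set_int ''j'' 0 0 s)" if "J i l s \<and> ints s ''i'' 0 = i \<and> ints s ''l'' 0 = l" for s
        using that by (auto simp: I_def J_def stable ints_set_int)
      show "tri F (\<lambda>s. I j s \<and> ints s ''j'' 0 = j) (RSet X (Var ''i'') (Var ''j'') (RAdd (RGet X (Var ''i'') (Var ''j'')) e)) (rcost e + 11)
         (\<lambda>s. I (Suc j) (set_int ''j'' 0 (Suc j) s) \<and> ints s ''j'' 0 = j)" if j: "j < d" for j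
      proof (rule tri_RSet)
        fix s assume s: "I j s \<and> ints s ''j'' 0 = j"
        then have Is: "Inv s" by (simp add: I_def)
        have e: "rval e s = val i l j" using ev[OF Is il j] s by (simp add: I_def)
        have "reals s X i j = (\<Sum>l'<l. val i l' j)" using s il j by (simp add: I_def)
        then show "I (Suc j) (set_int ''j'' 0 (Suc j) (set_real X (ival (Var ''i'') s) (ival (Var ''j'') s) (rval (RAdd (RGet X (Var ''i'') (Var ''j'')) e) s) s))
           \<and> ints (set_real X (ival (Var ''i'') s) (ival (Var ''j'') s) (rval (RAdd (RGet X (Var ''i'') (Var ''j'')) e) s) s) ''j'' 0 = j"
          using s stable[OF _ upd[OF Is]] by (auto simp: I_def e reals_set_real ints_set_int less_Suc_eq)
      qed simp
      show "ints s ''d'' 0 = d" if "I j s" for j s using that bnd by (simp add: I_def)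
    qed (use pos in auto)
    then show ?thesis
      by (rule tri_conseq) (auto simp: I_def J_def stable ints_set_int)
  qed
  have "tri F P (accumulate xa xb X e) (1 + 3 + a * b * (d * (rcost e + 34) + 7 + 46)) (J a 0)"
    unfolding accumulate_def
  proof (rule tri_Seq)
    show "tri F P (ISet ''c'' (INum 0) (INum 0)) 3 (J 0 0)"
      by (rule tri_ISet) (use pre in \<open>auto simp: J_def stable ints_set_int\<close>)
    show "tri F (J 0 0) (For ''i'' xa (For ''l'' xb (Seq ?inner (incr ''c'')))) (a * b * (d * (rcost e + 34) + 7 + 46)) (J a 0)"
    proof (rule tri_For2)
      fix i l assume il: "i < a" "l < b"
      show "tri F (\<lambda>s. J i l s \<and> ints s ''i'' 0 = i \<and> ints s ''l'' 0 = l) (Seq ?inner (incr ''c'')) (d * (rcost e + 34) + 7)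
        (\<lambda>s. J i (Suc l) s \<and> ints s ''i'' 0 = i \<and> ints s ''l'' 0 = l)"
      proof (rule tri_Seq[OF inner[OF il]])
        show "tri F (\<lambda>s. J i (Suc l) (set_int ''c'' 0 (i * b + Suc l) s) \<and> ints s ''i'' 0 = i \<and> ints s ''l'' 0 = l \<and> ints s ''c'' 0 = i * b + l)
          (incr ''c'') 6 (\<lambda>s. J i (Suc l) s \<and> ints s ''i'' 0 = i \<and> ints s ''l'' 0 = l)"
          by (rule tri_ISet) (auto simp: ints_set_int)
      qed simp
    next
      show "J (Suc i) 0 s" if "J i b s" for i s using that by (auto simp: J_def less_Suc_eq add.commute)
    qed (use pos stable bnd in \<open>auto simp: J_def ints_set_int\<close>)
  qed simp
  then show ?thesis
  proof (rule tri_conseq)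
    have d: "53 \<le> d * 53" using pos by simp
    have "d * (rcost e + 34) + 53 \<le> d * (rcost e + 87)" using d by (simp add: add_mult_distrib2)
    then have "a * b * (d * (rcost e + 34) + 53) \<le> a * b * (d * (rcost e + 87))" by (rule mult_le_mono2)
    moreover have "1 \<le> a * b * d" using pos by simp
    then have "4 \<le> a * b * d * 13" by linarith
    moreover have "a * b * (d * (rcost e + 87)) + a * b * d * 13 = a * b * d * (rcost e + 100)" by (simp add: algebra_simps)
    ultimately have "4 + a * b * (d * (rcost e + 34) + 53) \<le> a * b * d * (rcost e + 100)" by linarith
    then show "1 + 3 + a * b * (d * (rcost e + 34) + 7 + 46) \<le> T'" using pos(4) by (simp add: add.assoc)
  qed (auto simp: J_def intro: post)
qed

section \<open>The program\<close>

abbreviation RVar :: "string \<Rightarrow> rexp" where "RVar x \<equiv> RNat (Var x)"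

abbreviation sign_exp :: "string \<Rightarrow> string \<Rightarrow> rexp" where
  "sign_exp a x \<equiv> RSub (RNat (INum 1)) (RAdd (RNat (IGet a (Var x))) (RNat (IGet a (Var x))))"

abbreviation eps_exp :: rexp where "eps_exp \<equiv> RGet ''eps'' (INum 0) (INum 0)"

abbreviation zero_array :: "nat \<Rightarrow> nat \<Rightarrow> real" where "zero_array \<equiv> \<lambda>_ _. 0"

abbreviation double_N :: com where
  "double_N \<equiv> Seq (ISet ''M'' (INum 0) (Var ''N'')) (Seq (ISet ''N'' (INum 0) (IAdd (Var ''N'') (Var ''N''))) (incr ''L''))"

abbreviation p_exp :: rexp where "p_exp \<equiv> RGet ''p'' (INum 0) (INum 0)"

abbreviation set_p :: "rexp \<Rightarrow> com" where "set_p \<equiv> RSet ''p'' (INum 0) (INum 0)"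

abbreviation double_p :: com where "double_p \<equiv> Seq (set_p (RAdd p_exp p_exp)) (incr ''q'')"

abbreviation r_exp :: rexp where
  "r_exp \<equiv> RDiv (RMul (RNat (INum 90000)) (RAdd (RMul (RVar ''d'') (RVar ''q'')) (RMul (RVar ''L'') (RVar ''L'')))) (RMul eps_exp eps_exp)"

abbreviation m_exp :: rexp where "m_exp \<equiv> RMul (RMul (RNat (INum 56)) (RVar ''d'')) (RVar ''L'')"

abbreviation k_exp :: rexp where "k_exp \<equiv> RDiv (RMul (RNat (INum 2000)) (RVar ''L'')) (RMul eps_exp eps_exp)"

abbreviation even_X :: rexp where "even_X \<equiv> RGet ''X'' (IAdd (Var ''i'') (Var ''i'')) (Var ''j'')"

abbreviation odd_X :: rexp where "odd_X \<equiv> RGet ''X'' (IAdd (IAdd (Var ''i'') (Var ''i'')) (INum 1)) (Var ''j'')"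

abbreviation z_exp :: rexp where "z_exp \<equiv> RGet ''z'' (INum 0) (INum 0)"

abbreviation set_z :: "rexp \<Rightarrow> com" where "set_z \<equiv> RSet ''z'' (INum 0) (INum 0)"

abbreviation add_product :: com where
  "add_product \<equiv> set_z (RAdd z_exp (RMul (RGet ''A'' (Var ''i'') (Var ''j'')) (RGet ''W'' (Var ''l'') (Var ''j''))))"

text \<open>The unnormalized sketch inflates squared norms by r m, so forms of its inverse Gram
  matrix are too small by this factor. Dividing by \<open>k\<close> averages over the sign
  projections.\<close>

abbreviation score_exp :: rexp where
  "score_exp \<equiv> RAdd (RGet ''l'' (Var ''i'') (INum 0)) (RMul (RDiv (RMul (RVar ''r'') (RVar ''m'')) (RVar ''k'')) (RMul z_exp z_exp))"

definition log_n :: com where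
  "log_n = Seq (ISet ''N'' (INum 0) (INum 1)) (While (ILess (Var ''N'') (Var ''n''))
     double_N)"

definition log_d_eps :: com where
  "log_d_eps = Seq (set_p (RNat (INum 1)))
     (While (RLess p_exp (RDiv (RVar ''d'') eps_exp))
        double_p)"

definition sizes :: com where
  "sizes = Seq (count_up ''r'' r_exp)
     (Seq (count_up ''m'' m_exp)
     (Seq (count_up ''k'' k_exp)
     (Seq (count_up ''rm'' (RMul (RVar ''r'') (RVar ''m'')))
          (count_up ''kd'' (RMul (RVar ''k'') (RVar ''d''))))))"

text \<open>Rows from \<open>n\<close> on read the zeros with which the store was initialized, which
  pads A to a power of two.\<close>

definition init_X :: com where
  "init_X = fill ''N'' ''d'' ''X'' (Var ''i'') (RMul (sign_exp ''sg'' ''i'') (RGet ''A'' (Var ''i'') (Var ''j'')))"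

text \<open>In place, the sums would overwrite entries that the differences still need; hence the
  second array.\<close>

definition level :: com where
  "level = Seq (fill ''M'' ''d'' ''Y'' (Var ''i'') (RAdd even_X
                  odd_X))
     (Seq (fill ''M'' ''d'' ''Y'' (IAdd (Var ''M'') (Var ''i'')) (RSub even_X
                  odd_X))
          (fill ''N'' ''d'' ''X'' (Var ''i'') (RGet ''Y'' (Var ''i'') (Var ''j''))))"

definition negate :: com where
  "negate = fill ''N'' ''d'' ''X'' (IAdd (Var ''N'') (Var ''i'')) (RSub (RNat (INum 0)) (RGet ''X'' (Var ''i'') (Var ''j'')))"

definition sketch :: com where
  "sketch = accumulate ''r'' ''m'' ''B'' (RGet ''X'' (IGet ''K'' (Var ''c'')) (Var ''j''))"

text \<open>The signs are multiplied into V S^(-1) before A is touched. This costs k d^2 and then n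
  k d for the products with A, whereas whitening every row of A first would cost n d^2.\<close>

definition project :: com where
  "project = accumulate ''k'' ''d'' ''W''
     (RMul (RDiv (RGet ''bV'' (Var ''j'') (Var ''l'')) (RGet ''bS'' (Var ''l'') (Var ''l''))) (sign_exp ''G'' ''c''))"

definition write_scores :: com where
  "write_scores = For ''i'' ''n'' (For ''l'' ''k'' (Seq (set_z (RNat (INum 0)))
     (Seq (For ''j'' ''d'' add_product)
          (RSet ''l'' (Var ''i'') (INum 0) score_exp))))"

definition estimate :: com where
  "estimate = Seq init_X (Seq (For ''t'' ''L'' level) (Seq negate (Seq sketch
     (Seq (Svd ''B'' (Var ''r'') (Var ''d'') ''bU'' ''bS'' ''bV'') (Seq project write_scores)))))"

section \<open>Correctness and cost of the stages of the program\<close>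

lemma ints_write_mat [simp]: "ints (write_mat x M s) = ints s"
  by (simp add: write_mat_def)

lemma reals_write_mat_other: "y \<noteq> x \<Longrightarrow> reals (write_mat x M s) y = reals s y"
  by (simp add: write_mat_def)

lemma reals_write_mat: "M \<in> carrier_mat a b \<Longrightarrow> i < a \<Longrightarrow> j < b \<Longrightarrow> reals (write_mat x M s) x i j = M $$ (i, j)"
  by (simp add: write_mat_def)

locale machine_run =
  fixes F :: factorizer and n d L q r m k :: nat and \<epsilon> :: real and Af :: "nat \<Rightarrow> nat \<Rightarrow> real"
  assumes F: "valid_factorizer F"
    and pos: "1 \<le> n" "1 \<le> d" "1 \<le> L" "1 \<le> r" "1 \<le> m" "1 \<le> k" and dr: "d \<le> r"
begin

text \<open>The arrays required to be zero are the accumulators and the targets of the draws, whose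
  rules start from zero.\<close>

definition base :: "store \<Rightarrow> bool" where
  "base s \<longleftrightarrow> ints s ''n'' 0 = n \<and> ints s ''d'' 0 = d \<and> reals s ''A'' = Af \<and> reals s ''eps'' 0 0 = \<epsilon> \<and>
     reals s ''B'' = zero_array \<and> reals s ''W'' = zero_array \<and> reals s ''l'' = zero_array \<and>
     ints s ''sg'' = (\<lambda>_. 0) \<and> ints s ''K'' = (\<lambda>_. 0) \<and> ints s ''G'' = (\<lambda>_. 0)"

definition logs :: "nat \<Rightarrow> store \<Rightarrow> bool" where
  "logs q' s \<longleftrightarrow> base s \<and> ints s ''N'' 0 = 2 ^ L \<and> ints s ''L'' 0 = L \<and> ints s ''M'' 0 = 2 ^ (L - 1) \<and> ints s ''q'' 0 = q'"

lemma tri_log_n: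
  assumes "\<And>j. j < L \<longleftrightarrow> 2 ^ j < n"
  shows "tri F (\<lambda>s. base s \<and> ints s ''L'' 0 = 0 \<and> ints s ''q'' 0 = 0) log_n (L * 50 + 50) (logs 0)"
proof -
  define J where "J j s \<longleftrightarrow> base s \<and> ints s ''N'' 0 = 2 ^ j \<and> ints s ''L'' 0 = j \<and> (0 < j \<longrightarrow> ints s ''M'' 0 = 2 ^ (j - 1)) \<and> ints s ''q'' 0 = 0" for j s
  have "tri F (\<lambda>s. base s \<and> ints s ''L'' 0 = 0 \<and> ints s ''q'' 0 = 0) log_n (L * 50 + 50) (J L)"
    unfolding log_n_def
  proof (rule tri_Seq)
    show "tri F (\<lambda>s. base s \<and> ints s ''L'' 0 = 0 \<and> ints s ''q'' 0 = 0) (ISet ''N'' (INum 0) (INum 1)) 3 (J 0)"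
      by (rule tri_ISet) (auto simp: J_def base_def ints_set_int ints_set_int_other)
    show "tri F (J 0) (While (ILess (Var ''N'') (Var ''n''))
     double_N)
      (L * 50 + 20) (J L)"
    proof (rule tri_While[where T = 30])
      fix j
      let ?I = "\<lambda>c s. base s \<and> ints s ''N'' 0 = c \<and> ints s ''L'' 0 = j \<and> ints s ''M'' 0 = 2 ^ j \<and> ints s ''q'' 0 = 0"
      show "tri F (J j) double_N 30 (J (Suc j))"
      proof (rule tri_Seq)
        show "tri F (J j) (ISet ''M'' (INum 0) (Var ''N'')) 5
            (?I (2 ^ j))"
          by (rule tri_ISet) (auto simp: J_def base_def ints_set_int ints_set_int_other)
        show "tri F (?I (2 ^ j)) (Seq (ISet ''N'' (INum 0) (IAdd (Var ''N'') (Var ''N''))) (incr ''L'')) 20 (J (Suc j))"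
        proof (rule tri_Seq)
          show "tri F (?I (2 ^ j)) (ISet ''N'' (INum 0) (IAdd (Var ''N'') (Var ''N''))) 10
            (?I (2 ^ Suc j))"
            by (rule tri_ISet) (auto simp: J_def base_def ints_set_int ints_set_int_other)
          show "tri F (?I (2 ^ Suc j))
            (incr ''L'') 6 (J (Suc j))"
            by (rule tri_ISet) (auto simp: J_def base_def ints_set_int ints_set_int_other)
        qed simp
      qed simp
    next
      show "holds (ILess (Var ''N'') (Var ''n'')) s \<longleftrightarrow> j < L" if "J j s" for j s
        using that assms[of j] by (simp add: J_def base_def)
    qed simp
  qed simp
  then show ?thesis by (rule tri_conseq) (use pos in \<open>auto simp: J_def logs_def\<close>)
qed

lemma tri_log_d_eps:
  assumes "\<And>j. j < q \<longleftrightarrow> 2 ^ j < real d / \<epsilon>"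
  shows "tri F (logs 0) log_d_eps (q * 50 + 50) (logs q)"
proof -
  define J where "J j s \<longleftrightarrow> logs j s \<and> reals s ''p'' 0 0 = 2 ^ j" for j s
  have "tri F (logs 0) log_d_eps (q * 50 + 50) (J q)"
    unfolding log_d_eps_def
  proof (rule tri_Seq)
    show "tri F (logs 0) (set_p (RNat (INum 1))) 5 (J 0)"
      by (rule tri_RSet) (auto simp: J_def logs_def base_def reals_set_real)
    show "tri F (J 0) (While (RLess p_exp (RDiv (RVar ''d'') eps_exp))
        double_p)
      (q * 50 + 20) (J q)"
    proof (rule tri_While[where T = 30])
      fix j
      show "tri F (J j) double_p 30 (J (Suc j))"
      proof (rule tri_Seq)
        show "tri F (J j) (set_p (RAdd p_exp p_exp)) 20
          (\<lambda>s. logs j s \<and> reals s ''p'' 0 0 = 2 ^ Suc j)"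
          by (rule tri_RSet) (auto simp: J_def logs_def base_def reals_set_real)
        show "tri F (\<lambda>s. logs j s \<and> reals s ''p'' 0 0 = 2 ^ Suc j) (incr ''q'') 6 (J (Suc j))"
          by (rule tri_ISet) (auto simp: J_def logs_def base_def ints_set_int ints_set_int_other)
      qed simp
    next
      show "holds (RLess p_exp (RDiv (RVar ''d'') eps_exp)) s \<longleftrightarrow> j < q" if "J j s" for j s
        using that assms[of j] by (simp add: J_def logs_def base_def)
    qed simp
  qed simp
  then show ?thesis by (rule tri_conseq) (auto simp: J_def)
qed

definition params :: "store \<Rightarrow> bool" where
  "params s \<longleftrightarrow> logs q s \<and> ints s ''r'' 0 = r \<and> ints s ''m'' 0 = m \<and> ints s ''k'' 0 = k \<and>
     ints s ''rm'' 0 = r * m \<and> ints s ''kd'' 0 = k * d"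

lemma tri_sizes:
  assumes "r = nat \<lceil>90000 * (real d * real q + (real L)\<^sup>2) / \<epsilon>\<^sup>2\<rceil>" "m = 56 * d * L" "k = nat \<lceil>2000 * real L / \<epsilon>\<^sup>2\<rceil>"
  shows "tri F (logs q) sizes ((r + 1) * 50 + (m + 1) * 50 + (k + 1) * 50 + (r * m + 1) * 50 + (k * d + 1) * 50 + 10) params"
proof -
  note d = logs_def base_def ints_set_int ints_set_int_other power2_eq_square
  let ?r = "\<lambda>s. logs q s \<and> ints s ''r'' 0 = r"
  let ?m = "\<lambda>s. ?r s \<and> ints s ''m'' 0 = m"
  let ?k = "\<lambda>s. ?m s \<and> ints s ''k'' 0 = k"
  let ?rm = "\<lambda>s. ?k s \<and> ints s ''rm'' 0 = r * m"
  have 1: "tri F (logs q) (count_up ''r'' r_exp) ((r + 1) * 50) ?r"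
    by (rule tri_count_up[where v = "90000 * (real d * real q + (real L)\<^sup>2) / \<epsilon>\<^sup>2"]) (auto simp: d assms(1))
  have 2: "tri F ?r (count_up ''m'' m_exp) ((m + 1) * 50) ?m"
    by (rule tri_count_up_nat[where v = m]) (auto simp: d assms(2))
  have 3: "tri F ?m (count_up ''k'' k_exp) ((k + 1) * 50) ?k"
    by (rule tri_count_up[where v = "2000 * real L / \<epsilon>\<^sup>2"]) (auto simp: d assms(3))
  have 4: "tri F ?k (count_up ''rm'' (RMul (RVar ''r'') (RVar ''m''))) ((r * m + 1) * 50) ?rm"
    by (rule tri_count_up_nat[where v = "r * m"]) (auto simp: d)
  have 5: "tri F ?rm (count_up ''kd'' (RMul (RVar ''k'') (RVar ''d''))) ((k * d + 1) * 50) params"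
    by (rule tri_count_up_nat[where v = "k * d"]) (auto simp: d params_def)
  show ?thesis unfolding sizes_def
    by (rule tri_Seq[OF 1 tri_Seq[OF 2 tri_Seq[OF 3 tri_Seq[OF 4 5 order_refl] order_refl] order_refl]]) simp
qed

definition env :: "(nat \<Rightarrow> nat) \<Rightarrow> (nat \<Rightarrow> nat) \<Rightarrow> (nat \<Rightarrow> nat) \<Rightarrow> store \<Rightarrow> bool" where
  "env f g h s \<longleftrightarrow> ints s ''n'' 0 = n \<and> ints s ''d'' 0 = d \<and> reals s ''A'' = Af \<and> ints s ''N'' 0 = 2 ^ L \<and>
     ints s ''L'' 0 = L \<and> ints s ''M'' 0 = 2 ^ (L - 1) \<and> ints s ''r'' 0 = r \<and> ints s ''m'' 0 = m \<and> ints s ''k'' 0 = k \<and>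
     ints s ''sg'' = f \<and> ints s ''K'' = g \<and> ints s ''G'' = h"

lemma env_set_int: "x \<in> {''i'', ''j'', ''l'', ''c'', ''t''} \<Longrightarrow> env f g h (set_int x i v s) = env f g h s"
  unfolding insert_iff empty_iff
  by (elim disjE FalseE) (simp_all add: env_def ints_set_int_other)

lemma env_set_real: "x \<noteq> ''A'' \<Longrightarrow> env f g h (set_real x i j v s) = env f g h s"
  by (simp add: env_def reals_set_real)

context
  fixes f g h :: "nat \<Rightarrow> nat"
begin

lemma envD:
  assumes "env f g h s"
  shows "ints s ''n'' 0 = n" "ints s ''d'' 0 = d" "reals s ''A'' = Af" "ints s ''N'' 0 = 2 ^ L"
    "ints s ''L'' 0 = L" "ints s ''M'' 0 = 2 ^ (L - 1)" "ints s ''r'' 0 = r" "ints s ''m'' 0 = m" "ints s ''k'' 0 = k"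
    "ints s ''sg'' = f" "ints s ''K'' = g" "ints s ''G'' = h"
  using assms by (simp_all add: env_def)

definition x0 :: "nat \<Rightarrow> nat \<Rightarrow> real" where "x0 i j = sgn_of (f i) * Af i j"

definition fht :: "nat \<Rightarrow> nat \<Rightarrow> nat \<Rightarrow> real" where
  "fht t v j = (butterfly (2 ^ (L - 1)) ^^ t) (\<lambda>i. x0 i j) v"

definition rows :: "nat \<Rightarrow> nat \<Rightarrow> real" where
  "rows v j = (if v < 2 ^ L then fht L v j else - fht L (v - 2 ^ L) j)"

definition Bf :: "nat \<Rightarrow> nat \<Rightarrow> real" where "Bf b j = (\<Sum>l<m. rows (g (b * m + l)) j)"

definition Wf :: "real mat \<Rightarrow> real mat \<Rightarrow> nat \<Rightarrow> nat \<Rightarrow> real" where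
  "Wf S V c j = (\<Sum>l<d. V $$ (j, l) / S $$ (l, l) * sgn_of (h (c * d + l)))"

definition estimate_of :: "real mat \<Rightarrow> real mat \<Rightarrow> nat \<Rightarrow> real" where
  "estimate_of S V i = (\<Sum>c<k. real r * real m / real k * (\<Sum>j<d. Af i j * Wf S V c j)\<^sup>2)"

definition zeros :: "store \<Rightarrow> bool" where
  "zeros s \<longleftrightarrow> env f g h s \<and> reals s ''B'' = zero_array \<and> reals s ''W'' = zero_array \<and> reals s ''l'' = zero_array"

lemma zeros_set_int: "x \<in> {''i'', ''j'', ''l'', ''c'', ''t''} \<Longrightarrow> zeros (set_int x i v s) = zeros s"
  by (simp add: zeros_def env_set_int)

lemma zeros_set_real: "x \<in> {''X'', ''Y''} \<Longrightarrow> zeros (set_real x i j v s) = zeros s"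
  unfolding insert_iff empty_iff
  by (elim disjE FalseE) (simp_all add: zeros_def env_set_real reals_set_real)

lemma zerosD:
  assumes "zeros s"
  shows "ints s ''n'' 0 = n" "ints s ''d'' 0 = d" "reals s ''A'' = Af" "ints s ''N'' 0 = 2 ^ L"
    "ints s ''L'' 0 = L" "ints s ''M'' 0 = 2 ^ (L - 1)" "ints s ''sg'' = f"
  using assms by (simp_all add: zeros_def env_def)

lemma tri_init_X: "tri F zeros init_X (2 ^ L * d * 80) (\<lambda>s. zeros s \<and> (\<forall>i<2 ^ L. \<forall>j<d. reals s ''X'' i j = fht 0 i j))"
  unfolding init_X_def
  by (rule tri_fill[where base = 0 and a = "2 ^ L" and b = d and val = x0])
     (use pos in \<open>auto simp: zeros_set_int zeros_set_real fht_def x0_def zerosD\<close>)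

abbreviation at_level :: "nat \<Rightarrow> store \<Rightarrow> bool" where
  "at_level t s \<equiv> zeros s \<and> (\<forall>i<2 ^ L. \<forall>j<d. reals s ''X'' i j = fht t i j)"

lemma two_power_L: "2 ^ L = 2 * (2 ^ (L - 1) :: nat)"
  using pos by (cases L) auto

lemma fht_Suc:
  "i < 2 ^ (L - 1) \<Longrightarrow> fht (Suc t) i j = fht t (2 * i) j + fht t (2 * i + 1) j"
  "fht (Suc t) (2 ^ (L - 1) + i) j = fht t (2 * i) j - fht t (2 * i + 1) j"
  by (simp_all add: fht_def butterfly_def)

lemma tri_level: "tri F (\<lambda>s. at_level t s \<and> ints s ''t'' 0 = t) level (2 ^ L * d * 250) (\<lambda>s. at_level (Suc t) s \<and> ints s ''t'' 0 = t)"
  unfolding level_def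
proof (rule tri_Seq)
  let ?M = "2 ^ (L - 1) :: nat"
  let ?I0 = "\<lambda>s. at_level t s \<and> ints s ''t'' 0 = t"
  let ?I1 = "\<lambda>s. ?I0 s \<and> (\<forall>i<?M. \<forall>j<d. reals s ''Y'' i j = fht (Suc t) i j)"
  let ?I2 = "\<lambda>s. zeros s \<and> ints s ''t'' 0 = t \<and> (\<forall>i<2 ^ L. \<forall>j<d. reals s ''Y'' i j = fht (Suc t) i j)"
  show "tri F ?I0 (fill ''M'' ''d'' ''Y'' (Var ''i'') (RAdd even_X
                  odd_X)) (?M * d * 80) ?I1"
    by (rule tri_fill[where base = 0 and a = ?M and b = d and val = "fht (Suc t)"])
       (use pos in \<open>auto simp: zeros_set_int zeros_set_real ints_set_int reals_set_real fht_Suc[simplified] two_power_L mult_2 zerosD\<close>)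
  show "tri F ?I1 (Seq (fill ''M'' ''d'' ''Y'' (IAdd (Var ''M'') (Var ''i'')) (RSub even_X
                  odd_X))
          (fill ''N'' ''d'' ''X'' (Var ''i'') (RGet ''Y'' (Var ''i'') (Var ''j''))))
       (1 + ?M * d * 90 + 2 ^ L * d * 70) (\<lambda>s. at_level (Suc t) s \<and> ints s ''t'' 0 = t)"
  proof (rule tri_Seq)
    show "tri F ?I1 (fill ''M'' ''d'' ''Y'' (IAdd (Var ''M'') (Var ''i'')) (RSub even_X
                  odd_X)) (?M * d * 90) ?I2"
    proof (rule tri_fill[where base = ?M and a = ?M and b = d and val = "\<lambda>i. fht (Suc t) (?M + i)"])
      fix s assume s: "?I1 s" and Y: "\<And>i j. i < ?M \<Longrightarrow> j < d \<Longrightarrow> reals s ''Y'' (?M + i) j = fht (Suc t) (?M + i) j"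
      have "reals s ''Y'' i j = fht (Suc t) i j" if "i < 2 ^ L" "j < d" for i j
        using s Y[of "i - ?M" j] that two_power_L by (cases "i < ?M") auto
      then show "?I2 s" using s by blast
    qed (use pos in \<open>auto simp: zeros_set_int zeros_set_real ints_set_int reals_set_real fht_Suc[simplified] two_power_L mult_2 zerosD\<close>)
    show "tri F ?I2 (fill ''N'' ''d'' ''X'' (Var ''i'') (RGet ''Y'' (Var ''i'') (Var ''j''))) (2 ^ L * d * 70) (\<lambda>s. at_level (Suc t) s \<and> ints s ''t'' 0 = t)"
      by (rule tri_fill[where base = 0 and a = "2 ^ L" and b = d and val = "fht (Suc t)"])
         (use pos in \<open>auto simp: zeros_set_int zeros_set_real ints_set_int reals_set_real zerosD\<close>)
  qed simp
  have "1 \<le> ?M * d" using pos by simp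
  then show "1 + ?M * d * 80 + (1 + ?M * d * 90 + 2 ^ L * d * 70) \<le> 2 ^ L * d * 250"
    unfolding two_power_L by linarith
qed

lemma tri_transform: "tri F (at_level 0) (For ''t'' ''L'' level) (L * (2 ^ L * d * 273)) (at_level L)"
proof -
  have loop: "tri F (at_level 0) (For ''t'' ''L'' level) (L * (2 ^ L * d * 250 + 23)) (at_level L)"
  proof (rule tri_For_pos[where I = at_level and k = L])
    show "tri F (\<lambda>s. at_level t s \<and> ints s ''t'' 0 = t) level (2 ^ L * d * 250) (\<lambda>s. at_level (Suc t) (set_int ''t'' 0 (Suc t) s) \<and> ints s ''t'' 0 = t)" for t
      by (rule tri_conseq[OF tri_level]) (auto simp: zeros_set_int)
  qed (use pos in \<open>auto simp: zeros_set_int zerosD\<close>)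
  have "1 \<le> 2 ^ L * d" using pos by simp
  then have "2 ^ L * d * 250 + 23 \<le> 2 ^ L * d * 273" by linarith
  then have "L * (2 ^ L * d * 250 + 23) \<le> L * (2 ^ L * d * 273)" by (rule mult_le_mono2)
  then show ?thesis by (rule tri_conseq[OF loop, rotated 2]) auto
qed

abbreviation have_rows :: "store \<Rightarrow> bool" where
  "have_rows s \<equiv> zeros s \<and> (\<forall>v<2 * 2 ^ L. \<forall>j<d. reals s ''X'' v j = rows v j)"

lemma tri_negate: "tri F (at_level L) negate (2 ^ L * d * 80) have_rows"
  unfolding negate_def
proof (rule tri_fill[where base = "2 ^ L" and a = "2 ^ L" and b = d and val = "\<lambda>i j. - fht L i j"])
  fix s assume s: "at_level L s" and X: "\<And>i j. i < 2 ^ L \<Longrightarrow> j < d \<Longrightarrow> reals s ''X'' (2 ^ L + i) j = - fht L i j"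
  have "reals s ''X'' v j = rows v j" if "v < 2 * 2 ^ L" "j < d" for v j
    using s X[of "v - 2 ^ L" j] that by (cases "v < 2 ^ L") (auto simp: rows_def)
  then show "have_rows s" using s by blast
qed (use pos in \<open>auto simp: zeros_set_int zeros_set_real ints_set_int reals_set_real zerosD\<close>)

abbreviation sketched :: "store \<Rightarrow> bool" where
  "sketched s \<equiv> env f g h s \<and> reals s ''W'' = zero_array \<and> reals s ''l'' = zero_array \<and> (\<forall>i<r. \<forall>j<d. reals s ''B'' i j = Bf i j)"

lemma tri_sketch:
  assumes g: "\<And>i. i < r * m \<Longrightarrow> g i < 2 * 2 ^ L"
  shows "tri F have_rows sketch (r * m * d * 120) sketched"
  unfolding sketch_def
proof (rule tri_accumulate[where a = r and b = m and d = d and val = "\<lambda>i l j. rows (g (i * m + l)) j"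
      and Inv = "\<lambda>s. env f g h s \<and> reals s ''W'' = zero_array \<and> reals s ''l'' = zero_array \<and> (\<forall>v<2 * 2 ^ L. \<forall>j<d. reals s ''X'' v j = rows v j)"])
  fix s i l j
  assume s: "env f g h s \<and> reals s ''W'' = zero_array \<and> reals s ''l'' = zero_array \<and> (\<forall>v<2 * 2 ^ L. \<forall>j<d. reals s ''X'' v j = rows v j)"
    and i: "i < r" "l < m" "j < d" "ints s ''i'' 0 = i" "ints s ''l'' 0 = l" "ints s ''j'' 0 = j" "ints s ''c'' 0 = i * m + l"
  have "i * m + l < i * m + m" using i by simp
  also have "\<dots> = Suc i * m" by simp
  also have "\<dots> \<le> r * m" using i by (intro mult_right_mono) auto
  finally have "g (i * m + l) < 2 * 2 ^ L" by (rule g)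
  then show "rval (RGet ''X'' (IGet ''K'' (Var ''c'')) (Var ''j'')) s = rows (g (i * m + l)) j"
    using s i by (simp add: env_def)
qed (use pos in \<open>auto simp: env_set_int env_set_real reals_set_real zeros_def Bf_def envD\<close>)

abbreviation factored :: "real mat \<Rightarrow> real mat \<Rightarrow> store \<Rightarrow> bool" where
  "factored S V s \<equiv> env f g h s \<and> reals s ''W'' = zero_array \<and> reals s ''l'' = zero_array \<and>
     (\<forall>i<d. \<forall>j<d. reals s ''bS'' i j = S $$ (i, j) \<and> reals s ''bV'' i j = V $$ (i, j))"

abbreviation sketch_mat :: "real mat" where
  "sketch_mat \<equiv> Matrix.mat r d (\<lambda>(i, j). Bf i j)"

lemma thin_svd_sketch:
  assumes svd: "svd_of F sketch_mat = (U, S, V)"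
  shows "thin_svd sketch_mat U S V"
proof -
  have "dim_col sketch_mat \<le> dim_row sketch_mat" using dr by simp
  note conjunct1[OF mp[OF spec[OF F[unfolded valid_factorizer_def]] this]]
  then show ?thesis by (simp add: svd)
qed

lemma tri_svd:
  assumes svd: "svd_of F sketch_mat = (U, S, V)"
  shows "tri F sketched (Svd ''B'' (Var ''r'') (Var ''d'') ''bU'' ''bS'' ''bV'') (r * d\<^sup>2 + 5) (factored S V)"
  unfolding tri_def
proof (intro allI impI)
  fix s assume s: "sketched s"
  let ?s' = "write_mat ''bV'' V (write_mat ''bS'' S (write_mat ''bU'' U s))"
  have c: "S \<in> carrier_mat d d" "V \<in> carrier_mat d d"
    using thin_svd_sketch[OF svd] by (auto simp: thin_svd_def Let_def)
  have v: "ival (Var ''r'') s = r" "ival (Var ''d'') s = d" using s by (auto simp: env_def)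
  have "read_mat ''B'' r d s = sketch_mat" unfolding read_mat_def by (rule cong_mat) (use s in auto)
  then have "exec F (Svd ''B'' (Var ''r'') (Var ''d'') ''bU'' ''bS'' ''bV'') s
     (icost (Var ''r'') + icost (Var ''d'') + ival (Var ''r'') s * (ival (Var ''d'') s)\<^sup>2 + 1) (return_pmf ?s')"
    using v svd dr by (intro exec_Svd) auto
  then have "exec F (Svd ''B'' (Var ''r'') (Var ''d'') ''bU'' ''bS'' ''bV'') s (r * d\<^sup>2 + 5) (return_pmf ?s')"
    by (rule exec_mono) (simp add: v del: ival.simps)
  moreover have "factored S V ?s'"
    using s c by (auto simp: env_def reals_write_mat_other reals_write_mat[where a = d and b = d])
  ultimately show "\<exists>s'. exec F (Svd ''B'' (Var ''r'') (Var ''d'') ''bU'' ''bS'' ''bV'') s (r * d\<^sup>2 + 5) (return_pmf s') \<and> factored S V s'"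
    by blast
qed

abbreviation projected :: "real mat \<Rightarrow> real mat \<Rightarrow> store \<Rightarrow> bool" where
  "projected S V s \<equiv> env f g h s \<and> reals s ''l'' = zero_array \<and> (\<forall>c<k. \<forall>j<d. reals s ''W'' c j = Wf S V c j)"

lemma tri_project: "tri F (factored S V) project (k * d * d * 140) (projected S V)"
  unfolding project_def
  by (rule tri_accumulate[where a = k and b = d and d = d and val = "\<lambda>c l j. V $$ (j, l) / S $$ (l, l) * sgn_of (h (c * d + l))"
      and Inv = "\<lambda>s. env f g h s \<and> reals s ''l'' = zero_array \<and> (\<forall>i<d. \<forall>j<d. reals s ''bS'' i j = S $$ (i, j) \<and> reals s ''bV'' i j = V $$ (i, j))"])
     (use pos in \<open>auto simp: env_set_int env_set_real reals_set_real Wf_def envD\<close>)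

lemma tri_write_scores: "tri F (projected S V) write_scores (n * k * (d * 150)) (\<lambda>s. \<forall>i<n. reals s ''l'' i 0 = estimate_of S V i)"
proof -
  define J where "J i c s \<longleftrightarrow> env f g h s \<and> (\<forall>c<k. \<forall>j<d. reals s ''W'' c j = Wf S V c j) \<and>
     (\<forall>i'<n. reals s ''l'' i' 0 = (if i' < i then estimate_of S V i'
        else if i' = i then \<Sum>c'<c. real r * real m / real k * (\<Sum>j<d. Af i' j * Wf S V c' j)\<^sup>2 else 0))" for i c s
  have JI: "env f g h s" if "J i c s" for i c s using that by (simp add: J_def)
  have "tri F (projected S V) write_scores (n * k * (d * 150)) (J n 0)" unfolding write_scores_def
  proof (rule tri_For2)
    fix i c assume ic: "i < n" "c < k"
    let ?I = "\<lambda>j s. J i c s \<and> ints s ''i'' 0 = i \<and> ints s ''l'' 0 = c \<and> reals s ''z'' 0 0 = (\<Sum>j'<j. Af i j' * Wf S V c j')"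
    show "tri F (\<lambda>s. J i c s \<and> ints s ''i'' 0 = i \<and> ints s ''l'' 0 = c)
      (Seq (set_z (RNat (INum 0)))
     (Seq (For ''j'' ''d'' add_product)
          (RSet ''l'' (Var ''i'') (INum 0) score_exp)))
      (1 + 5 + (1 + d * (20 + 23) + 40))
      (\<lambda>s. J i (Suc c) s \<and> ints s ''i'' 0 = i \<and> ints s ''l'' 0 = c)"
    proof (rule tri_Seq)
      show "tri F (\<lambda>s. J i c s \<and> ints s ''i'' 0 = i \<and> ints s ''l'' 0 = c) (set_z (RNat (INum 0))) 5 (?I 0)"
        by (rule tri_RSet) (auto simp: J_def env_set_real reals_set_real)
      show "tri F (?I 0) (Seq (For ''j'' ''d'' add_product)
          (RSet ''l'' (Var ''i'') (INum 0) score_exp))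
         (1 + d * (20 + 23) + 40) (\<lambda>s. J i (Suc c) s \<and> ints s ''i'' 0 = i \<and> ints s ''l'' 0 = c)"
      proof (rule tri_Seq)
        show "tri F (?I 0) (For ''j'' ''d'' add_product) (d * (20 + 23)) (?I d)"
        proof (rule tri_For_pos[where I = ?I and k = d])
          show "tri F (\<lambda>s. ?I j s \<and> ints s ''j'' 0 = j) add_product 20
             (\<lambda>s. ?I (Suc j) (set_int ''j'' 0 (Suc j) s) \<and> ints s ''j'' 0 = j)" if "j < d" for j
            by (rule tri_RSet) (use that ic in \<open>auto simp: J_def env_set_real env_set_int reals_set_real ints_set_int envD\<close>)
        qed (use pos in \<open>auto simp: J_def env_set_int ints_set_int envD\<close>)
        show "tri F (?I d) (RSet ''l'' (Var ''i'') (INum 0) score_exp) 40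
            (\<lambda>s. J i (Suc c) s \<and> ints s ''i'' 0 = i \<and> ints s ''l'' 0 = c)"
        proof (rule tri_RSet)
          fix s assume s: "?I d s"
          then have e: "ints s ''r'' 0 = r" "ints s ''m'' 0 = m" "ints s ''k'' 0 = k" by (auto simp: J_def envD)
          show "J i (Suc c) (set_real ''l'' (ival (Var ''i'') s) (ival (INum 0) s) (rval score_exp s) s)
            \<and> ints (set_real ''l'' (ival (Var ''i'') s) (ival (INum 0) s) (rval score_exp s) s) ''i'' 0 = i
            \<and> ints (set_real ''l'' (ival (Var ''i'') s) (ival (INum 0) s) (rval score_exp s) s) ''l'' 0 = c"
            using s ic by (auto simp: J_def e env_set_real reals_set_real power2_eq_square)
        qed simp
      qed simp
    qed simp
  next
    show "J (Suc i) 0 s" if "i < n" "J i k s" for i s using that by (auto simp: J_def less_Suc_eq estimate_of_def)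
    have "d * 150 = d * 43 + d * 107" by simp
    then have "1 + 5 + (1 + d * (20 + 23) + 40) + 46 \<le> d * 150" using pos by simp
    then show "n * k * (1 + 5 + (1 + d * (20 + 23) + 40) + 46) \<le> n * k * (d * 150)" by (rule mult_le_mono2)
  qed (use pos in \<open>auto simp: J_def env_set_int envD\<close>)
  then show ?thesis by (rule tri_conseq) (auto simp: J_def)
qed

lemma tri_estimate:
  assumes g: "\<And>i. i < r * m \<Longrightarrow> g i < 2 * 2 ^ L" and svd: "svd_of F sketch_mat = (U, S, V)"
  shows "tri F zeros estimate (2 ^ L * d * 160 + L * (2 ^ L * d * 273) + r * m * d * 120 + r * d\<^sup>2 + k * d * d * 140 + n * k * (d * 150) + 11)
       (\<lambda>s. \<forall>i<n. reals s ''l'' i 0 = estimate_of S V i)"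
  unfolding estimate_def
  by (rule tri_Seq[OF tri_init_X tri_Seq[OF tri_transform tri_Seq[OF tri_negate tri_Seq[OF tri_sketch[OF g]
       tri_Seq[OF tri_svd[OF svd] tri_Seq[OF tri_project tri_write_scores order_refl] order_refl] order_refl] order_refl] order_refl]]) simp_all

end

end

section \<open>Failure probability\<close>

definition fails_with :: "factorizer \<Rightarrow> com \<Rightarrow> store \<Rightarrow> nat \<Rightarrow> (store \<Rightarrow> bool) \<Rightarrow> real \<Rightarrow> bool" where
  "fails_with F c s T Q p \<longleftrightarrow>
     (\<exists>D. exec F c s T D \<and> finite (set_pmf D) \<and> prob D {s'. \<not> Q s'} \<le> p)"

lemma fails_with_det:
  assumes "tri F P c T Q" "P s"
  shows "fails_with F c s T Q 0"
proof -
  obtain s' where s': "exec F c s T (return_pmf s')" "Q s'"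
    using assms unfolding tri_def by blast
  have "prob (return_pmf s') {s'. \<not> Q s'} \<le> 0"
    using s'(2) by (simp add: indicator_def)
  then show ?thesis unfolding fails_with_def using s'(1) by (intro exI[of _ "return_pmf s'"]) simp
qed

lemma fails_with_mono:
  assumes "fails_with F c s T Q p" "\<And>s. Q s \<Longrightarrow> Q' s" "p \<le> p'"
  shows "fails_with F c s T Q' p'"
proof -
  obtain D where D: "exec F c s T D" "finite (set_pmf D)" "prob D {s'. \<not> Q s'} \<le> p"
    using assms(1) unfolding fails_with_def by (elim exE conjE)
  have "prob D {s'. \<not> Q' s'} \<le> prob D {s'. \<not> Q s'}"
    by (rule prob_mono) (use assms(2) in auto)
  then have "prob D {s'. \<not> Q' s'} \<le> p'" using D(3) assms(3) by linarith
  then show ?thesis unfolding fails_with_def using D(1,2) by (intro exI[of _ D] conjI)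
qed

text \<open>Keeps the time bound on branches whose result has been given up.\<close>

lemma fails_with_one:
  assumes "fails_with F c s T Q p"
  shows "fails_with F c s T Q' 1"
proof -
  obtain D where "exec F c s T D" "finite (set_pmf D)"
    using assms unfolding fails_with_def by (elim exE conjE)
  then show ?thesis unfolding fails_with_def by (intro exI[of _ D] conjI) simp_all
qed

lemma fails_with_Seq:
  assumes c: "tri F P c Ta P'" "P s" and rest: "\<And>s'. P' s' \<Longrightarrow> fails_with F d s' Tb Q p"
  shows "fails_with F (Seq c d) s (1 + Ta + Tb) Q p"
proof -
  obtain s' where s': "exec F c s Ta (return_pmf s')" "P' s'" using c unfolding tri_def by blast
  obtain D where D: "exec F d s' Tb D" "finite (set_pmf D)" "prob D {s'. \<not> Q s'} \<le> p"
    using rest[OF s'(2)] unfolding fails_with_def by blast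
  have "exec F (Seq c d) s (1 + Ta + Tb) (bind_pmf (return_pmf s') (\<lambda>_. D))"
    by (rule exec_Seq[OF s'(1)]) (use D in auto)
  then show ?thesis unfolding fails_with_def using D by (auto simp: bind_return_pmf)
qed

text \<open>\<open>pre\<close> records whether the earlier draws were good. After a bad one only the
  trivial failure bound 1 is claimed, but termination and time are still proved for that
  branch.\<close>

lemma fails_with_draw:
  assumes ne: "a \<noteq> ''i''" "a \<noteq> y" "y \<noteq> ''i''" and k: "ints s y 0 = k" and zero: "ints s a = (\<lambda>_. 0)"
    and M: "\<And>s'. (\<forall>z. z \<noteq> ''i'' \<longrightarrow> z \<noteq> a \<longrightarrow> ints s' z = ints s z) \<Longrightarrow> ival e s' = M"
    and G: "pre \<Longrightarrow> prob (unifs k M) {f. \<not> G f} \<le> \<alpha>" and \<beta>: "0 \<le> \<beta>"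
    and rest: "\<And>f s'. f \<in> set_pmf (unifs k M) \<Longrightarrow> reals s' = reals s \<Longrightarrow> ints s' a = f \<Longrightarrow>
        (\<And>z. z \<noteq> ''i'' \<Longrightarrow> z \<noteq> a \<Longrightarrow> ints s' z = ints s z) \<Longrightarrow> fails_with F d s' Tb Q (if pre \<and> G f then \<beta> else 1)"
  shows "fails_with F (Seq (For ''i'' y (Draw a (Var ''i'') e)) d) s (1 + (k * (icost e + 16) + 10) + Tb) Q (if pre then \<alpha> + \<beta> else 1)"
proof -
  let ?P = "unifs k M"
  have fin: "finite (set_pmf ?P)" by (intro finite_set_Pi_pmf) auto
  obtain h where h: "exec F (For ''i'' y (Draw a (Var ''i'') e)) s (k * (icost e + 16) + 10) (map_pmf h ?P)"
    "\<And>f. reals (h f) = reals s" "\<And>f. f \<in> set_pmf ?P \<Longrightarrow> ints (h f) a = f"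
    "\<And>f z. z \<noteq> ''i'' \<Longrightarrow> z \<noteq> a \<Longrightarrow> ints (h f) z = ints s z"
    using exec_draw_loop[of "''i''" y a s k e M F] ne k zero M by auto
  have "\<exists>D. exec F d (h f) Tb D \<and> finite (set_pmf D) \<and> prob D {s'. \<not> Q s'} \<le> (if pre \<and> G f then \<beta> else 1)"
    if "f \<in> set_pmf ?P" for f
    using rest[OF that h(2) h(3)[OF that] h(4)] unfolding fails_with_def by blast
  then obtain D where D: "\<And>f. f \<in> set_pmf ?P \<Longrightarrow> exec F d (h f) Tb (D f) \<and> finite (set_pmf (D f)) \<and>
      prob (D f) {s'. \<not> Q s'} \<le> (if pre \<and> G f then \<beta> else 1)"
    by metis
  have "exec F (Seq (For ''i'' y (Draw a (Var ''i'') e)) d) s (1 + (k * (icost e + 16) + 10) + Tb)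
     (bind_pmf (map_pmf h ?P) (\<lambda>x. D (ints x a)))"
    by (rule exec_Seq[OF h(1)]) (use D h(3) in auto)
  moreover have "bind_pmf (map_pmf h ?P) (\<lambda>x. D (ints x a)) = bind_pmf ?P D"
    unfolding bind_map_pmf by (intro bind_pmf_cong refl) (simp add: h(3))
  moreover have "prob (bind_pmf ?P D) {s'. \<not> Q s'} \<le> (if pre then \<alpha> + \<beta> else 1)"
  proof (cases pre)
    case True
    have "prob (bind_pmf ?P D) {s'. \<not> Q s'} \<le> \<alpha> + \<beta>"
      by (rule prob_bind_le[OF G[OF True] \<beta> fin]) (use D True in \<open>force+\<close>)
    then show ?thesis using True by simp
  qed simp
  moreover have "finite (set_pmf (bind_pmf ?P D))" using fin D by auto
  ultimately show ?thesis unfolding fails_with_def by auto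
qed

section \<open>The random stages of the program\<close>

abbreviation draw_signs :: com where "draw_signs \<equiv> For ''i'' ''N'' (Draw ''sg'' (Var ''i'') (INum 1))"

abbreviation last_row :: iexp where "last_row \<equiv> ISub (IAdd (Var ''N'') (Var ''N'')) (INum 1)"

abbreviation draw_samples :: com where "draw_samples \<equiv> For ''i'' ''rm'' (Draw ''K'' (Var ''i'') last_row)"

abbreviation draw_projections :: com where "draw_projections \<equiv> For ''i'' ''kd'' (Draw ''G'' (Var ''i'') (INum 1))"

definition randomize :: com where
  "randomize = Seq draw_signs
     (Seq draw_samples
     (Seq draw_projections estimate))"

definition leverage_program :: com where
  "leverage_program = Seq log_n (Seq log_d_eps (Seq sizes randomize))"

context machine_run
begin

abbreviation signs :: "(nat \<Rightarrow> nat) pmf" where "signs \<equiv> unifs (2 ^ L) 1"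
abbreviation samples :: "(nat \<Rightarrow> nat) pmf" where "samples \<equiv> unifs (r * m) (2 * 2 ^ L - 1)"
abbreviation projections :: "(nat \<Rightarrow> nat) pmf" where "projections \<equiv> unifs (k * d) 1"

definition estimate_time :: nat where
  "estimate_time = 2 ^ L * d * 160 + L * (2 ^ L * d * 273) + r * m * d * 120 + r * d\<^sup>2 + k * d * d * 140 + n * k * (d * 150) + 11"

definition ready :: "(nat \<Rightarrow> nat) \<Rightarrow> (nat \<Rightarrow> nat) \<Rightarrow> (nat \<Rightarrow> nat) \<Rightarrow> store \<Rightarrow> bool" where
  "ready f g h s \<longleftrightarrow> zeros f g h s \<and> ints s ''rm'' 0 = r * m \<and> ints s ''kd'' 0 = k * d"

lemma samples_bound:
  assumes "g \<in> set_pmf samples" "i < r * m"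
  shows "g i < 2 * 2 ^ L"
proof -
  have "g i \<in> {0..2 * 2 ^ L - 1}"
    using assms by (auto simp: set_Pi_pmf PiE_dflt_def)
  moreover have "0 < (2::nat) * 2 ^ L" by simp
  ultimately show ?thesis by (metis Suc_pred' atLeastAtMost_iff less_Suc_eq_le)
qed

text \<open>The decomposition that \<open>F\<close> returns depends on \<open>f\<close> and
  \<open>g\<close> alone. It is fixed before the projection signs \<open>h\<close> are considered,
  so \<open>G3\<close> may refer to it although \<open>F\<close> is arbitrary.\<close>

lemma fails_randomize:
  assumes s: "params s" and nonneg: "0 \<le> \<alpha>2" "0 \<le> \<alpha>3"
    and G1: "prob signs {f. \<not> G1 f} \<le> \<alpha>1"
    and G2: "\<And>f. f \<in> set_pmf signs \<Longrightarrow> G1 f \<Longrightarrow> prob samples {g. \<not> G2 f g} \<le> \<alpha>2"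
    and G3: "\<And>f g. f \<in> set_pmf signs \<Longrightarrow> G1 f \<Longrightarrow> g \<in> set_pmf samples \<Longrightarrow> G2 f g \<Longrightarrow>
       prob projections {h. \<not> G3 f g h} \<le> \<alpha>3"
    and Q: "\<And>f g h U S V s. f \<in> set_pmf signs \<Longrightarrow> G1 f \<Longrightarrow> g \<in> set_pmf samples \<Longrightarrow> G2 f g \<Longrightarrow> G3 f g h \<Longrightarrow>
       svd_of F (sketch_mat f g) = (U, S, V) \<Longrightarrow> (\<And>i. i < n \<Longrightarrow> reals s ''l'' i 0 = estimate_of h S V i) \<Longrightarrow> Q s"
  shows "fails_with F randomize s (2 ^ L * 17 + r * m * 23 + k * d * 17 + 33 + estimate_time) Q (\<alpha>1 + (\<alpha>2 + \<alpha>3))"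
proof -
  have final: "fails_with F estimate s' estimate_time Q (if (G1 f \<and> G2 f g) \<and> G3 f g h then 0 else 1)"
    if f: "f \<in> set_pmf signs" and g: "g \<in> set_pmf samples" and s': "ready f g h s'" for f g h s'
  proof -
    obtain U S V where svd: "svd_of F (sketch_mat f g) = (U, S, V)" by (cases "svd_of F (sketch_mat f g)")
    have "tri F (zeros f g h) estimate estimate_time (\<lambda>s. \<forall>i<n. reals s ''l'' i 0 = estimate_of h S V i)"
      unfolding estimate_time_def by (rule tri_estimate[OF samples_bound[OF g] svd])
    then have *: "fails_with F estimate s' estimate_time (\<lambda>s. \<forall>i<n. reals s ''l'' i 0 = estimate_of h S V i) 0"
      by (rule fails_with_det) (use s' in \<open>simp add: ready_def\<close>)
    show ?thesis
    proof (cases "(G1 f \<and> G2 f g) \<and> G3 f g h")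
      case True
      have "fails_with F estimate s' estimate_time Q 0"
      proof (rule fails_with_mono[OF * _ order_refl])
        show "Q s" if "\<forall>i<n. reals s ''l'' i 0 = estimate_of h S V i" for s
          using True that by (intro Q[OF f _ g _ _ svd, of h]) auto
      qed
      then show ?thesis using True by simp
    next
      case False
      then show ?thesis using fails_with_one[OF *, of Q] by (simp only: if_False)
    qed
  qed
  let ?TG = "1 + (k * d * (icost (INum 1) + 16) + 10) + estimate_time"
  have stage3: "fails_with F (Seq draw_projections estimate) s' ?TG Q (if G1 f \<and> G2 f g then \<alpha>3 + 0 else 1)"
    if f: "f \<in> set_pmf signs" and g: "g \<in> set_pmf samples" and s': "ready f g (\<lambda>_. 0) s'" for f g s'
  proof (rule fails_with_draw[where M = 1 and G = "G3 f g"])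
    fix h and s'' :: store assume "reals s'' = reals s'" "ints s'' ''G'' = h"
      "\<And>z. z \<noteq> ''i'' \<Longrightarrow> z \<noteq> ''G'' \<Longrightarrow> ints s'' z = ints s' z"
    then have "ready f g h s''" using s' by (simp add: ready_def zeros_def env_def)
    then show "fails_with F estimate s'' estimate_time Q (if (G1 f \<and> G2 f g) \<and> G3 f g h then 0 else 1)"
      by (rule final[OF f g])
  qed (use s' f g G3 in \<open>auto simp: ready_def zeros_def env_def\<close>)
  let ?TK = "1 + (r * m * (icost last_row + 16) + 10) + ?TG"
  have stage2: "fails_with F (Seq draw_samples
     (Seq draw_projections estimate)) s' ?TK Q (if G1 f then \<alpha>2 + (\<alpha>3 + 0) else 1)"
    if f: "f \<in> set_pmf signs" and s': "ready f (\<lambda>_. 0) (\<lambda>_. 0) s'" for f s'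
  proof (rule fails_with_draw[where M = "2 * 2 ^ L - 1" and G = "G2 f"])
    fix g and s'' :: store assume g: "g \<in> set_pmf samples" and "reals s'' = reals s'" "ints s'' ''K'' = g"
      "\<And>z. z \<noteq> ''i'' \<Longrightarrow> z \<noteq> ''K'' \<Longrightarrow> ints s'' z = ints s' z"
    then have "ready f g (\<lambda>_. 0) s''" using s' by (simp add: ready_def zeros_def env_def)
    then show "fails_with F (Seq draw_projections estimate) s'' ?TG Q (if G1 f \<and> G2 f g then \<alpha>3 + 0 else 1)"
      by (rule stage3[OF f g])
  qed (use s' f G2 nonneg in \<open>auto simp: ready_def zeros_def env_def\<close>)
  have s0: "ready (\<lambda>_. 0) (\<lambda>_. 0) (\<lambda>_. 0) s"
    using s by (simp add: params_def logs_def base_def ready_def zeros_def env_def)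
  have "fails_with F randomize s (1 + (2 ^ L * (icost (INum 1) + 16) + 10) + ?TK) Q (if True then \<alpha>1 + (\<alpha>2 + (\<alpha>3 + 0)) else 1)"
    unfolding randomize_def
  proof (rule fails_with_draw[where M = 1 and G = G1])
    fix f and s' :: store assume f: "f \<in> set_pmf signs" and s': "reals s' = reals s" "ints s' ''sg'' = f"
      "\<And>z. z \<noteq> ''i'' \<Longrightarrow> z \<noteq> ''sg'' \<Longrightarrow> ints s' z = ints s z"
    then have "ready f (\<lambda>_. 0) (\<lambda>_. 0) s'" using s0 by (simp add: ready_def zeros_def env_def)
    then show "fails_with F (Seq draw_samples
     (Seq draw_projections estimate)) s' ?TK Q (if True \<and> G1 f then \<alpha>2 + (\<alpha>3 + 0) else 1)"
      using stage2[OF f] by simp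
  qed (use s0 G1 nonneg in \<open>auto simp: ready_def zeros_def env_def\<close>)
  then show ?thesis by (simp add: algebra_simps)
qed

end

section \<open>Accuracy and running time\<close>

abbreviation budget :: "nat \<Rightarrow> nat \<Rightarrow> real \<Rightarrow> real" where
  "budget n d \<epsilon> \<equiv> real n * real d * ln (real d / \<epsilon>) + real n * real d * ln (real n) / \<epsilon>\<^sup>2
     + real d ^ 3 * ln (real n) * ln (real d / \<epsilon>) / \<epsilon>\<^sup>2"

text \<open>Combines (j - 1) ln 2 \<le> ln x with ln 2 \<ge> 1/2, which gives j \<le> 2 ln x + 1,
  and 1 \<le> 2 ln 2 \<le> 2 ln x.\<close>

lemma log_bound:
  fixes x :: real
  assumes "2 \<le> x" "0 < j" "2 ^ (j - 1) < x"
  shows "real j \<le> 4 * ln x"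
proof -
  have "exp (1 / 2) \<le> (2::real)" using exp_bound[of "1 / 2"] by (simp add: power2_eq_square)
  then have ln2: "1 / 2 \<le> ln (2::real)" using ln_ge_iff[of 2 "1 / 2"] by simp
  have "real (j - 1) * ln 2 = ln (2 ^ (j - 1))" by (simp add: ln_realpow)
  also have "\<dots> \<le> ln x" using assms by simp
  finally have "real (j - 1) * ln 2 \<le> ln x" .
  moreover have "real (j - 1) * (1 / 2) \<le> real (j - 1) * ln 2" using ln2 by (intro mult_left_mono) auto
  moreover have "ln 2 \<le> ln x" using assms by simp
  moreover have "real j = real (j - 1) + 1" using assms by simp
  ultimately show ?thesis using ln2 by linarith
qed

text \<open>\<open>U\<close>, \<open>S\<close>, \<open>V\<close> and \<open>h\<close> serve the
  analysis; the program sees neither the SVD of A nor the matrix of the transform.\<close>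

locale leverage_run = machine_run F n d L q r m k \<epsilon> Af
  for F n d L q r m k \<epsilon> Af +
  fixes A U S V :: "real mat" and h :: "nat \<Rightarrow> nat \<Rightarrow> real"
  assumes A: "A \<in> carrier_mat n d" and Af: "Af = (\<lambda>i j. if i < n \<and> j < d then A $$ (i, j) else 0)"
    and svd: "full_rank_svd A U S V n d"
    and score: "\<And>i. i < n \<Longrightarrow> leverage_score A i = sqnorm (row U i)"
    and h_sq: "\<And>v i. (h v i)\<^sup>2 = 1"
    and h_butterfly: "\<And>x v. v < 2 ^ L \<Longrightarrow> (butterfly (2 ^ (L - 1)) ^^ L) x v = (\<Sum>i<2 ^ L. h v i * x i)"
    and h_norm: "\<And>x. (\<Sum>v<2 ^ L. (\<Sum>i<2 ^ L. h v i * x i)\<^sup>2) = 2 ^ L * (\<Sum>i<2 ^ L. (x i)\<^sup>2)"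
    and dn: "d < n" and L_iff: "\<And>j. j < L \<longleftrightarrow> 2 ^ j < n" and q_iff: "\<And>j. j < q \<longleftrightarrow> 2 ^ j < real d / \<epsilon>"
    and eps: "0 < \<epsilon>" "\<epsilon> \<le> 1 / 2"
    and r_def: "r = nat \<lceil>90000 * (real d * real q + (real L)\<^sup>2) / \<epsilon>\<^sup>2\<rceil>"
    and m_def: "m = 56 * d * L" and k_def: "k = nat \<lceil>2000 * real L / \<epsilon>\<^sup>2\<rceil>"
begin

interpretation a: full_rank_svd A U S V n d by (rule svd)

abbreviation "N \<equiv> 2 ^ L :: nat"

lemma nL: "n \<le> N" using L_iff[of L] by simp

lemma dq: "real d / \<epsilon> \<le> 2 ^ q" using q_iff[of q] by simp

lemma two_le_ratio: "2 \<le> real d / \<epsilon>"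
proof -
  have "2 * \<epsilon> \<le> real d" using eps pos(2) by (simp add: order_trans[of "2 * \<epsilon>" 1 "real d"])
  then show ?thesis using eps by (simp add: pos_le_divide_eq)
qed

lemma q_pos: "0 < q" using q_iff[of 0] two_le_ratio by simp

definition Uf :: "nat \<Rightarrow> nat \<Rightarrow> real" where "Uf i t = (if i < n then U $$ (i, t) else 0)"

definition mix :: "(nat \<Rightarrow> real) \<Rightarrow> nat \<Rightarrow> real" where "mix z i = (\<Sum>t<d. Uf i t * z t)"

text \<open>What the program would compute if it were given \<open>U\<close> in place of A. Signs,
  transform and sampling act on rows from the left and so commute with the factor \<open>a.K\<close>
  on the right; the randomness can be analysed for orthonormal columns.\<close>

definition urows :: "(nat \<Rightarrow> nat) \<Rightarrow> nat \<Rightarrow> nat \<Rightarrow> real" where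
  "urows f v t = (if v < N then \<Sum>i<N. h v i * (sgn_of (f i) * Uf i t)
     else - (\<Sum>i<N. h (v - N) i * (sgn_of (f i) * Uf i t)))"

lemma mix_norm: "(\<Sum>i<N. (mix z i)\<^sup>2) = (\<Sum>t<d. (z t)\<^sup>2)"
proof -
  have "(\<Sum>i<N. (mix z i)\<^sup>2) = (\<Sum>i<n. (mix z i)\<^sup>2)"
    using nL by (intro sum.mono_neutral_right) (auto simp: mix_def Uf_def)
  also have "\<dots> = sqnorm (U *\<^sub>v vec d z)"
    using a.carriers(1)
    by (auto simp: scalar_prod_def mix_def Uf_def atLeast0LessThan power2_eq_square intro!: sum.cong)
  also have "\<dots> = sqnorm (vec d z)"
    by (rule sqnorm_isometry[OF a.carriers(1) a.orth(1)]) simp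
  finally show ?thesis by (simp add: scalar_prod_def atLeast0LessThan power2_eq_square)
qed

lemma urows_mix:
  assumes "v < N"
  shows "(\<Sum>t<d. urows f v t * z t) = (\<Sum>i<N. h v i * (sgn_of (f i) * mix z i))"
proof -
  have "(\<Sum>t<d. urows f v t * z t) = (\<Sum>t<d. \<Sum>i<N. h v i * (sgn_of (f i) * (Uf i t * z t)))"
    using assms by (simp add: urows_def sum_distrib_right mult.assoc)
  also have "\<dots> = (\<Sum>i<N. \<Sum>t<d. h v i * (sgn_of (f i) * (Uf i t * z t)))" by (rule sum.swap)
  finally show ?thesis by (simp add: mix_def sum_distrib_left)
qed

lemma Af_factor:
  assumes "j < d"
  shows "Af i j = (\<Sum>t<d. Uf i t * a.K $$ (t, j))"
proof (cases "i < n")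
  case True
  then have "A $$ (i, j) = (\<Sum>t<d. U $$ (i, t) * a.K $$ (t, j))"
    using assms a.carriers(1) a.KT_carrier(1) by (simp add: a.A_UK scalar_prod_def atLeast0LessThan)
  then show ?thesis using True assms by (simp add: Af Uf_def)
qed (simp add: Af Uf_def)

lemma rows_factor:
  assumes j: "j < d" and v: "v < 2 * N"
  shows "rows f v j = (\<Sum>t<d. urows f v t * a.K $$ (t, j))"
proof -
  have fht: "fht f L v j = (\<Sum>t<d. urows f v t * a.K $$ (t, j))" if v: "v < N" for v
  proof -
    have "fht f L v j = (\<Sum>i<N. h v i * (sgn_of (f i) * mix (\<lambda>t. a.K $$ (t, j)) i))"
      unfolding fht_def h_butterfly[OF v] x0_def Af_factor[OF j] mix_def ..
    then show ?thesis by (simp add: urows_mix[OF v])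
  qed
  show ?thesis
  proof (cases "v < N")
    case True
    then show ?thesis by (simp add: rows_def fht)
  next
    case False
    then have "rows f v j = - (\<Sum>t<d. urows f (v - N) t * a.K $$ (t, j))" using v by (simp add: rows_def fht)
    also have "\<dots> = (\<Sum>t<d. urows f v t * a.K $$ (t, j))"
      using False v unfolding sum_negf[symmetric] by (intro sum.cong) (auto simp: urows_def)
    finally show ?thesis .
  qed
qed

definition basis :: "nat \<Rightarrow> nat \<Rightarrow> real" where "basis j t = (if t = j then 1 else 0)"

text \<open>For a zero row the division by 0 yields the zero vector, which still has norm at most
  1.\<close>

definition unit_row :: "nat \<Rightarrow> nat \<Rightarrow> real" where
  "unit_row i t = U $$ (i, t) / sqrt (\<Sum>t<d. (U $$ (i, t))\<^sup>2)"

text \<open>The columns of \<open>U\<close> bound the single entries of the transformed matrix, as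
  the lower tail needs; the images of the normalized rows control the upper tail at the
  rows.\<close>

definition flat_vectors :: "(nat \<Rightarrow> real) set" where
  "flat_vectors = mix ` (basis ` {..<d} \<union> unit_row ` {..<n})"

definition flat_signs :: "(nat \<Rightarrow> nat) \<Rightarrow> bool" where
  "flat_signs f \<longleftrightarrow> (\<forall>w\<in>flat_vectors. \<forall>v<N. (\<Sum>i<N. h v i * (sgn_of (f i) * w i))\<^sup>2 \<le> 56 * real L)"

lemma card_flat_vectors: "finite flat_vectors" "card flat_vectors \<le> 2 * N"
proof -
  show "finite flat_vectors" by (simp add: flat_vectors_def)
  have "card flat_vectors \<le> card (basis ` {..<d} \<union> unit_row ` {..<n})"
    unfolding flat_vectors_def by (rule card_image_le) simp
  also have "\<dots> \<le> card (basis ` {..<d}) + card (unit_row ` {..<n})" by (rule card_Un_le)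
  also have "\<dots> \<le> d + n" using card_image_le[of "{..<d}" basis] card_image_le[of "{..<n}" unit_row] by simp
  finally show "card flat_vectors \<le> 2 * N" using dn nL by simp
qed

lemma flat_vectors_norm:
  assumes "w \<in> flat_vectors"
  shows "(\<Sum>i<N. (w i)\<^sup>2) \<le> 1"
proof -
  have 1: "(\<Sum>t<d. (basis j t)\<^sup>2) \<le> 1" for j
  proof -
    have "(\<Sum>t<d. (basis j t)\<^sup>2) = (\<Sum>t<d. if t = j then 1 else 0)" by (intro sum.cong) (auto simp: basis_def)
    then show ?thesis by simp
  qed
  have 2: "(\<Sum>t<d. (unit_row i t)\<^sup>2) \<le> 1" for i
  proof -
    let ?s = "\<Sum>t<d. (U $$ (i, t))\<^sup>2"
    have "0 \<le> ?s" by (intro sum_nonneg) auto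
    then have "(\<Sum>t<d. (unit_row i t)\<^sup>2) = ?s / ?s"
      by (simp add: unit_row_def power_divide flip: sum_divide_distrib)
    then show ?thesis by (simp add: divide_le_eq_1)
  qed
  show ?thesis using assms 1 2 by (auto simp: flat_vectors_def mix_norm)
qed

lemma exp_L: "real N \<le> exp (real L)"
  using two_power_le_exp[of L] by simp

lemma flat_prob: "prob signs {f. \<not> flat_signs f} \<le> 0.05"
proof -
  have "prob signs {f. \<exists>w\<in>flat_vectors. \<exists>v<N. 56 * real L < (\<Sum>i<N. h v i * (sgn_of (f i) * w i))\<^sup>2}
     \<le> real (card flat_vectors * N) * (2 * exp (- (56 * real L / 8)))"
    by (rule flat_all) (use card_flat_vectors flat_vectors_norm h_sq in auto)
  \<comment> \<open>Here 56 / 8 = 7: the flatness level makes each failure e^(-7 L), against at most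
    twice N^2 pairs with N \<le> e^L.\<close>
  also have "\<dots> \<le> (2 * exp (real L)) * exp (real L) * (2 * exp (- (7 * real L)))"
  proof (intro mult_mono)
    have "real (card flat_vectors) \<le> 2 * real N" using card_flat_vectors(2) by (metis of_nat_le_iff of_nat_mult of_nat_numeral)
    then have "real (card flat_vectors) * real N \<le> (2 * exp (real L)) * exp (real L)"
      using exp_L by (intro mult_mono) auto
    then show "real (card flat_vectors * N) \<le> (2 * exp (real L)) * exp (real L)" by simp
  qed auto
  also have "\<dots> = 4 * exp (- (5 * real L))" by (simp add: exp_minus field_simps flip: exp_add)
  also have "\<dots> \<le> 4 * exp (- 5)" using pos by simp
  also have "\<dots> \<le> 0.05" using exp_neg_numerals(2) by simp
  finally show ?thesis by (simp add: flat_signs_def not_le)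
qed

lemma embedding_flat:
  assumes f: "f \<in> set_pmf signs" and flat: "flat_signs f"
  shows "embedding N m d n L q r \<epsilon> (urows f) (\<lambda>i t. U $$ (i, t))"
proof
  have flatD: "(\<Sum>t<d. urows f v t * z t)\<^sup>2 \<le> 56 * real L"
    if "v < N" "z \<in> basis ` {..<d} \<union> unit_row ` {..<n}" for v z
    using flat that unfolding urows_mix[OF that(1)] flat_signs_def flat_vectors_def by blast
  show "0 < N" by simp
  show "0 < d" "0 < L" "0 < q" "n \<le> 2 ^ L" "real d / \<epsilon> \<le> 2 ^ q" "0 < \<epsilon>" "\<epsilon> \<le> 1 / 2" "m = 56 * d * L"
    using pos nL dq eps m_def q_pos by auto
  show "90000 * (real d * real q + (real L)\<^sup>2) / \<epsilon>\<^sup>2 \<le> real r" unfolding r_def by (rule real_nat_ceiling_ge)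
  show "urows f (N + v) t = - urows f v t" if "v < N" for v t using that by (simp add: urows_def)
  show "(\<Sum>v<N. (\<Sum>t<d. urows f v t * z t)\<^sup>2) = real N * (\<Sum>t<d. (z t)\<^sup>2)" for z
  proof -
    have "(sgn_of (f i) * mix z i)\<^sup>2 = (mix z i)\<^sup>2" if "i < N" for i
    proof -
      have "f i = 0 \<or> f i = 1" using f that by (force simp: set_Pi_pmf PiE_dflt_def)
      then show ?thesis by auto
    qed
    then have "(\<Sum>i<N. (sgn_of (f i) * mix z i)\<^sup>2) = (\<Sum>i<N. (mix z i)\<^sup>2)" by (intro sum.cong) auto
    then show ?thesis
      using h_norm[of "\<lambda>i. sgn_of (f i) * mix z i"] by (simp add: urows_mix mix_norm)
  qed
  show "(urows f v j)\<^sup>2 \<le> 56 * real L" if "v < N" "j < d" for v j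
  proof -
    have "(\<Sum>t<d. urows f v t * basis j t) = (\<Sum>t<d. if t = j then urows f v j else 0)"
      by (intro sum.cong) (auto simp: basis_def)
    then show ?thesis using flatD[of v "basis j"] that by simp
  qed
  show "(\<Sum>t<d. urows f v t * U $$ (i, t))\<^sup>2 \<le> 56 * real L * (\<Sum>t<d. (U $$ (i, t))\<^sup>2)" if "v < N" "i < n" for v i
  proof -
    define s where "s = (\<Sum>t<d. (U $$ (i, t))\<^sup>2)"
    have s0: "0 \<le> s" unfolding s_def by (intro sum_nonneg) auto
    show ?thesis
    proof (cases "s = 0")
      case True
      then have "U $$ (i, t) = 0" if "t < d" for t using that by (auto simp: s_def sum_nonneg_eq_0_iff)
      then show ?thesis by simp
    next
      case False
      then have s: "0 < s" using s0 by simp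
      have "(\<Sum>t<d. urows f v t * unit_row i t) = (\<Sum>t<d. urows f v t * U $$ (i, t)) / sqrt s"
        by (simp add: unit_row_def s_def sum_divide_distrib)
      then have "(\<Sum>t<d. urows f v t * U $$ (i, t))\<^sup>2 / s \<le> 56 * real L"
        using flatD[of v "unit_row i"] that s by (simp add: power_divide)
      then show ?thesis using s by (simp add: s_def[symmetric] pos_divide_le_eq)
    qed
  qed
qed

abbreviation phi :: "(nat \<Rightarrow> nat) \<Rightarrow> (nat \<Rightarrow> nat) \<Rightarrow> nat \<Rightarrow> nat \<Rightarrow> real" where
  "phi f \<equiv> embedding.\<Phi> m (urows f)"

definition embeds :: "(nat \<Rightarrow> nat) \<Rightarrow> (nat \<Rightarrow> nat) \<Rightarrow> bool" where
  "embeds f g \<longleftrightarrow>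
     (\<forall>z. (1 - \<epsilon> / 4) * (real r * real m) * (\<Sum>t<d. (z t)\<^sup>2) \<le> (\<Sum>b<r. (\<Sum>t<d. phi f g b t * z t)\<^sup>2)) \<and>
     (\<forall>i<n. (\<Sum>b<r. (\<Sum>t<d. phi f g b t * U $$ (i, t))\<^sup>2) \<le> (1 + \<epsilon> / 4) * (real r * real m) * (\<Sum>t<d. (U $$ (i, t))\<^sup>2))"

lemma embeds_prob:
  assumes "f \<in> set_pmf signs" "flat_signs f"
  shows "prob samples {g. \<not> embeds f g} \<le> 0.06"
  using embedding.embedding_prob[OF embedding_flat[OF assms]] unfolding embeds_def .

text \<open>With the SVD of the sketch, its squared norm is the form of the inverse Gram matrix at
  row \<open>i\<close> of A.\<close>

definition whitened :: "real mat \<Rightarrow> real mat \<Rightarrow> nat \<Rightarrow> nat \<Rightarrow> real" where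
  "whitened S' V' i l = (\<Sum>j<d. A $$ (i, j) * (V' $$ (j, l) / S' $$ (l, l)))"

definition projects :: "(nat \<Rightarrow> nat) \<Rightarrow> (nat \<Rightarrow> nat) \<Rightarrow> (nat \<Rightarrow> nat) \<Rightarrow> bool" where
  "projects f g hh \<longleftrightarrow> (case svd_of F (sketch_mat f g) of (U', S', V') \<Rightarrow> \<forall>i<n.
     (1 - \<epsilon> / 4) * real k * (\<Sum>l<d. (whitened S' V' i l)\<^sup>2) \<le> jl_sum k d hh (whitened S' V' i) \<and>
     jl_sum k d hh (whitened S' V' i) \<le> (1 + \<epsilon> / 4) * real k * (\<Sum>l<d. (whitened S' V' i l)\<^sup>2))"

lemma projects_prob: "prob projections {hh. \<not> projects f g hh} \<le> 0.03"
proof -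
  obtain U' S' V' where svd': "svd_of F (sketch_mat f g) = (U', S', V')" by (cases "svd_of F (sketch_mat f g)")
  let ?bad = "\<lambda>i. {hh. \<not> ((1 - \<epsilon> / 4) * real k * (\<Sum>l<d. (whitened S' V' i l)\<^sup>2) \<le> jl_sum k d hh (whitened S' V' i) \<and>
     jl_sum k d hh (whitened S' V' i) \<le> (1 + \<epsilon> / 4) * real k * (\<Sum>l<d. (whitened S' V' i l)\<^sup>2))}"
  have "{hh. \<not> projects f g hh} = (\<Union>i\<in>{..<n}. ?bad i)" by (auto simp: projects_def svd')
  then have "prob projections {hh. \<not> projects f g hh} = prob projections (\<Union>i\<in>{..<n}. ?bad i)" by (simp only:)
  also have "\<dots> \<le> real (card {..<n}) * (2 * exp (- (real k * (\<epsilon> / 4)\<^sup>2 / 20)))"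
    using eps by (intro prob_UN_le jl_vec) auto
  also have "\<dots> \<le> exp (real L) * (2 * exp (- (6 * real L)))"
  proof (intro mult_mono)
    have "real n \<le> real N" using nL by (simp only: of_nat_le_iff)
    then have "real n \<le> exp (real L)" using exp_L by (rule order_trans)
    then show "real (card {..<n}) \<le> exp (real L)" by simp
    have "2000 * real L / \<epsilon>\<^sup>2 \<le> real k" unfolding k_def by (rule real_nat_ceiling_ge)
    then have "2000 * real L \<le> real k * \<epsilon>\<^sup>2" using eps by (simp add: pos_divide_le_eq)
    moreover have "0 \<le> real L" by simp
    \<comment> \<open>320 = 16 * 20 stems from the tail exponent k (\<epsilon>/4)^2 / 20, and 2000 /
      320 > 6.\<close>
    ultimately have "6 * real L \<le> real k * \<epsilon>\<^sup>2 / 320" by linarith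
    then show "exp (- (real k * (\<epsilon> / 4)\<^sup>2 / 20)) \<le> exp (- (6 * real L))" by (simp add: power_divide)
  qed auto
  also have "\<dots> = 2 * exp (- (5 * real L))" by (simp add: mult.left_commute flip: exp_add)
  also have "\<dots> \<le> 2 * exp (- 5)" using pos by simp
  also have "\<dots> \<le> 0.03" using exp_neg_numerals(2) by simp
  finally show ?thesis .
qed

definition accurate :: "store \<Rightarrow> bool" where
  "accurate s \<longleftrightarrow> (\<forall>i<n. \<bar>leverage_score A i - reals s ''l'' i 0\<bar> \<le> \<epsilon> * leverage_score A i)"

text \<open>Both the score and its estimate lie within a relative error \<epsilon> / 4 of \<rho>
  \<tau>, so they differ by at most \<epsilon> \<rho> \<tau> / 2. Since \<epsilon> / 4 \<le> 1/2,
  the score is at least \<rho> \<tau> / 2, which makes the error relative to the score.\<close>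

lemma accurate_estimate:
  assumes f: "f \<in> set_pmf signs" "flat_signs f" and g: "g \<in> set_pmf samples" and emb: "embeds f g" and proj: "projects f g hh"
    and svd': "svd_of F (sketch_mat f g) = (U', S', V')"
    and out: "\<And>i. i < n \<Longrightarrow> reals s ''l'' i 0 = estimate_of hh S' V' i"
  shows "accurate s"
  unfolding accurate_def
proof (intro allI impI)
  fix i assume i: "i < n"
  define \<tau> where "\<tau> = (\<Sum>l<d. (whitened S' V' i l)\<^sup>2)"
  define \<rho> where "\<rho> = real r * real m"
  have \<rho>: "0 < \<rho>" using pos by (simp add: \<rho>_def)
  let ?\<Phi> = "Matrix.mat r d (\<lambda>(b, t). phi f g b t)"
  have phi_eq: "phi f g b t = (\<Sum>l<m. urows f (g (b * m + l)) t)" for b t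
    by (rule embedding.\<Phi>_def[OF embedding_flat[OF f]])
  \<comment> \<open>The sketch of A is the sketch of \<open>U\<close> times \<open>a.K\<close>,
    because every operation on the rows acts from the left.\<close>
  have B: "sketch_mat f g = ?\<Phi> * (S * transpose_mat V)"
  proof (rule eq_matI)
    fix b j assume "b < dim_row (?\<Phi> * (S * transpose_mat V))" "j < dim_col (?\<Phi> * (S * transpose_mat V))"
    then have bj: "b < r" "j < d" using a.carriers by auto
    have "Bf f g b j = (\<Sum>l<m. \<Sum>t<d. urows f (g (b * m + l)) t * a.K $$ (t, j))"
      unfolding Bf_def
    proof (rule sum.cong[OF refl])
      fix l assume "l \<in> {..<m}"
      then have "b * m + l < Suc b * m" by simp
      also have "\<dots> \<le> r * m" using bj by (intro mult_right_mono) auto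
      finally show "rows f (g (b * m + l)) j = (\<Sum>t<d. urows f (g (b * m + l)) t * a.K $$ (t, j))"
        by (intro rows_factor bj samples_bound[OF g])
    qed
    also have "\<dots> = (\<Sum>t<d. \<Sum>l<m. urows f (g (b * m + l)) t * a.K $$ (t, j))" by (rule sum.swap)
    also have "\<dots> = (\<Sum>t<d. phi f g b t * a.K $$ (t, j))" by (simp add: phi_eq sum_distrib_right)
    also have "\<dots> = (?\<Phi> * a.K) $$ (b, j)"
      using bj a.KT_carrier(1) by (simp add: scalar_prod_def atLeast0LessThan)
    finally show "sketch_mat f g $$ (b, j) = (?\<Phi> * (S * transpose_mat V)) $$ (b, j)"
      using bj by (simp add: a.K_def)
  qed (use a.carriers in auto)
  have apply_phi: "sqnorm (?\<Phi> *\<^sub>v z) = (\<Sum>b<r. (\<Sum>t<d. phi f g b t * z $ t)\<^sup>2)" if "z \<in> carrier_vec d" for z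
    using that by (auto simp: scalar_prod_def atLeast0LessThan power2_eq_square intro!: sum.cong)
  have row_U: "row U i \<in> carrier_vec d" "t < d \<Longrightarrow> row U i $ t = U $$ (i, t)" for t
    using a.carriers(1) i by auto
  have lev: "(1 - \<epsilon> / 4) * \<rho> * \<tau> \<le> leverage_score A i" "leverage_score A i \<le> (1 + \<epsilon> / 4) * \<rho> * \<tau>"
  proof -
    have thin: "thin_svd (sketch_mat f g) U' S' V'" by (rule thin_svd_sketch[OF svd'])
    have lower: "(1 - \<epsilon> / 4) * \<rho> * sqnorm z \<le> sqnorm (?\<Phi> *\<^sub>v z)" if z: "z \<in> carrier_vec d" for z
    proof -
      have "sqnorm z = (\<Sum>t<d. (z $ t)\<^sup>2)" using z by (simp add: scalar_prod_def atLeast0LessThan power2_eq_square)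
      then show ?thesis using emb unfolding apply_phi[OF z] embeds_def \<rho>_def by simp
    qed
    have "sqnorm (row U i) = (\<Sum>t<d. (U $$ (i, t))\<^sup>2)"
      using row_U a.carriers(1) by (simp add: scalar_prod_def atLeast0LessThan power2_eq_square)
    moreover have "(\<Sum>b<r. (\<Sum>t<d. phi f g b t * row U i $ t)\<^sup>2) = (\<Sum>b<r. (\<Sum>t<d. phi f g b t * U $$ (i, t))\<^sup>2)"
      using row_U by (intro sum.cong refl arg_cong[where f = "\<lambda>x. x\<^sup>2"]) auto
    ultimately have upper: "sqnorm (?\<Phi> *\<^sub>v row U i) \<le> (1 + \<epsilon> / 4) * \<rho> * sqnorm (row U i)"
      using emb i unfolding apply_phi[OF row_U(1)] embeds_def \<rho>_def by simp
    have "?\<Phi> \<in> carrier_mat r d" "0 \<le> \<epsilon> / 4" "\<epsilon> / 4 < 1" using eps by auto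
    from sketched_leverage[OF svd thin this(1) B \<rho> this(2,3) i lower upper]
    show "(1 - \<epsilon> / 4) * \<rho> * \<tau> \<le> leverage_score A i" "leverage_score A i \<le> (1 + \<epsilon> / 4) * \<rho> * \<tau>"
      by (simp_all add: score[OF i] \<tau>_def whitened_def)
  qed
  have est: "estimate_of hh S' V' i = \<rho> / real k * jl_sum k d hh (whitened S' V' i)"
  proof -
    have "(\<Sum>j<d. Af i j * Wf hh S' V' c j) = (\<Sum>l<d. sgn_of (hh (c * d + l)) * whitened S' V' i l)" for c
    proof -
      have "(\<Sum>j<d. Af i j * Wf hh S' V' c j)
          = (\<Sum>j<d. \<Sum>l<d. sgn_of (hh (c * d + l)) * (A $$ (i, j) * (V' $$ (j, l) / S' $$ (l, l))))"
        using i by (intro sum.cong refl) (auto simp: Af Wf_def sum_distrib_left intro!: sum.cong)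
      also have "\<dots> = (\<Sum>l<d. \<Sum>j<d. sgn_of (hh (c * d + l)) * (A $$ (i, j) * (V' $$ (j, l) / S' $$ (l, l))))"
        by (rule sum.swap)
      finally show ?thesis by (simp add: whitened_def sum_distrib_left)
    qed
    then show ?thesis by (simp add: estimate_of_def \<rho>_def sum_distrib_left)
  qed
  have kpos: "0 < real k" using pos by simp
  have "(1 - \<epsilon> / 4) * real k * \<tau> \<le> jl_sum k d hh (whitened S' V' i)"
    "jl_sum k d hh (whitened S' V' i) \<le> (1 + \<epsilon> / 4) * real k * \<tau>"
    using proj i unfolding projects_def svd' \<tau>_def by auto
  then have "\<rho> / real k * ((1 - \<epsilon> / 4) * real k * \<tau>) \<le> estimate_of hh S' V' i"
    "estimate_of hh S' V' i \<le> \<rho> / real k * ((1 + \<epsilon> / 4) * real k * \<tau>)"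
    unfolding est using \<rho> kpos by (intro mult_left_mono; simp)+
  moreover have "\<rho> / real k * ((1 - \<epsilon> / 4) * real k * \<tau>) = \<rho> * \<tau> - \<epsilon> / 4 * (\<rho> * \<tau>)"
    "\<rho> / real k * ((1 + \<epsilon> / 4) * real k * \<tau>) = \<rho> * \<tau> + \<epsilon> / 4 * (\<rho> * \<tau>)"
    using kpos by (simp_all add: field_simps)
  moreover have "\<rho> * \<tau> - \<epsilon> / 4 * (\<rho> * \<tau>) \<le> leverage_score A i" "leverage_score A i \<le> \<rho> * \<tau> + \<epsilon> / 4 * (\<rho> * \<tau>)"
    using lev by (simp_all add: algebra_simps)
  moreover have "\<epsilon> * (\<rho> * \<tau> / 2) = 2 * (\<epsilon> / 4 * (\<rho> * \<tau>))" by simp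
  ultimately have "\<bar>leverage_score A i - estimate_of hh S' V' i\<bar> \<le> \<epsilon> * (\<rho> * \<tau> / 2)"
    by (intro abs_leI) linarith+
  also have "\<dots> \<le> \<epsilon> * leverage_score A i"
  proof (intro mult_left_mono)
    have "0 \<le> \<rho> * \<tau>" using \<rho> by (simp add: \<tau>_def sum_nonneg)
    then have "\<epsilon> / 4 * (\<rho> * \<tau>) \<le> 1 / 2 * (\<rho> * \<tau>)" using eps by (intro mult_right_mono) auto
    then show "\<rho> * \<tau> / 2 \<le> leverage_score A i" using \<open>\<rho> * \<tau> - \<epsilon> / 4 * (\<rho> * \<tau>) \<le> leverage_score A i\<close> by linarith
  qed (use eps in simp)
  finally show "\<bar>leverage_score A i - reals s ''l'' i 0\<bar> \<le> \<epsilon> * leverage_score A i" by (simp add: out[OF i])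
qed

lemma fails_randomize_accurate:
  assumes "params s"
  shows "fails_with F randomize s (2 ^ L * 17 + r * m * 23 + k * d * 17 + 33 + estimate_time) accurate 0.2"
proof -
  have "fails_with F randomize s (2 ^ L * 17 + r * m * 23 + k * d * 17 + 33 + estimate_time) accurate (0.05 + (0.06 + 0.03))"
    by (rule fails_randomize[where ?G1.0 = flat_signs and ?G2.0 = embeds and ?G3.0 = projects, OF assms])
       (use flat_prob embeds_prob projects_prob accurate_estimate in auto)
  then show ?thesis by (rule fails_with_mono) auto
qed

definition total_time :: nat where
  "total_time = 1 + (L * 50 + 50) + (1 + (q * 50 + 50) + (1 +
     ((r + 1) * 50 + (m + 1) * 50 + (k + 1) * 50 + (r * m + 1) * 50 + (k * d + 1) * 50 + 10) +
     (2 ^ L * 17 + r * m * 23 + k * d * 17 + 33 + estimate_time)))"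

lemma fails_program:
  "fails_with F leverage_program (input_store A \<epsilon>) total_time accurate 0.2"
proof -
  have init: "base (input_store A \<epsilon>) \<and> ints (input_store A \<epsilon>) ''L'' 0 = 0 \<and> ints (input_store A \<epsilon>) ''q'' 0 = 0"
    unfolding base_def using A
    by (auto simp: input_store_def write_mat_def set_real_def set_int_def Af fun_eq_iff)
  show ?thesis unfolding leverage_program_def total_time_def
    by (rule fails_with_Seq[OF tri_log_n[OF L_iff] init fails_with_Seq[OF tri_log_d_eps[OF q_iff] _
          fails_with_Seq[OF tri_sizes[OF r_def m_def k_def] _ fails_randomize_accurate]]]) assumption+
qed

text \<open>Every term is dominated by one of the four leading costs: d \<le> m turns r d^2 into r m
  d, and d < n turns k d^2 into n k d.\<close>

lemma total_time_le: "total_time \<le> 2000 * (L * N * d + r * m * d + n * k * d + q)"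
proof -
  define a where "a = L * N * d"
  define b where "b = r * m * d"
  define c where "c = n * k * d"
  have N1: "1 \<le> N" by simp
  have dm: "d \<le> m" using pos(3) by (simp add: m_def)
  have mono: "x \<le> y * x" if "1 \<le> y" for x y :: nat using that by simp
  have a: "1 \<le> a" "L \<le> a" "N \<le> a" "N * d \<le> a" "L * (N * d) \<le> a"
    unfolding a_def using pos N1 by (auto simp: Suc_le_eq)
  have b: "1 \<le> b" "r \<le> b" "m \<le> b" "r * m \<le> b" "r * d\<^sup>2 \<le> b"
    unfolding b_def using pos dm by (auto simp: Suc_le_eq power2_eq_square)
  have c: "1 \<le> c" "k \<le> c" "k * d \<le> c" "k * d * d \<le> c" "n * k * (d * 150) = c * 150"
  proof -
    have "k * d * d \<le> n * (k * d)" using dn by (simp add: mult.commute)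
    then show "1 \<le> c" "k \<le> c" "k * d \<le> c" "k * d * d \<le> c" "n * k * (d * 150) = c * 150"
      unfolding c_def using pos by (auto simp: Suc_le_eq mult.assoc)
  qed
  \<comment> \<open>Products are replaced by fresh variables, so that what remains is linear
    arithmetic.\<close>
  have arith: "1 + (L * 50 + 50) + (1 + (q * 50 + 50) + (1 +
     ((r + 1) * 50 + (m + 1) * 50 + (k + 1) * 50 + (rm + 1) * 50 + (kd + 1) * 50 + 10) +
     (N' * 17 + rm * 23 + kd * 17 + 33 + (Nd * 160 + LNd + b * 120 + rd + kdd * 140 + c * 150 + 11)))) \<le> 2000 * (a + b + c + q)"
    if "1 \<le> a" "L \<le> a" "N' \<le> a" "Nd \<le> a" "LNd \<le> a * 273" "1 \<le> b" "r \<le> b" "m \<le> b" "rm \<le> b" "rd \<le> b"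
      "1 \<le> c" "k \<le> c" "kd \<le> c" "kdd \<le> c" for a b c L N' Nd LNd r m rm rd k kd kdd q :: nat
    using that by (simp add: algebra_simps)
  have "L * (N * d * 273) \<le> a * 273" using a(5) by simp
  then show ?thesis
    unfolding total_time_def estimate_time_def a_def[symmetric] b_def[symmetric] c_def[symmetric] c(5)
    by (intro arith a b c(1-4))
qed

section \<open>Comparison of the running time with the budget\<close>

lemma L_le: "real L \<le> 4 * ln (real n)"
proof (rule log_bound)
  show "2 ^ (L - 1) < real n" using L_iff[of "L - 1"] pos by (simp flip: of_nat_less_iff)
qed (use pos dn in auto)

lemma q_le: "real q \<le> 4 * ln (real d / \<epsilon>)"
  using log_bound[OF two_le_ratio q_pos] q_iff[of "q - 1"] q_pos by simp

text \<open>Absorbs the cost d^2 L^3 / \<epsilon>^2 caused by the summand L^2 in \<open>r\<close>.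
  If d < L^2, the left-hand side is at most L^4 = 4096 (L/8)^4, and L/8 is written as 1 + x/4 with x
  = L/2 - 4 to use (1 + x/4)^4 \<le> exp x. Finally exp (1/2) \<le> 2 and 2^L \<le> 2 n.\<close>

lemma d_L_square: "real d * (real L)\<^sup>2 \<le> (real d)\<^sup>2 + 8192 * real n"
proof (cases "(real L)\<^sup>2 \<le> real d")
  case True
  then have "real d * (real L)\<^sup>2 \<le> real d * real d" by (intro mult_left_mono) auto
  then show ?thesis by (simp add: power2_eq_square)
next
  case False
  then have "real d * (real L)\<^sup>2 \<le> (real L)\<^sup>2 * (real L)\<^sup>2" by (intro mult_right_mono) auto
  also have "\<dots> = 4096 * (1 + (real L / 2 - 4) / real 4) ^ 4"
    by (simp add: field_simps power2_eq_square power4_eq_xxxx)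
  also have "(1 + (real L / 2 - 4) / real 4) ^ 4 \<le> exp (real L / 2 - 4)"
    using pos by (intro exp_ge_one_plus_x_over_n_power_n) auto
  also have "\<dots> \<le> exp (real L * (1 / 2))" by simp
  also have "\<dots> = exp (1 / 2) ^ L" by (simp only: exp_of_nat_mult)
  also have "\<dots> \<le> 2 ^ L"
    using exp_bound[of "1 / 2"] by (intro power_mono) (auto simp: power2_eq_square)
  also have "\<dots> \<le> 2 * real n"
  proof -
    have "2 ^ (L - 1) < real n" using L_iff[of "L - 1"] pos by (simp flip: of_nat_less_iff)
    then show ?thesis using power_Suc[of "2::real" "L - 1"] pos by simp
  qed
  finally show ?thesis by (simp add: add_increasing)
qed

lemma real_total_time_le:
  "real total_time \<le> 16 * 10 ^ 14 * (budget n d \<epsilon>)"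
proof -
  define Y where "Y = real n * real d * real L / \<epsilon>\<^sup>2"
  define Z where "Z = real d ^ 3 * real L * real q / \<epsilon>\<^sup>2"
  define e where "e = 1 / \<epsilon>\<^sup>2"
  have e1: "1 \<le> e"
  proof -
    have "\<epsilon>\<^sup>2 \<le> 1\<^sup>2" using eps by (intro power_mono) auto
    then show ?thesis using eps by (simp add: e_def)
  qed
  have real1: "1 \<le> real n" "1 \<le> real d" "1 \<le> real L" "1 \<le> real q" using pos q_pos by auto
  have X1: "real (L * N * d) \<le> 2 * Y"
  proof -
    have "2 ^ (L - 1) < real n" using L_iff[of "L - 1"] pos by (simp flip: of_nat_less_iff)
    then have "real N \<le> 2 * real n" using power_Suc[of "2::real" "L - 1"] pos by simp
    then have "real L * real d * real N \<le> real L * real d * (2 * real n)" by (intro mult_left_mono) auto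
    also have "\<dots> \<le> real L * real d * (2 * real n) * e" using e1 mult_left_mono[OF e1, of "real L * real d * (2 * real n)"] by simp
    also have "\<dots> = 2 * Y" by (simp add: Y_def e_def)
    finally show ?thesis by (simp add: mult_ac)
  qed
  have X3: "real (n * k * d) \<le> 2001 * Y"
  proof -
    have "0 \<le> 2000 * real L * e" using e1 by simp
    then have "real k \<le> 2000 * real L * e + 1" unfolding k_def e_def by (simp add: of_nat_nat)
    moreover have "1 * 1 \<le> real L * e" using real1 e1 by (intro mult_mono) auto
    ultimately have "real k \<le> 2001 * (real L * e)" by linarith
    then have "real n * real d * real k \<le> real n * real d * (2001 * (real L * e))" by (intro mult_left_mono) auto
    then show ?thesis by (simp add: Y_def e_def mult_ac)
  qed
  have X2: "real (r * m * d) \<le> 5040056 * (2 * Z + 8192 * Y)"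
  proof -
    let ?w = "real d * real q + (real L)\<^sup>2"
    have "1 * 1 \<le> real d * real q" using real1 by (intro mult_mono) auto
    then have "1 \<le> ?w" by (simp add: add_increasing2)
    then have we: "1 * 1 \<le> ?w * e" using e1 by (intro mult_mono) auto
    have "real r \<le> 90000 * ?w / \<epsilon>\<^sup>2 + 1" unfolding r_def using we by (simp add: of_nat_nat e_def)
    moreover have "90000 * ?w / \<epsilon>\<^sup>2 = 90000 * (?w * e)" by (simp add: e_def)
    ultimately have "real r \<le> 90001 * (?w * e)" using we by linarith
    then have "real r * (56 * (real d)\<^sup>2 * real L) \<le> 90001 * (?w * e) * (56 * (real d)\<^sup>2 * real L)"
      by (intro mult_right_mono) auto
    \<comment> \<open>5040056 = 90001 * 56, where 90001 includes the rounding of \<open>r\<close>;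
      the second summand is the one that \<open>d_L_square\<close> handles.\<close>
    also have "\<dots> = 5040056 * (Z + real d * real L * e * (real d * (real L)\<^sup>2))"
      by (simp add: Z_def e_def power2_eq_square power3_eq_cube algebra_simps add_divide_distrib)
    also have "real d * real L * e * (real d * (real L)\<^sup>2) \<le> real d * real L * e * ((real d)\<^sup>2 + 8192 * real n)"
      using e1 by (intro mult_left_mono d_L_square) auto
    also have "\<dots> = real d ^ 3 * real L * e + 8192 * Y"
      by (simp add: Y_def e_def power2_eq_square power3_eq_cube algebra_simps add_divide_distrib)
    also have "real d ^ 3 * real L * e \<le> real d ^ 3 * real L * e * real q"
      using mult_left_mono[OF real1(4), of "real d ^ 3 * real L * e"] e1 by simp
    also have "\<dots> = Z" by (simp add: Z_def e_def)
    finally show ?thesis by (simp add: m_def power2_eq_square mult_ac)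
  qed
  have X4: "real q \<le> Z"
  proof -
    have "1 \<le> real d ^ 3" using real1 by simp
    then have "1 * 1 * 1 \<le> real d ^ 3 * real L * e" using real1 e1 by (intro mult_mono) auto
    then have "1 * real q \<le> real d ^ 3 * real L * e * real q" by (intro mult_right_mono) auto
    then show ?thesis by (simp add: Z_def e_def)
  qed
  have YZ: "0 \<le> Y" "0 \<le> Z" by (simp_all add: Y_def Z_def)
  have "real total_time \<le> real (2000 * (L * N * d + r * m * d + n * k * d + q))"
    using total_time_le by (simp only: of_nat_le_iff)
  also have "\<dots> = 2000 * (real (L * N * d) + real (r * m * d) + real (n * k * d) + real q)"
    by (simp only: of_nat_add of_nat_mult of_nat_numeral)
  \<comment> \<open>The largest coefficient is that of \<open>Y\<close>, dominated by 2000 * 5040056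
    * 8192, about 8.3 * 10^13.\<close>
  also have "\<dots> \<le> 10 ^ 14 * (Y + Z)" using X1 X2 X3 X4 YZ by simp
  \<comment> \<open>16 = 4 * 4 from the two logarithms in \<open>Z\<close>; the same factor is used
    for \<open>Y\<close>.\<close>
  also have "\<dots> \<le> 10 ^ 14 * (16 * (real n * real d * ln (real n) / \<epsilon>\<^sup>2) + 16 * (real d ^ 3 * ln (real n) * ln (real d / \<epsilon>) / \<epsilon>\<^sup>2))"
  proof (intro mult_left_mono add_mono)
    have ln0: "0 \<le> ln (real n)" using real1 by simp
    have "Y \<le> real n * real d * (16 * ln (real n)) / \<epsilon>\<^sup>2"
      unfolding Y_def using L_le ln0 by (intro divide_right_mono mult_left_mono) auto
    then show "Y \<le> 16 * (real n * real d * ln (real n) / \<epsilon>\<^sup>2)" by (simp add: mult_ac)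
    have "real L * real q \<le> (4 * ln (real n)) * (4 * ln (real d / \<epsilon>))"
      using L_le q_le ln0 by (intro mult_mono) auto
    then have "real d ^ 3 * (real L * real q) / \<epsilon>\<^sup>2 \<le> real d ^ 3 * ((4 * ln (real n)) * (4 * ln (real d / \<epsilon>))) / \<epsilon>\<^sup>2"
      by (intro divide_right_mono mult_left_mono) auto
    then show "Z \<le> 16 * (real d ^ 3 * ln (real n) * ln (real d / \<epsilon>) / \<epsilon>\<^sup>2)" by (simp add: Z_def mult_ac)
  qed simp
  also have "\<dots> = 16 * 10 ^ 14 * (0 + real n * real d * ln (real n) / \<epsilon>\<^sup>2 + real d ^ 3 * ln (real n) * ln (real d / \<epsilon>) / \<epsilon>\<^sup>2)"
    by (simp only: distrib_left mult.assoc mult.left_commute[of 16] add_0_left)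
  also have "\<dots> \<le> 16 * 10 ^ 14 * (budget n d \<epsilon>)"
    using two_le_ratio by (intro mult_left_mono add_right_mono) auto
  finally show ?thesis .
qed

end

section \<open>From failure bounds to runs of the machine\<close>

lemma fails_with_run:
  assumes "fails_with F P (input_store A \<epsilon>) T Q p"
  shows "\<exists>N. (\<forall>cfg\<in>set_pmf (run F N (start P A \<epsilon>)). halted cfg \<and> time_spent cfg \<le> T) \<and>
    prob (run F N (start P A \<epsilon>)) {cfg. Q (fst (snd cfg))} \<ge> 1 - p"
proof -
  obtain D where D: "exec F P (input_store A \<epsilon>) T D" "prob D {s. \<not> Q s} \<le> p"
    using assms unfolding fails_with_def by (elim exE conjE)
  obtain N where N: "\<forall>cfg\<in>set_pmf (run F N (start P A \<epsilon>)). halted cfg \<and> time_spent cfg \<le> T"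
    "map_pmf (\<lambda>cfg. fst (snd cfg)) (run F N (start P A \<epsilon>)) = D"
    using exec_run[OF D(1)] unfolding start_def by blast
  have "prob (run F N (start P A \<epsilon>)) {cfg. Q (fst (snd cfg))} = prob D {s. Q s}"
    unfolding N(2)[symmetric] by (simp add: vimage_def)
  also have "\<dots> = 1 - prob D {s. \<not> Q s}"
    using measure_pmf.prob_compl[of "{s. \<not> Q s}" D] by (simp add: Diff_eq Collect_neg_eq[symmetric] Compl_eq)
  finally show ?thesis using N(1) D(2) by (intro exI[of _ N]) simp
qed

lemma leverage_run_exists:
  assumes F: "valid_factorizer F" and d: "1 \<le> d" "d < n" and A: "A \<in> carrier_mat n d"
    and rank: "vec_space.rank n A = d" and eps: "0 < \<epsilon>" "\<epsilon> \<le> 1 / 2"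
  shows "\<exists>L q r m k Af U S V h. leverage_run F n d L q r m k \<epsilon> Af A U S V h"
proof -
  define L where "L = (LEAST j. n \<le> 2 ^ j)"
  define q where "q = (LEAST j. real d / \<epsilon> \<le> 2 ^ j)"
  define r where "r = nat \<lceil>90000 * (real d * real q + (real L)\<^sup>2) / \<epsilon>\<^sup>2\<rceil>"
  define k where "k = nat \<lceil>2000 * real L / \<epsilon>\<^sup>2\<rceil>"
  have L_iff: "j < L \<longleftrightarrow> 2 ^ j < n" for j
  proof
    assume "j < L"
    then show "2 ^ j < n" unfolding L_def using not_less_Least by (metis not_le)
  next
    assume j: "2 ^ j < n"
    have "n \<le> 2 ^ n" by (rule less_imp_le) (rule less_exp)
    then have "n \<le> 2 ^ L" unfolding L_def by (rule LeastI)
    then have "(2::nat) ^ j < 2 ^ L" using j by linarith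
    then show "j < L" by simp
  qed
  have q_iff: "j < q \<longleftrightarrow> 2 ^ j < real d / \<epsilon>" for j
  proof
    assume "j < q"
    then show "2 ^ j < real d / \<epsilon>" unfolding q_def using not_less_Least by (metis not_le)
  next
    assume j: "2 ^ j < real d / \<epsilon>"
    obtain i where "real d / \<epsilon> < 2 ^ i" using real_arch_pow[of 2 "real d / \<epsilon>"] by auto
    then have "real d / \<epsilon> \<le> 2 ^ i" by simp
    then have "real d / \<epsilon> \<le> 2 ^ q" unfolding q_def by (rule LeastI)
    then have "(2::real) ^ j < 2 ^ q" using j by linarith
    then show "j < q" by simp
  qed
  have L: "1 \<le> L" using L_iff[of 0] d by simp
  have "\<epsilon> < real d" using eps d by simp
  then have q: "1 \<le> q" using q_iff[of 0] eps by (simp add: pos_less_divide_eq)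
  have e1: "1 \<le> 1 / \<epsilon>\<^sup>2"
  proof -
    have "\<epsilon>\<^sup>2 \<le> 1\<^sup>2" using eps by (intro power_mono) auto
    then show ?thesis using eps by simp
  qed
  \<comment> \<open>The factorization primitive acts only on matrices with at least as many rows as
    columns, so the sketch must not be wide.\<close>
  have dr: "d \<le> r"
  proof -
    have "real d * 1 \<le> real d * real q" using q by (intro mult_left_mono) auto
    then have "real d \<le> 90000 * (real d * real q + (real L)\<^sup>2)" by (simp add: add_increasing2)
    then have "real d * 1 \<le> 90000 * (real d * real q + (real L)\<^sup>2) * (1 / \<epsilon>\<^sup>2)"
      using e1 by (intro mult_mono) auto
    also have "\<dots> \<le> real r" unfolding r_def by (simp add: real_nat_ceiling_ge)
    finally show ?thesis by simp
  qed
  have "1 * 1 \<le> 2000 * real L * (1 / \<epsilon>\<^sup>2)" using L e1 by (intro mult_mono) auto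
  also have "\<dots> \<le> real k" unfolding k_def by (simp add: real_nat_ceiling_ge)
  finally have k: "1 \<le> k" by simp
  have m: "1 \<le> 56 * d * L" using d L by simp
  obtain U S V where svd: "thin_svd A U S V" "\<And>i. i < n \<Longrightarrow> leverage_score A i = sqnorm (row U i)"
    using leverage_score_svd[OF F A] d by (metis less_imp_le)
  have full: "full_rank_svd A U S V n d"
    using A svd(1) full_rank_injective[OF A rank] by unfold_locales
  obtain h :: "nat \<Rightarrow> nat \<Rightarrow> real" where h: "\<And>k i. (h k i)\<^sup>2 = 1"
    "\<And>x k. k < 2 ^ L \<Longrightarrow> (butterfly (2 ^ (L - 1)) ^^ L) x k = (\<Sum>i<2 ^ L. h k i * x i)"
    "\<And>x. (\<Sum>k<2 ^ L. (\<Sum>i<2 ^ L. h k i * x i)\<^sup>2) = 2 ^ L * (\<Sum>i<2 ^ L. (x i)\<^sup>2)"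
    using butterflies_hadamard[of L] L by auto
  have "leverage_run F n d L q r (56 * d * L) k \<epsilon> (\<lambda>i j. if i < n \<and> j < d then A $$ (i, j) else 0) A U S V h"
    by (intro leverage_run.intro machine_run.intro leverage_run_axioms.intro)
       (fact F A d L k m dr svd(2) full h L_iff q_iff eps r_def k_def refl
        | use d dr in linarith)+
  then show ?thesis by blast
qed

lemma leverage_program_correct:
  assumes "valid_factorizer F" "1 \<le> d" "d < n" "A \<in> carrier_mat n d" "vec_space.rank n A = d" "0 < \<epsilon>" "\<epsilon> \<le> 1 / 2"
  shows "\<exists>N. (\<forall>cfg \<in> set_pmf (run F N (start leverage_program A \<epsilon>)).
            halted cfg \<and> (real n \<le> exp (real d) \<longrightarrow> real (time_spent cfg) \<le> 16 * 10 ^ 14 * (budget n d \<epsilon>))) \<and>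
          prob (run F N (start leverage_program A \<epsilon>))
            {cfg. \<forall>i<n. \<bar>leverage_score A i - returned_score cfg i\<bar> \<le> \<epsilon> * leverage_score A i} \<ge> 0.8"
proof -
  obtain L q r m k Af U S V h where "leverage_run F n d L q r m k \<epsilon> Af A U S V h"
    using leverage_run_exists[OF assms] by (elim exE)
  then interpret leverage_run F n d L q r m k \<epsilon> Af A U S V h .
  obtain N where N: "\<forall>cfg\<in>set_pmf (run F N (start leverage_program A \<epsilon>)). halted cfg \<and> time_spent cfg \<le> total_time"
    "prob (run F N (start leverage_program A \<epsilon>)) {cfg. accurate (fst (snd cfg))} \<ge> 1 - 0.2"
    using fails_with_run[OF fails_program] by blast
  have time: "real (time_spent cfg) \<le> 16 * 10 ^ 14 * (budget n d \<epsilon>)" if "time_spent cfg \<le> total_time" for cfg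
    by (rule order_trans[OF _ real_total_time_le]) (use that in simp)
  show ?thesis
    by (rule exI[of _ N]) (use N time in \<open>auto simp: accurate_def returned_score_def\<close>)
qed

theorem theorem1:
  shows "\<exists>(P :: com) (C :: real). 0 < C \<and>
    (\<forall>(F :: factorizer) (n :: nat) (d :: nat) (A :: real mat) (\<epsilon> :: real).
       valid_factorizer F \<and> 1 \<le> d \<and> d < n \<and>
       A \<in> carrier_mat n d \<and> vec_space.rank n A = d \<and>
       0 < \<epsilon> \<and> \<epsilon> \<le> 1 / 2 \<longrightarrow>
       (\<exists>N. (\<forall>cfg \<in> set_pmf (run F N (start P A \<epsilon>)).
               halted cfg \<and>
               (real n \<le> exp (real d) \<longrightarrow>
                  real (time_spent cfg) \<le>
                    C * (real n * real d * ln (real d / \<epsilon>)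
                         + real n * real d * ln (real n) / \<epsilon>\<^sup>2
                         + real d ^ 3 * ln (real n) * ln (real d / \<epsilon>) / \<epsilon>\<^sup>2))) \<and>
            measure_pmf.prob (run F N (start P A \<epsilon>))
              {cfg. \<forall>i<n. \<bar>leverage_score A i - returned_score cfg i\<bar> \<le> \<epsilon> * leverage_score A i}
              \<ge> 0.8))"
  by (rule exI[of _ leverage_program], rule exI[of _ "16 * 10 ^ 14"], rule conjI, simp, intro allI impI,
      rule leverage_program_correct) auto

end
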